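(* Let $f_0:\mathbb{R}^n\to\mathbb{R}$ and $F:\mathbb{R}^n\to\mathbb{R}^m$ be twice continuously differentiable, $g:\mathbb{R}^m\to\overline{\mathbb{R}}$ lower semicontinuous proper convex, and $f:=f_0+g\circ F$. Let $\bar x\in\operatorname{dom}(g\circ F)$ be a tilt-stable local minimizer of $f$ with modulus $\kappa>0$ satisfying the KKT conditions (there is $\mu\in\partial g(F(\bar x))$ with $\nabla_xL(\bar x,\mu)=0$). Assume: (1) there is a neighborhood of $\bar x$ such that for every $x$ in it and every $\mu\in\partial g(F(x))$, $g$ is parabolically regular at $F(x)$ for $\mu$ and parabolically epi-differentiable at $F(x)$ for every $d$ with $dg(F(x))(d)=\langle\mu,d\rangle$; (2) $g$ is locally Lipschitz around $F(\bar x)$ relative to $\operatorname{dom}g$ with constant $\ell\ge0$, and there are $\kappa_0>0$ and a neighborhood $\mathcal{U}$ of $\bar x$ with $\operatorname{dist}(x',\operatorname{dom}(g\circ F))\le\kappa_0\operatorname{dist}(F(x'),\operatorname{dom}g)$ for all $x'\in\mathcal{U}$; (3) for every $\mu\in\partial g(F(\bar x))$ there exists $\overline{W}=\overline W_\mu\in\partial_B\operatorname{Prox}_g(F(\bar x)+\mu)$ with $\bigcup_{V\in\mathcal{J}\operatorname{Prox}_g(F(\bar x)+\mu)}\operatorname{rge}V=\operatorname{rge}\overline{W}$ such that every $y$ in this union satisfies $y=\overline{W}\bar z$ for some $\bar z$ with $\min_{z\in\mathbb{R}^m,\,y=Vz,\,V\in\mathcal{J}\operatorname{Prox}_g(F(\bar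 x)+\mu)}\langle y,z-y\rangle=\langle y,\bar z-y\rangle=\langle y,(\overline{W}^\dagger-I)y\rangle$; (4) for any nonzero $w\in\mathcal{K}(\bar x,-\nabla f_0(\bar x))$, any $\mu\in\Lambda(\bar x,-\nabla f_0(\bar x);w)\cap\tau(\bar x,-\nabla f_0(\bar x))\mathbb{B}_{\mathbb{R}^m}$ and any $v$ with $\nabla F(\bar x)v\in\operatorname{dom}\Gamma_g(F(\bar x),\mu)$, there exist $(x^k,\mu^k)\to(\bar x,\mu)$ with $\mu^k\in\partial g(F(x^k))$, $z^k\to(\overline{W}_\mu^\dagger-I)\nabla F(\bar x)v$ and $v^k\to v$ such that $(z^k,-\nabla F(x^k)v^k)\in\widehat{\mathcal{N}}_{\operatorname{gph}\partial g}(F(x^k),\mu^k)$ and $\Lambda(x^k,\nabla F(x^k)^T\mu^k)$ is a singleton. Then $$\langle v,\nabla^2_{xx}L(\bar x,\mu)v\rangle+\Gamma_g(F(\bar x),\mu)(\nabla F(\bar x)v)\ge\frac1\kappa\|v\|^2\quad\text{for all } v\neq0 \text{ with } \nabla F(\bar x)v\in\bigcup_{V\in\mathcal{J}\operatorname{Prox}_g(F(\bar x)+\mu)}\operatorname{rge}V$$ for every $\mu\in\bigcup_{0\neq w\in\mathcal{K}(\bar x,-\nabla f_0(\bar x))}\Lambda(\bar x,-\nabla f_0(\bar x);w)\cap\tau(\bar x,-\nabla f_0(\bar x))\mathbb{B}_{\mathbb{R}^m}$.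
   Context: $L(x,\mu):=f_0(x)+\langle F(x),\mu\rangle$. $dg(y)(d):=\liminf_{t\downarrow0,\,d'\to d}\frac{g(y+td')-g(y)}{t}$; $d^{2}g(y,\mu)(d):=\liminf_{\tau\downarrow0,\,d'\to d}\frac{g(y+\tau d')-g(y)-\tau\langle \mu,d'\rangle}{\tau^2/2}$; for $d$ with $dg(y)(d)$ finite, $d^{2}g(y)(d,w):=\liminf_{t\downarrow0,\,w'\to w}\frac{g(y+td+\frac12t^2w')-g(y)-t\,dg(y)(d)}{t^2/2}$. Parabolic epi-differentiability at $y$ for $d$: $\operatorname{dom}d^2g(y)(d,\cdot)\neq\emptyset$ and for every $w$, $t_k\downarrow0$ there are $w_k\to w$ with $d^2g(y)(d,w)=\lim_k\frac{g(y+t_kd+\frac12t_k^2w_k)-g(y)-t_k\,dg(y)(d)}{t_k^2/2}$; parabolic regularity at $y$ for $\mu$: $\inf_w\{d^2g(y)(d,w)-\langle\mu,w\rangle\}=d^2g(y,\mu)(d)$ for all $d$. $\widehat{\mathcal{N}}_C$ is the Fréchet regular normal cone. $\operatorname{Prox}_g(y):=\operatorname{argmin}_z\{g(z)+\frac12\|z-y\|^2\}$; $\partial_B$ B-subdifferential, $\mathcal{J}:=\operatorname{conv}\partial_B$; $\operatorname{rge}V$ range, $V^\dagger$ Moore–Penrose inverse. SOVF: $\Gamma_g(y,\mu)(v):=\min_{d,\,v=Vd,\,V\in\mathcal{J}\operatorname{Prox}_g(y+\mu)}\langle v,d-v\rangle$ if $v\in\bigcup_{V\in\mathcal{J}\operatorname{Prox}_g(y+\mu)}\operatorname{rge}V$,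 $\infty$ otherwise; its domain is where it is finite. For $x^*\in\nabla F(x)^T\partial g(F(x))$: $\Lambda(x,x^* ):=\{\mu\in\partial g(F(x))\mid x^*=\nabla F(x)^T\mu\}$; $\mathcal{K}(x,x^* ):=\{d\mid dg(F(x))(\nabla F(x)d)=\langle x^*,d\rangle\}$; for $v\in\mathcal{K}(x,x^* )$, $\Lambda(x,x^*;v):=\operatorname{argmax}_{\mu\in\Lambda(x,x^* )}(\langle\mu,\nabla^2F(x)(v,v)\rangle+d^2g(F(x),\mu)(\nabla F(x)v))$ with $\nabla^2F(x)(v,v)_i=v^T\nabla^2F_i(x)v$; $\tau(x,x^* ):=\kappa_0\ell\|\nabla F(x)\|+\kappa_0\|x^*\|+\ell$. $\bar x$ is a tilt-stable local minimizer of $f$ with modulus $\kappa$ if for some $\delta>0$ the map $M_\delta(u):=\operatorname{argmin}_{\|x'-\bar x\|\le\delta}\{f(x')-f(\bar x)-\langle u,x'-\bar x\rangle\}$ is single-valued and Lipschitz with modulus $\kappa$ on a neighborhood of $u=0$ and $M_\delta(0)=\{\bar x\}$. *)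

theory Defs
  imports "HOL-Analysis.Analysis"
begin

definition jac :: "(real^'n \<Rightarrow> real^'m) \<Rightarrow> real^'n \<Rightarrow> real^'n^'m" where
  "jac F x = matrix (frechet_derivative F (at x))"

definition grad :: "(real^'n \<Rightarrow> real) \<Rightarrow> real^'n \<Rightarrow> real^'n" where
  "grad f x = (\<chi> i. frechet_derivative f (at x) (axis i 1))"

definition C2_fun :: "(real^'n \<Rightarrow> real) \<Rightarrow> bool" where
  "C2_fun f \<longleftrightarrow> (\<forall>x. f differentiable (at x)) \<and> (\<forall>x. grad f differentiable (at x)) \<and>
     (\<forall>h. continuous_on UNIV (\<lambda>x. frechet_derivative (grad f) (at x) h))"

definition C2_map :: "(real^'n \<Rightarrow> real^'m) \<Rightarrow> bool" where
  "C2_map F \<longleftrightarrow> (\<forall>x. F differentiable (at x)) \<and> (\<forall>x. jac F differentiable (at x)) \<and>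
     (\<forall>h. continuous_on UNIV (\<lambda>x. frechet_derivative (jac F) (at x) h))"

definition hessq :: "(real^'n \<Rightarrow> real) \<Rightarrow> real^'n \<Rightarrow> real^'n \<Rightarrow> real" where
  "hessq f x v = frechet_derivative (grad f) (at x) v \<bullet> v"

text \<open>\<open>\<nabla>\<^sup>2F(x)(v,v)\<close>, with i-th component \<open>v\<^sup>T \<nabla>\<^sup>2F\<^sub>i(x) v\<close>.\<close>
definition d2F :: "(real^'n \<Rightarrow> real^'m) \<Rightarrow> real^'n \<Rightarrow> real^'n \<Rightarrow> real^'m" where
  "d2F F x v = frechet_derivative (jac F) (at x) v *v v"

definition edom :: "('a \<Rightarrow> ereal) \<Rightarrow> 'a set" where
  "edom g = {y. g y < \<infinity>}"

definition lsc :: "('a::topological_space \<Rightarrow> ereal) \<Rightarrow> bool" where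
  "lsc g \<longleftrightarrow> (\<forall>y. g y \<le> Liminf (at y) g)"

definition proper :: "('a \<Rightarrow> ereal) \<Rightarrow> bool" where
  "proper g \<longleftrightarrow> (\<forall>y. g y \<noteq> -\<infinity>) \<and> edom g \<noteq> {}"

definition econvex :: "('a::real_vector \<Rightarrow> ereal) \<Rightarrow> bool" where
  "econvex g \<longleftrightarrow> convex {(y, t::real). g y \<le> ereal t}"

definition subdiff :: "('a::real_inner \<Rightarrow> ereal) \<Rightarrow> 'a \<Rightarrow> 'a set" where
  "subdiff g y = {\<mu>. \<bar>g y\<bar> \<noteq> \<infinity> \<and> (\<forall>z. g y + ereal (\<mu> \<bullet> (z - y)) \<le> g z)}"

definition gph_subdiff :: "('a::real_inner \<Rightarrow> ereal) \<Rightarrow> ('a \<times> 'a) set" where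
  "gph_subdiff g = {(y, \<mu>). \<mu> \<in> subdiff g y}"

definition subderiv :: "('a::real_normed_vector \<Rightarrow> ereal) \<Rightarrow> 'a \<Rightarrow> 'a \<Rightarrow> ereal" where
  "subderiv g y d = Liminf (at_right 0 \<times>\<^sub>F nhds d)
     (\<lambda>(t, d'). (g (y + t *\<^sub>R d') - g y) / ereal t)"

definition subderiv2 :: "('a::real_inner \<Rightarrow> ereal) \<Rightarrow> 'a \<Rightarrow> 'a \<Rightarrow> 'a \<Rightarrow> ereal" where
  "subderiv2 g y \<mu> d = Liminf (at_right 0 \<times>\<^sub>F nhds d)
     (\<lambda>(t, d'). (g (y + t *\<^sub>R d') - g y - ereal (t * (\<mu> \<bullet> d'))) / ereal (t\<^sup>2 / 2))"

text \<open>Parabolic difference quotient and parabolic subderivative \<open>d\<^sup>2g(y)(d,w)\<close>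
  (meaningful when \<open>dg(y)(d)\<close> is finite).\<close>
definition parab_quot :: "('a::real_normed_vector \<Rightarrow> ereal) \<Rightarrow> 'a \<Rightarrow> 'a \<Rightarrow> real \<Rightarrow> 'a \<Rightarrow> ereal" where
  "parab_quot g y d t w' = (g (y + t *\<^sub>R d + (t\<^sup>2 / 2) *\<^sub>R w') - g y - ereal t * subderiv g y d)
      / ereal (t\<^sup>2 / 2)"

definition parab_subderiv :: "('a::real_normed_vector \<Rightarrow> ereal) \<Rightarrow> 'a \<Rightarrow> 'a \<Rightarrow> 'a \<Rightarrow> ereal" where
  "parab_subderiv g y d w = Liminf (at_right 0 \<times>\<^sub>F nhds w) (\<lambda>(t, w'). parab_quot g y d t w')"

definition parab_epi_diff :: "('a::real_normed_vector \<Rightarrow> ereal) \<Rightarrow> 'a \<Rightarrow> 'a \<Rightarrow> bool" where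
  "parab_epi_diff g y d \<longleftrightarrow> \<bar>subderiv g y d\<bar> \<noteq> \<infinity> \<and>
     (\<exists>w. parab_subderiv g y d w < \<infinity>) \<and>
     (\<forall>w t. (\<forall>k. t k > 0) \<and> t \<longlonglongrightarrow> 0 \<longrightarrow>
        (\<exists>wk. wk \<longlonglongrightarrow> w \<and> (\<lambda>k. parab_quot g y d (t k) (wk k)) \<longlonglongrightarrow> parab_subderiv g y d w))"

definition parab_regular :: "('a::real_inner \<Rightarrow> ereal) \<Rightarrow> 'a \<Rightarrow> 'a \<Rightarrow> bool" where
  "parab_regular g y \<mu> \<longleftrightarrow> (\<forall>d. subderiv2 g y \<mu> d < \<infinity> \<longrightarrow>
     (INF w. parab_subderiv g y d w - ereal (\<mu> \<bullet> w)) = subderiv2 g y \<mu> d)"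

definition frechet_normal :: "'a::real_inner set \<Rightarrow> 'a \<Rightarrow> 'a set" where
  "frechet_normal C p = {v. \<forall>\<epsilon>>0. \<exists>\<delta>>0. \<forall>p'\<in>C. norm (p' - p) < \<delta> \<longrightarrow>
      v \<bullet> (p' - p) \<le> \<epsilon> * norm (p' - p)}"

definition prox :: "(real^'m \<Rightarrow> ereal) \<Rightarrow> real^'m \<Rightarrow> real^'m" where
  "prox g y = (THE z. \<forall>z'. g z + ereal ((norm (z - y))\<^sup>2 / 2) \<le> g z' + ereal ((norm (z' - y))\<^sup>2 / 2))"

definition Bsubdiff :: "(real^'m \<Rightarrow> real^'m) \<Rightarrow> real^'m \<Rightarrow> (real^'m^'m) set" where
  "Bsubdiff P y = {V. \<exists>yk. yk \<longlonglongrightarrow> y \<and> (\<forall>k. P differentiable (at (yk k))) \<and>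
      (\<lambda>k. jac P (yk k)) \<longlonglongrightarrow> V}"

definition Clarke_jac :: "(real^'m \<Rightarrow> real^'m) \<Rightarrow> real^'m \<Rightarrow> (real^'m^'m) set" where
  "Clarke_jac P y = convex hull (Bsubdiff P y)"

definition rge :: "real^'m^'k \<Rightarrow> (real^'k) set" where
  "rge V = range (\<lambda>z. V *v z)"

definition pinv :: "real^'m^'k \<Rightarrow> real^'k^'m" where
  "pinv V = (THE X. V ** X ** V = V \<and> X ** V ** X = X \<and>
      transpose (V ** X) = V ** X \<and> transpose (X ** V) = X ** V)"

definition SOVF :: "(real^'m \<Rightarrow> ereal) \<Rightarrow> real^'m \<Rightarrow> real^'m \<Rightarrow> real^'m \<Rightarrow> ereal" where
  "SOVF g y \<mu> v = (if v \<in> (\<Union>V\<in>Clarke_jac (prox g) (y + \<mu>). rge V)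
     then (INF dV \<in> {(d, V). V \<in> Clarke_jac (prox g) (y + \<mu>) \<and> v = V *v d}.
             ereal (v \<bullet> (fst dV - v)))
     else \<infinity>)"

definition Lambda :: "(real^'m \<Rightarrow> ereal) \<Rightarrow> (real^'n \<Rightarrow> real^'m) \<Rightarrow> real^'n \<Rightarrow> real^'n \<Rightarrow> (real^'m) set" where
  "Lambda g F x xs = {\<mu>\<in>subdiff g (F x). xs = transpose (jac F x) *v \<mu>}"

definition crit_cone :: "(real^'m \<Rightarrow> ereal) \<Rightarrow> (real^'n \<Rightarrow> real^'m) \<Rightarrow> real^'n \<Rightarrow> real^'n \<Rightarrow> (real^'n) set" where
  "crit_cone g F x xs = {d. subderiv g (F x) (jac F x *v d) = ereal (xs \<bullet> d)}"

definition Lambda_dir :: "(real^'m \<Rightarrow> ereal) \<Rightarrow> (real^'n \<Rightarrow> real^'m) \<Rightarrow> real^'n \<Rightarrow> real^'n \<Rightarrow> real^'n \<Rightarrow> (real^'m) set" where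
  "Lambda_dir g F x xs v = {\<mu>\<in>Lambda g F x xs. \<forall>\<mu>'\<in>Lambda g F x xs.
      ereal (\<mu>' \<bullet> d2F F x v) + subderiv2 g (F x) \<mu>' (jac F x *v v)
        \<le> ereal (\<mu> \<bullet> d2F F x v) + subderiv2 g (F x) \<mu> (jac F x *v v)}"

definition tau :: "real \<Rightarrow> real \<Rightarrow> (real^'n \<Rightarrow> real^'m) \<Rightarrow> real^'n \<Rightarrow> real^'n \<Rightarrow> real" where
  "tau \<kappa>0 ell F x xs = \<kappa>0 * ell * onorm (\<lambda>v. jac F x *v v) + \<kappa>0 * norm xs + ell"

definition tilt_M :: "(real^'n \<Rightarrow> ereal) \<Rightarrow> real^'n \<Rightarrow> real \<Rightarrow> real^'n \<Rightarrow> (real^'n) set" where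
  "tilt_M f xb \<delta> u = {x\<in>cball xb \<delta>. \<forall>x'\<in>cball xb \<delta>.
      f x - f xb - ereal (u \<bullet> (x - xb)) \<le> f x' - f xb - ereal (u \<bullet> (x' - xb))}"

definition tilt_stable :: "(real^'n \<Rightarrow> ereal) \<Rightarrow> real^'n \<Rightarrow> real \<Rightarrow> bool" where
  "tilt_stable f xb \<kappa> \<longleftrightarrow> (\<exists>\<delta>>0. \<exists>\<epsilon>>0.
      (\<forall>u\<in>ball 0 \<epsilon>. \<exists>x. tilt_M f xb \<delta> u = {x}) \<and>
      (\<forall>u\<in>ball 0 \<epsilon>. \<forall>u'\<in>ball 0 \<epsilon>. \<forall>x x'. tilt_M f xb \<delta> u = {x} \<and> tilt_M f xb \<delta> u' = {x'}
          \<longrightarrow> dist x x' \<le> \<kappa> * dist u u') \<and>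
      tilt_M f xb \<delta> 0 = {xb})"

end

theory Submission
  imports Defs
begin

text \<open>
  The inequality is proved at the points \<open>(x\<^sup>k, \<mu>\<^sup>k, z\<^sup>k, v\<^sup>k)\<close> of assumption (4) and then passed to the
  limit. At such a point two bounds on the second subderivative of \<open>g\<close> at \<open>F x\<^sup>k\<close> for \<open>\<mu>\<^sup>k\<close> in the
  direction \<open>- \<nabla>F(x\<^sup>k) v\<^sup>k\<close> are combined.

  Upper bound \<open>\<langle>z\<^sup>k, \<nabla>F(x\<^sup>k) v\<^sup>k\<rangle>\<close>: a tangent \<open>(a, b)\<close> to the graph of \<open>\<partial>g\<close> has \<open>2 b\<close> as a subgradient
  at \<open>a\<close> of the second subderivative, which is therefore at most \<open>\<langle>a, b\<rangle>\<close> there. Resolvents provide tangents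
  with \<open>a + \<rho> b = - \<nabla>F(x\<^sup>k) v\<^sup>k\<close>; test the regular normal against them and let \<open>\<rho>\<close> tend to zero.

  Lower bound \<open>\<parallel>v\<^sup>k\<parallel>\<^sup>2 / \<kappa> - \<langle>v\<^sup>k, \<nabla>\<^sup>2\<^sub>x\<^sub>x L(x\<^sup>k, \<mu>\<^sup>k) v\<^sup>k\<rangle>\<close>: tilt stability yields quadratic growth of
  \<open>f\<close> at every KKT pair near \<open>(xb, 0)\<close>. Inserting parabolic arcs, corrected back into the domain by
  metric subregularity, gives a penalized inequality for the convex parabolic subderivative. Convex
  separation turns the penalty into a multiplier \<open>\<eta>\<close>, which belongs to \<open>\<Lambda>(x\<^sup>k, \<nabla>F(x\<^sup>k)\<^sup>T \<mu>\<^sup>k)\<close>; since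
  this set is a singleton, \<open>\<eta> = \<mu>\<^sup>k\<close>, and parabolic regularity concludes.
\<close>

section \<open>Lower limits and lower semicontinuity\<close>

lemma Liminf_le_Liminf_compose:
  fixes h :: "'a \<Rightarrow> 'b::complete_linorder"
  assumes "filterlim \<phi> G F"
  shows "Liminf G h \<le> Liminf F (\<lambda>x. h (\<phi> x))"
  unfolding le_Liminf_iff
  using assms by (auto dest!: less_LiminfD intro: eventually_compose_filterlim)

lemma Liminf_le_limit:
  fixes h :: "'a \<Rightarrow> 'b::{complete_linorder, linorder_topology}"
  assumes "filterlim \<phi> G F" "F \<noteq> bot" "\<forall>\<^sub>F x in F. h (\<phi> x) \<le> c x" "(c \<longlongrightarrow> l) F"
  shows "Liminf G h \<le> l"
proof -
  have "Liminf G h \<le> Liminf F (\<lambda>x. h (\<phi> x))"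
    using assms(1) by (rule Liminf_le_Liminf_compose)
  also have "\<dots> \<le> Liminf F c"
    using assms(3) by (rule Liminf_mono)
  also have "\<dots> = l"
    using assms(2,4) by (rule lim_imp_Liminf)
  finally show ?thesis .
qed

lemma at_right_prod_nhds:
  "at_right (0::real) \<times>\<^sub>F nhds d = inf (nhds (0, d)) (principal ({0<..} \<times> UNIV))"
proof (rule filter_eqI, rule iffI)
  fix P assume "eventually P (at_right (0::real) \<times>\<^sub>F nhds d)"
  then show "eventually P (inf (nhds (0::real, d)) (principal ({0<..} \<times> UNIV)))"
    unfolding eventually_inf_principal nhds_prod eventually_prod_filter at_within_def by auto
next
  fix P assume "eventually P (inf (nhds (0::real, d)) (principal ({0<..} \<times> UNIV)))"
  then obtain Q R where "eventually Q (nhds 0)" "eventually R (nhds d)"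
      "\<And>t d'. Q t \<Longrightarrow> R d' \<Longrightarrow> 0 < t \<Longrightarrow> P (t, d')"
    unfolding eventually_inf_principal nhds_prod eventually_prod_filter by auto
  then show "eventually P (at_right (0::real) \<times>\<^sub>F nhds d)"
    unfolding eventually_prod_filter at_within_def eventually_inf_principal
    by (intro exI[of _ "\<lambda>t. 0 < t \<and> Q t"] exI[of _ R]) (auto elim: eventually_mono)
qed

lemma eventually_at_right_prod_nhds:
  "\<forall>\<^sub>F (t, d') in at_right (0::real) \<times>\<^sub>F nhds d. 0 < t"
  unfolding at_right_prod_nhds eventually_inf_principal by (rule always_eventually) auto

lemma at_right_prod_nhds_neq_bot [simp]: "at_right (0::real) \<times>\<^sub>F nhds d \<noteq> bot"
  by (simp add: prod_filter_eq_bot)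

lemma filterlim_at_right_prod_nhds:
  fixes t :: "'i \<Rightarrow> real"
  assumes "\<forall>\<^sub>F k in F. 0 < t k" "(t \<longlongrightarrow> 0) F" "(dk \<longlongrightarrow> d) F"
  shows "filterlim (\<lambda>k. (t k, dk k)) (at_right 0 \<times>\<^sub>F nhds d) F"
  using assms by (intro filterlim_Pair) (auto simp: filterlim_at elim: eventually_mono)

lemma positive_null_sequence:
  obtains t :: "nat \<Rightarrow> real" where "\<And>k. 0 < t k" "t \<longlonglongrightarrow> 0"
  using LIMSEQ_inverse_real_of_nat by (rule that[rotated]) simp

lemma frequently_at_right_prod_sequence:
  fixes d :: "'a::first_countable_topology"
  assumes "\<exists>\<^sub>F p in at_right (0::real) \<times>\<^sub>F nhds d. P p"
  obtains t dk where "\<And>k. 0 < t k" "t \<longlonglongrightarrow> 0" "dk \<longlonglongrightarrow> d" "\<And>k. P (t k, dk k)"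
proof -
  let ?S = "{0<..} \<times> UNIV \<inter> Collect P"
  have "\<not> (\<forall>\<^sub>F p in inf (nhds (0, d)) (principal ?S). False)"
    using assms by (simp add: frequently_def at_right_prod_nhds eventually_inf_principal)
  then obtain p :: "nat \<Rightarrow> real \<times> 'a" where p: "\<And>k. p k \<in> ?S" "p \<longlonglongrightarrow> (0, d)"
    unfolding eventually_nhds_within_iff_sequentially by blast
  show thesis
  proof (rule that)
    show "(\<lambda>k. fst (p k)) \<longlonglongrightarrow> 0" "(\<lambda>k. snd (p k)) \<longlonglongrightarrow> d"
      using tendsto_fst[OF p(2)] tendsto_snd[OF p(2)] by simp_all
    show "0 < fst (p k)" "P (fst (p k), snd (p k))" for k
      using p(1)[of k] by auto
  qed
qed

lemma frequently_less_of_Liminf_less: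
  fixes h :: "'a \<Rightarrow> 'b::complete_linorder"
  assumes "Liminf F h < C"
  shows "\<exists>\<^sub>F x in F. h x < C"
  using assms Liminf_bounded[of C h F] by (auto simp: frequently_def not_less)

lemma lsc_Liminf_prod_nhds:
  fixes h :: "'b \<times> 'a::topological_space \<Rightarrow> ereal"
  shows "lsc (\<lambda>a. Liminf (F \<times>\<^sub>F nhds a) h)"
  unfolding lsc_def le_Liminf_iff[of "Liminf _ _"]
proof (intro allI impI)
  fix a c assume "c < Liminf (F \<times>\<^sub>F nhds a) h"
  then obtain c' where c': "c < c'" "c' < Liminf (F \<times>\<^sub>F nhds a) h"
    using dense by blast
  obtain P Q where P: "eventually P F" and Q: "\<forall>\<^sub>F a' in nhds a. eventually Q (nhds a')"
    and PQ: "\<And>x y. P x \<Longrightarrow> Q y \<Longrightarrow> c' < h (x, y)"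
    using less_LiminfD[OF c'(2)] unfolding eventually_prod_filter eventually_eventually by blast
  have "c < Liminf (F \<times>\<^sub>F nhds a') h" if "eventually Q (nhds a')" for a'
  proof -
    have "\<forall>\<^sub>F p in F \<times>\<^sub>F nhds a'. c' \<le> h p"
      unfolding eventually_prod_filter using P that PQ less_imp_le by blast
    then show ?thesis
      using c'(1) Liminf_bounded less_le_trans by blast
  qed
  then show "\<forall>\<^sub>F a' in at a. c < Liminf (F \<times>\<^sub>F nhds a') h"
    using Q by (auto simp: eventually_at_filter elim: eventually_mono)
qed

lemma lsc_le_Liminf_nhds:
  assumes "lsc g"
  shows "g a \<le> Liminf (nhds a) g"
  using assms unfolding lsc_def le_Liminf_iff eventually_nhds_conv_at by auto

lemma lsc_le_limit:
  assumes "lsc g" "(x \<longlongrightarrow> a) F" "F \<noteq> bot" "\<forall>\<^sub>F k in F. g (x k) \<le> c k" "(c \<longlongrightarrow> l) F"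
  shows "g a \<le> l"
  using lsc_le_Liminf_nhds[OF assms(1)] Liminf_le_limit[OF assms(2-5)] by (rule order_trans)

lemma lsc_add_continuous:
  fixes q :: "'a::topological_space \<Rightarrow> real"
  assumes "lsc g" "continuous_on UNIV q"
  shows "lsc (\<lambda>z. g z + ereal (q z))"
  unfolding lsc_def
proof
  fix a
  show "g a + ereal (q a) \<le> Liminf (at a) (\<lambda>z. g z + ereal (q z))"
  proof (cases "at a = bot")
    case False
    have "g a + ereal (q a) \<le> Liminf (at a) (\<lambda>z. g z + ereal (q z)) + ereal e" if "e > 0" for e
    proof -
      have "(q \<longlongrightarrow> q a) (at a)"
        using assms(2) by (simp add: continuous_on_def)
      then have "\<forall>\<^sub>F z in at a. q a - e < q z"
        using that by (intro order_tendstoD(1)) auto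
      then have "\<forall>\<^sub>F z in at a. g z + ereal (q a - e) \<le> g z + ereal (q z)"
        by eventually_elim (auto intro: add_left_mono)
      from Liminf_mono[OF this]
      have "Liminf (at a) g + ereal (q a - e) \<le> Liminf (at a) (\<lambda>z. g z + ereal (q z))"
        using False by (simp add: Liminf_add_ereal_right)
      moreover have "g a + ereal (q a - e) \<le> Liminf (at a) g + ereal (q a - e)"
        using assms(1) by (auto simp: lsc_def intro: add_right_mono)
      ultimately have "g a + ereal (q a - e) + ereal e
          \<le> Liminf (at a) (\<lambda>z. g z + ereal (q z)) + ereal e"
        by (intro add_right_mono) (rule order_trans)
      then show ?thesis
        by (simp add: add.assoc)
    qed
    then show ?thesis
      by (rule ereal_le_epsilon2) auto
  qed simp
qed

lemma lsc_attains_inf: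
  fixes g :: "'a::metric_space \<Rightarrow> ereal"
  assumes "lsc g" "compact K" "K \<noteq> {}"
  obtains x where "x \<in> K" "\<And>z. z \<in> K \<Longrightarrow> g x \<le> g z"
proof -
  obtain v where v: "\<And>k. v k \<in> g ` K" "v \<longlonglongrightarrow> Inf (g ` K)"
    using Inf_as_limit[of "g ` K"] assms(3) by blast
  then have "\<forall>k. \<exists>x\<in>K. v k = g x"
    by blast
  then obtain x where x: "\<And>k. x k \<in> K" "\<And>k. v k = g (x k)"
    by metis
  obtain a \<phi> where a: "a \<in> K" "strict_mono \<phi>" "(x \<circ> \<phi>) \<longlonglongrightarrow> a"
    using assms(2) x(1) by (metis compact_eq_seq_compact_metric seq_compactE)
  have "g a \<le> Inf (g ` K)"
    using lsc_le_limit[OF assms(1) a(3) _ _ LIMSEQ_subseq_LIMSEQ[OF v(2) a(2)]] x(2) by simp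
  then show thesis
    using a(1) by (intro that) (auto simp: le_INF_iff)
qed

section \<open>Subgradients and proximal points\<close>

lemma power2_norm_add_scaleR:
  fixes x y :: "'a::real_inner"
  shows "(norm (x + u *\<^sub>R y))\<^sup>2 = (norm x)\<^sup>2 + 2 * u * (x \<bullet> y) + u\<^sup>2 * (norm y)\<^sup>2"
  unfolding power2_norm_eq_inner inner_add_left inner_add_right inner_scaleR_left inner_scaleR_right
    inner_commute[of y x] by (simp add: algebra_simps power2_eq_square)

lemma norm_le_norm_add_scaleR:
  fixes a b :: "'a::real_inner"
  assumes "0 \<le> a \<bullet> b" "0 \<le> r"
  shows "norm a \<le> norm (a + r *\<^sub>R b)"
proof (rule power2_le_imp_le)
  show "(norm a)\<^sup>2 \<le> (norm (a + r *\<^sub>R b))\<^sup>2"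
    unfolding power2_norm_add_scaleR using assms by simp
qed simp

lemma nonpos_if_le_small_multiples:
  fixes a b :: real
  assumes "\<And>u. 0 < u \<Longrightarrow> u < 1 \<Longrightarrow> a \<le> u * b"
  shows "a \<le> 0"
proof (rule tendsto_lowerbound)
  show "((\<lambda>u. u * b) \<longlongrightarrow> 0) (at_right 0)"
    by (intro tendsto_mult_left_zero) simp
  show "\<forall>\<^sub>F u in at_right 0. a \<le> u * b"
    unfolding eventually_at_right_field using assms by (intro exI[of _ 1]) auto
qed simp

lemma econvexD:
  assumes "econvex g" "g a \<le> ereal \<alpha>" "g b \<le> ereal \<beta>" "0 \<le> u" "u \<le> 1"
  shows "g ((1 - u) *\<^sub>R a + u *\<^sub>R b) \<le> ereal ((1 - u) * \<alpha> + u * \<beta>)"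
proof -
  have "(1 - u) *\<^sub>R (a, \<alpha>) + u *\<^sub>R (b, \<beta>) \<in> {(y, t::real). g y \<le> ereal t}"
    using assms unfolding econvex_def by (intro convexD_alt) auto
  then show ?thesis by simp
qed

lemma subdiffE:
  assumes "\<mu> \<in> subdiff g y"
  obtains gy where "g y = ereal gy" "\<And>z. ereal (gy + \<mu> \<bullet> (z - y)) \<le> g z"
  using assms unfolding subdiff_def by (cases "g y") auto

lemma subdiffI:
  assumes "g y = ereal gy" "\<And>z r. g z \<le> ereal r \<Longrightarrow> gy + \<mu> \<bullet> (z - y) \<le> r"
  shows "\<mu> \<in> subdiff g y"
  unfolding subdiff_def
proof (intro CollectI conjI allI)
  show "g y + ereal (\<mu> \<bullet> (z - y)) \<le> g z" for z
    by (rule ereal_le_real) (use assms in auto)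
qed (use assms in auto)

lemma subdiff_monotone:
  assumes "\<mu> \<in> subdiff g y" "\<mu>' \<in> subdiff g y'"
  shows "0 \<le> (\<mu>' - \<mu>) \<bullet> (y' - y)"
proof -
  obtain a where a: "g y = ereal a" "\<And>z. ereal (a + \<mu> \<bullet> (z - y)) \<le> g z"
    by (rule subdiffE[OF assms(1)]) blast
  obtain b where b: "g y' = ereal b" "\<And>z. ereal (b + \<mu>' \<bullet> (z - y')) \<le> g z"
    by (rule subdiffE[OF assms(2)]) blast
  have "a + \<mu> \<bullet> (y' - y) \<le> b" "b + \<mu>' \<bullet> (y - y') \<le> a"
    using a(2)[of y'] b(2)[of y] a(1) b(1) by auto
  then show ?thesis by (simp add: inner_diff_left inner_diff_right)
qed

lemma affine_plus_quadratic_coercive: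
  fixes \<mu> y z p :: "'a::real_inner"
  assumes "0 < \<rho>" and far: "norm (y - p) + 2 * \<rho> * norm \<mu> \<le> norm (z - p)"
  shows "(norm (y - p))\<^sup>2 / (2 * \<rho>) \<le> \<mu> \<bullet> (z - y) + (norm (z - p))\<^sup>2 / (2 * \<rho>)"
proof -
  define n where "n = norm (z - p)"
  define D where "D = norm (y - p)"
  have "2 * \<rho> * norm \<mu> * (n + D) \<le> (n - D) * (n + D)"
    using far by (intro mult_right_mono) (auto simp: n_def D_def)
  then have "norm \<mu> * (n + D) \<le> n\<^sup>2 / (2 * \<rho>) - D\<^sup>2 / (2 * \<rho>)"
    using \<open>0 < \<rho>\<close> by (simp add: field_simps power2_eq_square)
  moreover have "- (\<mu> \<bullet> (z - y)) \<le> norm \<mu> * (n + D)"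
  proof -
    have "norm (z - y) \<le> n + D"
      using norm_triangle_ineq4[of "z - p" "y - p"] by (simp add: n_def D_def)
    then have "norm \<mu> * norm (z - y) \<le> norm \<mu> * (n + D)"
      by (intro mult_left_mono) auto
    then show ?thesis
      using Cauchy_Schwarz_ineq2[of \<mu> "z - y"] by linarith
  qed
  ultimately show ?thesis
    unfolding n_def D_def by linarith
qed

lemma proximal_point_exists:
  fixes g :: "'a::euclidean_space \<Rightarrow> ereal"
  assumes lsc: "lsc g" and sub: "\<mu> \<in> subdiff g y" and "0 < \<rho>"
  obtains l where "\<And>z. g l + ereal ((norm (l - p))\<^sup>2 / (2 * \<rho>)) \<le> g z + ereal ((norm (z - p))\<^sup>2 / (2 * \<rho>))"
proof -
  define q where "q z = (norm (z - p))\<^sup>2 / (2 * \<rho>)" for z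
  define R where "R = norm (y - p) + 2 * \<rho> * norm \<mu>"
  obtain gy where gy: "g y = ereal gy" "\<And>z. ereal (gy + \<mu> \<bullet> (z - y)) \<le> g z"
    by (rule subdiffE[OF sub]) blast
  have y: "y \<in> cball p R"
    using \<open>0 < \<rho>\<close> by (simp add: R_def dist_norm norm_minus_commute)
  have "continuous_on UNIV q"
    unfolding q_def using \<open>0 < \<rho>\<close> by (intro continuous_intros) auto
  then obtain l where l: "\<And>z. z \<in> cball p R \<Longrightarrow> g l + ereal (q l) \<le> g z + ereal (q z)"
    using lsc_attains_inf[OF lsc_add_continuous[OF lsc] compact_cball] y by blast
  have "g l + ereal (q l) \<le> g z + ereal (q z)" for z
  proof (cases "z \<in> cball p R")
    case False
    then have "q y \<le> \<mu> \<bullet> (z - y) + q z"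
      unfolding q_def using \<open>0 < \<rho>\<close>
      by (intro affine_plus_quadratic_coercive) (auto simp: R_def dist_norm norm_minus_commute)
    then have "g y + ereal (q y) \<le> ereal (gy + \<mu> \<bullet> (z - y)) + ereal (q z)"
      by (simp add: gy(1))
    also have "\<dots> \<le> g z + ereal (q z)"
      by (intro add_right_mono gy(2))
    finally show ?thesis
      using l[OF y] by (rule order_trans[rotated])
  qed (rule l)
  then show thesis
    using that unfolding q_def by blast
qed

lemma subdiff_proximal_point:
  fixes g :: "'a::real_inner \<Rightarrow> ereal"
  assumes conv: "econvex g" and "0 < \<rho>" and fin: "\<bar>g l\<bar> \<noteq> \<infinity>"
    and min: "\<And>z. g l + ereal ((norm (l - p))\<^sup>2 / (2 * \<rho>)) \<le> g z + ereal ((norm (z - p))\<^sup>2 / (2 * \<rho>))"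
  shows "(1 / \<rho>) *\<^sub>R (p - l) \<in> subdiff g l"
proof -
  obtain gl where gl: "g l = ereal gl"
    using fin by (cases "g l") auto
  define \<nu> where "\<nu> = (1 / \<rho>) *\<^sub>R (p - l)"
  have "gl + \<nu> \<bullet> (z - l) \<le> s" if gz: "g z \<le> ereal s" for z s
  proof -
    have "\<nu> \<bullet> (z - l) - (s - gl) \<le> u * ((norm (z - l))\<^sup>2 / (2 * \<rho>))" if u: "0 < u" "u < 1" for u
    proof -
      define z' where "z' = (1 - u) *\<^sub>R l + u *\<^sub>R z"
      have shift: "z' - p = (l - p) + u *\<^sub>R (z - l)"
        by (simp add: z'_def algebra_simps)
      have "(l - p) \<bullet> (z - l) = - (\<rho> * (\<nu> \<bullet> (z - l)))"
        using \<open>0 < \<rho>\<close> by (simp add: \<nu>_def inner_diff_left)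
      then have expand: "(norm (z' - p))\<^sup>2 / (2 * \<rho>) = (norm (l - p))\<^sup>2 / (2 * \<rho>) - u * (\<nu> \<bullet> (z - l))
          + u * (u * ((norm (z - l))\<^sup>2 / (2 * \<rho>)))"
        unfolding shift power2_norm_add_scaleR
        using \<open>0 < \<rho>\<close> by (simp add: field_simps power2_eq_square)
      have "g z' \<le> ereal ((1 - u) * gl + u * s)"
        unfolding z'_def using econvexD[OF conv _ gz, of l gl u] gl u by simp
      then have "g z' + ereal ((norm (z' - p))\<^sup>2 / (2 * \<rho>))
          \<le> ereal ((1 - u) * gl + u * s) + ereal ((norm (z' - p))\<^sup>2 / (2 * \<rho>))"
        by (rule add_right_mono)
      from order_trans[OF min this, unfolded expand gl]
      have "u * (\<nu> \<bullet> (z - l) - (s - gl)) \<le> u * (u * ((norm (z - l))\<^sup>2 / (2 * \<rho>)))"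
        by (simp add: algebra_simps)
      then show ?thesis
        using u(1) by (simp only: mult_le_cancel_left_pos)
    qed
    then have "\<nu> \<bullet> (z - l) - (s - gl) \<le> 0"
      by (rule nonpos_if_le_small_multiples)
    then show ?thesis
      by simp
  qed
  then show ?thesis
    unfolding \<nu>_def using subdiffI[of g, OF gl] by blast
qed

lemma subdiff_resolvent:
  fixes g :: "'a::euclidean_space \<Rightarrow> ereal"
  assumes "lsc g" "econvex g" "\<mu> \<in> subdiff g y" "\<rho> > 0"
  obtains y' \<mu>' where "\<mu>' \<in> subdiff g y'" "y' + \<rho> *\<^sub>R \<mu>' = p"
proof -
  obtain gy where gy: "g y = ereal gy" "\<And>z. ereal (gy + \<mu> \<bullet> (z - y)) \<le> g z"
    by (rule subdiffE[OF assms(3)]) blast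
  obtain l where l: "\<And>z. g l + ereal ((norm (l - p))\<^sup>2 / (2 * \<rho>))
      \<le> g z + ereal ((norm (z - p))\<^sup>2 / (2 * \<rho>))"
    using proximal_point_exists[OF assms(1,3,4)] by blast
  have "\<bar>g l\<bar> \<noteq> \<infinity>"
    using l[of y] gy(2)[of l] by (cases "g l") (auto simp: gy(1))
  from subdiff_proximal_point[OF assms(2,4) this l] show thesis
    using assms(4) by (intro that) auto
qed

section \<open>Second subderivatives and twice epi-differentiability\<close>

definition second_quot :: "('a::real_inner \<Rightarrow> ereal) \<Rightarrow> 'a \<Rightarrow> 'a \<Rightarrow> real \<Rightarrow> 'a \<Rightarrow> ereal" where
  "second_quot g y \<mu> t d = (g (y + t *\<^sub>R d) - g y - ereal (t * (\<mu> \<bullet> d))) / ereal (t\<^sup>2 / 2)"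

lemma subderiv2_eq_Liminf_second_quot:
  "subderiv2 g y \<mu> d = Liminf (at_right 0 \<times>\<^sub>F nhds d) (\<lambda>(t, d'). second_quot g y \<mu> t d')"
  by (simp add: subderiv2_def second_quot_def)

lemma ereal_diff_quot_le_iff:
  assumes "0 < s"
  shows "(a - ereal b - ereal c) / ereal s \<le> ereal \<gamma> \<longleftrightarrow> a \<le> ereal (b + c + s * \<gamma>)"
  using assms by (cases a) (auto simp: field_simps)

lemma second_quot_le_iff:
  assumes "g y = ereal gy" "0 < t"
  shows "second_quot g y \<mu> t d \<le> ereal \<gamma> \<longleftrightarrow>
    g (y + t *\<^sub>R d) \<le> ereal (gy + t * (\<mu> \<bullet> d) + t\<^sup>2 / 2 * \<gamma>)"
  unfolding second_quot_def using assms ereal_diff_quot_le_iff[of "t\<^sup>2 / 2"] by simp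

lemma second_quot_nonneg:
  assumes "\<mu> \<in> subdiff g y" "0 < t"
  shows "0 \<le> second_quot g y \<mu> t d"
proof (rule ereal_le_real)
  obtain gy where gy: "g y = ereal gy" "\<And>z. ereal (gy + \<mu> \<bullet> (z - y)) \<le> g z"
    by (rule subdiffE[OF assms(1)]) blast
  fix \<gamma> assume "second_quot g y \<mu> t d \<le> ereal \<gamma>"
  then have "g (y + t *\<^sub>R d) \<le> ereal (gy + t * (\<mu> \<bullet> d) + t\<^sup>2 / 2 * \<gamma>)"
    using second_quot_le_iff[of g, OF gy(1) assms(2)] by simp
  from order_trans[OF gy(2) this] show "0 \<le> ereal \<gamma>"
    using assms(2) by (simp add: zero_le_mult_iff)
qed

lemma subderiv2_nonneg:
  assumes "\<mu> \<in> subdiff g y"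
  shows "0 \<le> subderiv2 g y \<mu> d"
  unfolding subderiv2_eq_Liminf_second_quot
  by (rule Liminf_bounded, rule eventually_mono[OF eventually_at_right_prod_nhds])
    (use second_quot_nonneg[OF assms] in auto)

lemma subderiv2_le_limit:
  assumes "\<And>k. 0 < t k" "t \<longlonglongrightarrow> 0" "dk \<longlonglongrightarrow> d"
    and "\<forall>\<^sub>F k in sequentially. second_quot g y \<mu> (t k) (dk k) \<le> ereal (c k)" "c \<longlonglongrightarrow> l"
  shows "subderiv2 g y \<mu> d \<le> ereal l"
  unfolding subderiv2_eq_Liminf_second_quot
  by (rule Liminf_le_limit[OF filterlim_at_right_prod_nhds]) (use assms in auto)

lemma lsc_subderiv2: "lsc (subderiv2 g y \<mu>)"
  unfolding subderiv2_def[abs_def] by (rule lsc_Liminf_prod_nhds)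

lemma subderiv_ge_subgradient:
  assumes "\<mu> \<in> subdiff g y"
  shows "ereal (\<mu> \<bullet> d) \<le> subderiv g y d"
proof -
  obtain gy where gy: "g y = ereal gy" "\<And>z. ereal (gy + \<mu> \<bullet> (z - y)) \<le> g z"
    by (rule subdiffE[OF assms]) blast
  have quot: "ereal (\<mu> \<bullet> d') \<le> (g (y + t *\<^sub>R d') - g y) / ereal t" if "0 < t" for t d'
    using gy(2)[of "y + t *\<^sub>R d'"] gy(1) that by (cases "g (y + t *\<^sub>R d')") (auto simp: field_simps)
  have "((\<lambda>p. \<mu> \<bullet> snd p) \<longlongrightarrow> \<mu> \<bullet> d) (at_right (0::real) \<times>\<^sub>F nhds d)"
    by (intro tendsto_intros filterlim_snd)
  then have "ereal (\<mu> \<bullet> d) = Liminf (at_right (0::real) \<times>\<^sub>F nhds d) (\<lambda>p. ereal (\<mu> \<bullet> snd p))"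
    by (intro lim_imp_Liminf[symmetric]) auto
  also have "\<dots> \<le> subderiv g y d"
    unfolding subderiv_def
    by (rule Liminf_mono, rule eventually_mono[OF eventually_at_right_prod_nhds])
      (use quot in auto)
  finally show ?thesis .
qed

lemma subderiv_eq_of_subderiv2_finite:
  assumes mu: "\<mu> \<in> subdiff g y" and fin: "subderiv2 g y \<mu> d < \<infinity>"
  shows "subderiv g y d = ereal (\<mu> \<bullet> d)"
proof (rule antisym)
  obtain gy where gy: "g y = ereal gy"
    by (rule subdiffE[OF mu]) blast
  obtain \<gamma> where "subderiv2 g y \<mu> d < ereal \<gamma>"
    using fin ereal_dense2 by blast
  then have "\<exists>\<^sub>F p in at_right 0 \<times>\<^sub>F nhds d. (case p of (t, d') \<Rightarrow> second_quot g y \<mu> t d') < ereal \<gamma>"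
    unfolding subderiv2_eq_Liminf_second_quot by (rule frequently_less_of_Liminf_less)
  then obtain t dk where t: "\<And>k. 0 < t k" "t \<longlonglongrightarrow> 0" "dk \<longlonglongrightarrow> d"
    and le: "\<And>k. second_quot g y \<mu> (t k) (dk k) < ereal \<gamma>"
    by (rule frequently_at_right_prod_sequence) auto
  have quot: "(g (y + t k *\<^sub>R dk k) - g y) / ereal (t k) \<le> ereal (\<mu> \<bullet> dk k + t k * (\<gamma> / 2))" for k
  proof -
    have "g (y + t k *\<^sub>R dk k) \<le> ereal (gy + t k * (\<mu> \<bullet> dk k + t k * (\<gamma> / 2)))"
      using less_imp_le[OF le[of k]] second_quot_le_iff[of g, OF gy t(1)]
      by (simp add: algebra_simps power2_eq_square)
    then show ?thesis
      using ereal_diff_quot_le_iff[OF t(1), of _ gy 0] by (simp add: gy flip: zero_ereal_def)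
  qed
  have "(\<lambda>k. \<mu> \<bullet> dk k + t k * (\<gamma> / 2)) \<longlonglongrightarrow> \<mu> \<bullet> d + 0 * (\<gamma> / 2)"
    by (intro tendsto_intros t)
  then have "(\<lambda>k. ereal (\<mu> \<bullet> dk k + t k * (\<gamma> / 2))) \<longlonglongrightarrow> ereal (\<mu> \<bullet> d)"
    by simp
  then show "subderiv g y d \<le> ereal (\<mu> \<bullet> d)"
    unfolding subderiv_def
    by (rule Liminf_le_limit[OF filterlim_at_right_prod_nhds, rotated -1]) (use t quot in auto)
qed (rule subderiv_ge_subgradient[OF mu])

lemma subderiv2_scaleR_le:
  assumes "0 < r"
  shows "subderiv2 g y \<mu> (r *\<^sub>R d) \<le> ereal (r\<^sup>2) * subderiv2 g y \<mu> d"
proof -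
  have scale: "second_quot g y \<mu> (t / r) (r *\<^sub>R d') = ereal (r\<^sup>2) * second_quot g y \<mu> t d'" for t d'
    unfolding second_quot_def using assms
    by (cases "g (y + t *\<^sub>R d') - g y - ereal (t * (\<mu> \<bullet> d'))") (auto simp: power_divide field_simps)
  have "filterlim (\<lambda>(t, d'). (t / r, r *\<^sub>R d')) (at_right 0 \<times>\<^sub>F nhds (r *\<^sub>R d)) (at_right 0 \<times>\<^sub>F nhds d)"
    unfolding case_prod_beta
  proof (rule filterlim_at_right_prod_nhds)
    show "\<forall>\<^sub>F p in at_right 0 \<times>\<^sub>F nhds d. 0 < fst p / r"
      by (rule eventually_mono[OF eventually_at_right_prod_nhds]) (use assms in auto)
    have "((\<lambda>p. fst p / r) \<longlongrightarrow> 0 / r) (at_right 0 \<times>\<^sub>F nhds d)"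
      by (intro tendsto_intros filterlim_compose[OF _ filterlim_fst]) (use assms in auto)
    then show "((\<lambda>p. fst p / r) \<longlongrightarrow> 0) (at_right 0 \<times>\<^sub>F nhds d)"
      by simp
    show "((\<lambda>p. r *\<^sub>R snd p) \<longlongrightarrow> r *\<^sub>R d) (at_right 0 \<times>\<^sub>F nhds d)"
      by (intro tendsto_intros filterlim_snd)
  qed
  from Liminf_le_Liminf_compose[OF this, of "\<lambda>(t, d'). second_quot g y \<mu> t d'"] show ?thesis
    by (simp add: subderiv2_eq_Liminf_second_quot case_prod_beta' scale Liminf_ereal_mult_left)
qed

text \<open>Epi-convergence of the second-order quotients, in terms of the points strictly above the graph of
  their lower limit.\<close>
definition twice_epi_diff :: "('a::real_inner \<Rightarrow> ereal) \<Rightarrow> 'a \<Rightarrow> 'a \<Rightarrow> bool" where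
  "twice_epi_diff g y \<mu> \<longleftrightarrow> (\<forall>d \<gamma> t. subderiv2 g y \<mu> d < ereal \<gamma> \<and> (\<forall>k. 0 < t k) \<and> t \<longlonglongrightarrow> 0 \<longrightarrow>
    (\<exists>dk. dk \<longlonglongrightarrow> d \<and> (\<forall>\<^sub>F k in sequentially. second_quot g y \<mu> (t k) (dk k) \<le> ereal \<gamma>)))"

definition parab_arc :: "'a::real_vector \<Rightarrow> 'a \<Rightarrow> 'a \<Rightarrow> real \<Rightarrow> 'a" where
  "parab_arc x d w t = x + t *\<^sub>R d + (t\<^sup>2 / 2) *\<^sub>R w"

lemma parab_arc_eq: "parab_arc x d w t = x + t *\<^sub>R (d + (t / 2) *\<^sub>R w)"
  by (simp add: parab_arc_def algebra_simps power2_eq_square)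

lemma second_quot_parabola:
  assumes "\<bar>g y\<bar> \<noteq> \<infinity>" "subderiv g y d = ereal (\<mu> \<bullet> d)" "0 < t"
  shows "second_quot g y \<mu> t (d + (t / 2) *\<^sub>R w) = parab_quot g y d t w - ereal (\<mu> \<bullet> w)"
  unfolding second_quot_def parab_quot_def parab_arc_eq[symmetric] parab_arc_def[symmetric] assms(2)
  using assms(1,3) by (cases "g y"; cases "g (parab_arc y d w t)")
    (auto simp: field_simps inner_add_right power2_eq_square)

lemma parab_regular_imp_twice_epi_diff:
  assumes mu: "\<mu> \<in> subdiff g y" and reg: "parab_regular g y \<mu>"
    and epi: "\<And>d. subderiv g y d = ereal (\<mu> \<bullet> d) \<Longrightarrow> parab_epi_diff g y d"
  shows "twice_epi_diff g y \<mu>"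
  unfolding twice_epi_diff_def
proof (intro allI impI, elim conjE)
  fix d \<gamma> and t :: "nat \<Rightarrow> real"
  assume less: "subderiv2 g y \<mu> d < ereal \<gamma>" and t: "\<forall>k. 0 < t k" "t \<longlonglongrightarrow> 0"
  have fin: "subderiv2 g y \<mu> d < \<infinity>"
    using less by (rule less_trans) simp
  have sd: "subderiv g y d = ereal (\<mu> \<bullet> d)"
    using mu fin by (rule subderiv_eq_of_subderiv2_finite)
  have "(INF w. parab_subderiv g y d w - ereal (\<mu> \<bullet> w)) < ereal \<gamma>"
    using reg fin less unfolding parab_regular_def by auto
  then obtain w where w: "parab_subderiv g y d w - ereal (\<mu> \<bullet> w) < ereal \<gamma>"
    by (auto simp: INF_less_iff)
  obtain wk where wk: "wk \<longlonglongrightarrow> w" "(\<lambda>k. parab_quot g y d (t k) (wk k)) \<longlonglongrightarrow> parab_subderiv g y d w"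
    using epi[OF sd] t unfolding parab_epi_diff_def by blast
  define dk where "dk k = d + (t k / 2) *\<^sub>R wk k" for k
  have "(\<lambda>k. parab_quot g y d (t k) (wk k) - ereal (\<mu> \<bullet> wk k))
      \<longlonglongrightarrow> parab_subderiv g y d w - ereal (\<mu> \<bullet> w)"
    by (intro tendsto_diff_ereal_general tendsto_intros wk) auto
  moreover have "parab_quot g y d (t k) (wk k) - ereal (\<mu> \<bullet> wk k) = second_quot g y \<mu> (t k) (dk k)" for k
    unfolding dk_def by (rule second_quot_parabola[symmetric]) (use mu sd t in \<open>auto simp: subdiff_def\<close>)
  ultimately have "(\<lambda>k. second_quot g y \<mu> (t k) (dk k)) \<longlonglongrightarrow> parab_subderiv g y d w - ereal (\<mu> \<bullet> w)"
    by simp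
  from order_tendstoD(2)[OF this w]
  have "\<forall>\<^sub>F k in sequentially. second_quot g y \<mu> (t k) (dk k) \<le> ereal \<gamma>"
    by (rule eventually_mono) simp
  moreover have "dk \<longlonglongrightarrow> d + (0 / 2) *\<^sub>R w"
    unfolding dk_def by (intro tendsto_intros t wk) simp
  ultimately show "\<exists>dk. dk \<longlonglongrightarrow> d \<and> (\<forall>\<^sub>F k in sequentially. second_quot g y \<mu> (t k) (dk k) \<le> ereal \<gamma>)"
    by auto
qed

section \<open>Regular normals to the graph of the subdifferential\<close>

definition contingent_cone :: "'a::real_normed_vector set \<Rightarrow> 'a \<Rightarrow> 'a set" where
  "contingent_cone C p = {v. \<exists>t vk. (\<forall>k. 0 < t k) \<and> t \<longlonglongrightarrow> (0::real) \<and> vk \<longlonglongrightarrow> v \<and>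
    (\<forall>k::nat. p + t k *\<^sub>R vk k \<in> C)}"

lemma frechet_normal_inner_contingent_le_0:
  assumes normal: "v \<in> frechet_normal C p" and tangent: "w \<in> contingent_cone C p"
  shows "v \<bullet> w \<le> 0"
proof (rule nonpos_if_le_small_multiples)
  fix e :: real assume "0 < e"
  obtain t wk where t: "\<And>k. 0 < t k" "t \<longlonglongrightarrow> 0" and wk: "wk \<longlonglongrightarrow> w"
    and C: "\<And>k::nat. p + t k *\<^sub>R wk k \<in> C"
    using tangent unfolding contingent_cone_def by blast
  obtain \<delta> where "0 < \<delta>"
    and \<delta>: "\<And>p'. p' \<in> C \<Longrightarrow> norm (p' - p) < \<delta> \<Longrightarrow> v \<bullet> (p' - p) \<le> e * norm (p' - p)"
    using normal \<open>0 < e\<close> unfolding frechet_normal_def by blast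
  have "(\<lambda>k. norm (t k *\<^sub>R wk k)) \<longlonglongrightarrow> norm (0 *\<^sub>R w)"
    by (intro tendsto_intros t wk)
  then have "\<forall>\<^sub>F k in sequentially. norm (t k *\<^sub>R wk k) < \<delta>"
    using \<open>0 < \<delta>\<close> by (intro order_tendstoD(2)) auto
  then have "\<forall>\<^sub>F k in sequentially. v \<bullet> wk k \<le> e * norm (wk k)"
  proof eventually_elim
    case (elim k)
    then have "t k * (v \<bullet> wk k) \<le> t k * (e * norm (wk k))"
      using \<delta>[OF C[of k]] t(1)[of k] by (simp add: algebra_simps)
    then show ?case
      using t(1)[of k] by simp
  qed
  moreover have "(\<lambda>k. v \<bullet> wk k) \<longlonglongrightarrow> v \<bullet> w" "(\<lambda>k. e * norm (wk k)) \<longlonglongrightarrow> e * norm w"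
    by (intro tendsto_intros wk)+
  ultimately show "v \<bullet> w \<le> e * norm w"
    by (intro tendsto_le[OF sequentially_bot])
qed

lemma subdiff_difference_quotient:
  fixes g :: "'a::euclidean_space \<Rightarrow> ereal"
  assumes lsc: "lsc g" and conv: "econvex g" and mu: "\<mu> \<in> subdiff g y" and "0 < \<rho>" "0 < t"
  obtains a b where "\<mu> + t *\<^sub>R b \<in> subdiff g (y + t *\<^sub>R a)" "a + \<rho> *\<^sub>R b = u" "norm a \<le> norm u"
proof -
  obtain y' \<mu>' where sub: "\<mu>' \<in> subdiff g y'" and res: "y' + \<rho> *\<^sub>R \<mu>' = y + t *\<^sub>R u + \<rho> *\<^sub>R \<mu>"
    using subdiff_resolvent[OF lsc conv mu \<open>0 < \<rho>\<close>] by blast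
  define a where "a = (1 / t) *\<^sub>R (y' - y)"
  define b where "b = (1 / t) *\<^sub>R (\<mu>' - \<mu>)"
  have y': "y' = y + t *\<^sub>R a" and \<mu>': "\<mu>' = \<mu> + t *\<^sub>R b"
    using \<open>0 < t\<close> by (auto simp: a_def b_def)
  have "t *\<^sub>R (a + \<rho> *\<^sub>R b) = t *\<^sub>R u"
    using res unfolding y' \<mu>' by (simp add: algebra_simps)
  then have u: "a + \<rho> *\<^sub>R b = u"
    using \<open>0 < t\<close> by simp
  have "0 \<le> t\<^sup>2 * (a \<bullet> b)"
    using subdiff_monotone[OF mu sub] unfolding y' \<mu>'
    by (simp add: inner_commute power2_eq_square ac_simps)
  then have "0 \<le> a \<bullet> b"
    using \<open>0 < t\<close> by (simp add: zero_le_mult_iff)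
  then have "norm a \<le> norm u"
    unfolding u[symmetric] using \<open>0 < \<rho>\<close> by (intro norm_le_norm_add_scaleR) auto
  then show thesis
    using sub u unfolding y' \<mu>' by (intro that)
qed

lemma contingent_cone_gph_subdiff_resolvent:
  fixes g :: "'a::euclidean_space \<Rightarrow> ereal"
  assumes lsc: "lsc g" and conv: "econvex g" and mu: "\<mu> \<in> subdiff g y" and "0 < \<rho>"
  obtains a b where "(a, b) \<in> contingent_cone (gph_subdiff g) (y, \<mu>)" "a + \<rho> *\<^sub>R b = u"
proof -
  obtain t :: "nat \<Rightarrow> real" where t: "\<And>k. 0 < t k" "t \<longlonglongrightarrow> 0"
    by (rule positive_null_sequence) blast
  have "\<forall>k. \<exists>a b. \<mu> + t k *\<^sub>R b \<in> subdiff g (y + t k *\<^sub>R a) \<and> a + \<rho> *\<^sub>R b = u \<and> norm a \<le> norm u"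
    using subdiff_difference_quotient[OF lsc conv mu \<open>0 < \<rho>\<close> t(1)] by metis
  then obtain a b where sub: "\<And>k. \<mu> + t k *\<^sub>R b k \<in> subdiff g (y + t k *\<^sub>R a k)"
    and u: "\<And>k. a k + \<rho> *\<^sub>R b k = u" and norm_a: "\<And>k. norm (a k) \<le> norm u"
    by metis
  have b: "b k = (1 / \<rho>) *\<^sub>R (u - a k)" for k
    unfolding u[of k, symmetric] using \<open>0 < \<rho>\<close> by simp
  have "bounded (range a)"
    using norm_a by (auto intro: boundedI)
  then obtain l \<phi> where \<phi>: "strict_mono \<phi>" and a: "(a \<circ> \<phi>) \<longlonglongrightarrow> l"
    using bounded_imp_convergent_subsequence by blast
  have "(\<lambda>k. (a (\<phi> k), b (\<phi> k))) \<longlonglongrightarrow> (l, (1 / \<rho>) *\<^sub>R (u - l))"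
    unfolding b using a by (intro tendsto_intros) (auto simp: o_def)
  moreover have "(\<lambda>k. t (\<phi> k)) \<longlonglongrightarrow> 0"
    using LIMSEQ_subseq_LIMSEQ[OF t(2) \<phi>] by (simp add: o_def)
  ultimately have "(l, (1 / \<rho>) *\<^sub>R (u - l)) \<in> contingent_cone (gph_subdiff g) (y, \<mu>)"
    unfolding contingent_cone_def gph_subdiff_def using sub t(1)
    by (intro CollectI exI[of _ "\<lambda>k. t (\<phi> k)"] exI[of _ "\<lambda>k. (a (\<phi> k), b (\<phi> k))"]) auto
  then show thesis
    using \<open>0 < \<rho>\<close> by (intro that) auto
qed

lemma subdiff_imp_second_quot_ineq:
  assumes gy: "g y = ereal gy" and sub: "\<mu> + t *\<^sub>R b \<in> subdiff g (y + t *\<^sub>R a)" and "0 < t"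
  shows "second_quot g y \<mu> t a + ereal (2 * (b \<bullet> (c - a))) \<le> second_quot g y \<mu> t c"
proof (rule ereal_le_real)
  obtain ga where ga: "g (y + t *\<^sub>R a) = ereal ga"
      "\<And>z. ereal (ga + (\<mu> + t *\<^sub>R b) \<bullet> (z - (y + t *\<^sub>R a))) \<le> g z"
    by (rule subdiffE[OF sub]) blast
  fix \<gamma> assume "second_quot g y \<mu> t c \<le> ereal \<gamma>"
  then have "g (y + t *\<^sub>R c) \<le> ereal (gy + t * (\<mu> \<bullet> c) + t\<^sup>2 / 2 * \<gamma>)"
    using second_quot_le_iff[of g, OF gy \<open>0 < t\<close>] by simp
  from order_trans[OF ga(2) this]
  have "g (y + t *\<^sub>R a) \<le> ereal (gy + t * (\<mu> \<bullet> a) + t\<^sup>2 / 2 * (\<gamma> - 2 * (b \<bullet> (c - a))))"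
    unfolding ga(1) by (simp add: inner_add_left inner_diff_right algebra_simps power2_eq_square)
  then have "second_quot g y \<mu> t a \<le> ereal (\<gamma> - 2 * (b \<bullet> (c - a)))"
    using second_quot_le_iff[of g, OF gy \<open>0 < t\<close>] by simp
  then show "second_quot g y \<mu> t a + ereal (2 * (b \<bullet> (c - a))) \<le> ereal \<gamma>"
    by (cases "second_quot g y \<mu> t a") auto
qed

lemma subderiv2_le_recovery:
  assumes gy: "g y = ereal gy" and t: "\<And>k. 0 < t k" "t \<longlonglongrightarrow> 0"
    and sub: "\<And>k. \<mu> + t k *\<^sub>R bk k \<in> subdiff g (y + t k *\<^sub>R ak k)"
    and ak: "ak \<longlonglongrightarrow> a" and bk: "bk \<longlonglongrightarrow> b" and ck: "ck \<longlonglongrightarrow> c"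
    and quot: "\<forall>\<^sub>F k in sequentially. second_quot g y \<mu> (t k) (ck k) \<le> ereal \<gamma>"
  shows "subderiv2 g y \<mu> a \<le> ereal (\<gamma> - 2 * (b \<bullet> (c - a)))"
proof (rule subderiv2_le_limit[OF t ak])
  show "\<forall>\<^sub>F k in sequentially. second_quot g y \<mu> (t k) (ak k) \<le> ereal (\<gamma> - 2 * (bk k \<bullet> (ck k - ak k)))"
    using quot
  proof eventually_elim
    case (elim k)
    with subdiff_imp_second_quot_ineq[of g, OF gy sub t(1), of k "ck k"] show ?case
      by (cases "second_quot g y \<mu> (t k) (ak k)") (auto dest: order_trans)
  qed
  show "(\<lambda>k. \<gamma> - 2 * (bk k \<bullet> (ck k - ak k))) \<longlonglongrightarrow> \<gamma> - 2 * (b \<bullet> (c - a))"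
    by (intro tendsto_intros ak bk ck)
qed

lemma contingent_cone_gph_subdiff_imp_subdiff_subderiv2:
  assumes mu: "\<mu> \<in> subdiff g y" and epi: "twice_epi_diff g y \<mu>"
    and tangent: "(a, b) \<in> contingent_cone (gph_subdiff g) (y, \<mu>)"
  shows "2 *\<^sub>R b \<in> subdiff (subderiv2 g y \<mu>) a"
proof -
  obtain t p where t: "\<And>k. 0 < t k" "t \<longlonglongrightarrow> 0" and p: "p \<longlonglongrightarrow> (a, b)"
    and gph: "\<And>k. (y, \<mu>) + t k *\<^sub>R p k \<in> gph_subdiff g"
    using tangent unfolding contingent_cone_def by blast
  have ak: "(\<lambda>k. fst (p k)) \<longlonglongrightarrow> a" and bk: "(\<lambda>k. snd (p k)) \<longlonglongrightarrow> b"
    using tendsto_fst[OF p] tendsto_snd[OF p] by auto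
  obtain gy where gy: "g y = ereal gy"
    by (rule subdiffE[OF mu]) blast
  have sub: "\<mu> + t k *\<^sub>R snd (p k) \<in> subdiff g (y + t k *\<^sub>R fst (p k))" for k
    using gph[of k] by (cases "p k") (simp add: gph_subdiff_def)
  note le = subderiv2_le_recovery[of g, OF gy t sub ak bk]
  have "second_quot g y \<mu> (t k) 0 \<le> ereal 0" for k
    using second_quot_le_iff[of g, OF gy t(1)] gy by simp
  then have "subderiv2 g y \<mu> a \<le> ereal (0 - 2 * (b \<bullet> (0 - a)))"
    by (intro le[OF tendsto_const]) simp
  then obtain s where s: "subderiv2 g y \<mu> a = ereal s"
    using subderiv2_nonneg[OF mu, of a] by (cases "subderiv2 g y \<mu> a") auto
  show ?thesis
  proof (rule subdiffI[of "subderiv2 g y \<mu>", OF s])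
    fix c r assume r: "subderiv2 g y \<mu> c \<le> ereal r"
    show "s + 2 *\<^sub>R b \<bullet> (c - a) \<le> r"
    proof (rule field_le_epsilon)
      fix e :: real assume "0 < e"
      then have "subderiv2 g y \<mu> c < ereal (r + e)"
        using r by (simp add: le_less_trans)
      then obtain ck where "ck \<longlonglongrightarrow> c"
          "\<forall>\<^sub>F k in sequentially. second_quot g y \<mu> (t k) (ck k) \<le> ereal (r + e)"
        using epi t unfolding twice_epi_diff_def by blast
      from le[OF this] show "s + 2 *\<^sub>R b \<bullet> (c - a) \<le> r + e"
        by (simp add: s)
    qed
  qed
qed

text \<open>Euler's relation: \<open>2 b\<close> is a subgradient at \<open>a\<close> of a function that is positively homogeneous of
  degree two.\<close>
lemma subderiv2_le_inner_contingent:
  assumes mu: "\<mu> \<in> subdiff g y" and "twice_epi_diff g y \<mu>"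
    and "(a, b) \<in> contingent_cone (gph_subdiff g) (y, \<mu>)"
  shows "subderiv2 g y \<mu> a \<le> ereal (a \<bullet> b)"
proof -
  have "2 *\<^sub>R b \<in> subdiff (subderiv2 g y \<mu>) a"
    using assms by (rule contingent_cone_gph_subdiff_imp_subdiff_subderiv2)
  then obtain s where s: "subderiv2 g y \<mu> a = ereal s"
    and sub: "\<And>c. ereal (s + 2 *\<^sub>R b \<bullet> (c - a)) \<le> subderiv2 g y \<mu> c"
    by (rule subdiffE) blast
  have "2 * s - 2 * (a \<bullet> b) \<le> u * s" if u: "0 < u" "u < 1" for u
  proof -
    have "s + 2 *\<^sub>R b \<bullet> ((1 - u) *\<^sub>R a - a) \<le> (1 - u)\<^sup>2 * s"
      using order_trans[OF sub subderiv2_scaleR_le[of "1 - u" g y \<mu> a]] u(2) by (simp add: s)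
    then have "u * (2 * s - 2 * (a \<bullet> b)) \<le> u * (u * s)"
      by (simp add: inner_diff_right inner_commute algebra_simps power2_eq_square)
    then show ?thesis
      using u(1) by (simp only: mult_le_cancel_left_pos)
  qed
  then have "2 * s - 2 * (a \<bullet> b) \<le> 0"
    by (rule nonpos_if_le_small_multiples)
  then show ?thesis
    by (simp add: s)
qed

lemma frechet_normal_resolvent_bounds:
  assumes mu: "\<mu> \<in> subdiff g y" and epi: "twice_epi_diff g y \<mu>"
    and normal: "(z, w) \<in> frechet_normal (gph_subdiff g) (y, \<mu>)"
    and tangent: "(a, b) \<in> contingent_cone (gph_subdiff g) (y, \<mu>)"
    and "0 < \<rho>" and w: "a + \<rho> *\<^sub>R b = w"
  shows "subderiv2 g y \<mu> a \<le> ereal (- (z \<bullet> a))" "(norm (a - w))\<^sup>2 \<le> \<rho> * (norm z * norm w)"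
proof -
  have sub2: "subderiv2 g y \<mu> a \<le> ereal (a \<bullet> b)"
    using mu epi tangent by (rule subderiv2_le_inner_contingent)
  have nonneg: "0 \<le> a \<bullet> b"
    using order_trans[OF subderiv2_nonneg[OF mu] sub2] by simp
  have bound: "a \<bullet> b + \<rho> * (norm b)\<^sup>2 \<le> - (z \<bullet> a)"
    using frechet_normal_inner_contingent_le_0[OF normal tangent]
    by (simp add: w[symmetric] inner_add_left power2_norm_eq_inner)
  have "0 \<le> \<rho> * (norm b)\<^sup>2"
    using \<open>0 < \<rho>\<close> by simp
  then show "subderiv2 g y \<mu> a \<le> ereal (- (z \<bullet> a))"
    using order_trans[OF sub2] bound by simp
  have "\<rho> * (norm b)\<^sup>2 \<le> norm z * norm a"
    using bound nonneg Cauchy_Schwarz_ineq2[of z a] by linarith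
  also have "\<dots> \<le> norm z * norm w"
    unfolding w[symmetric] using nonneg \<open>0 < \<rho>\<close>
    by (intro mult_left_mono norm_le_norm_add_scaleR) auto
  finally have "\<rho> * (\<rho> * (norm b)\<^sup>2) \<le> \<rho> * (norm z * norm w)"
    using \<open>0 < \<rho>\<close> by (intro mult_left_mono) auto
  then show "(norm (a - w))\<^sup>2 \<le> \<rho> * (norm z * norm w)"
    by (simp add: w[symmetric] power_mult_distrib power2_eq_square ac_simps)
qed

lemma subderiv2_le_inner_frechet_normal:
  fixes g :: "'a::euclidean_space \<Rightarrow> ereal"
  assumes lsc: "lsc g" and conv: "econvex g" and mu: "\<mu> \<in> subdiff g y" and epi: "twice_epi_diff g y \<mu>"
    and normal: "(z, w) \<in> frechet_normal (gph_subdiff g) (y, \<mu>)"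
  shows "subderiv2 g y \<mu> w \<le> ereal (- (z \<bullet> w))"
proof -
  obtain \<rho> :: "nat \<Rightarrow> real" where \<rho>: "\<And>k. 0 < \<rho> k" "\<rho> \<longlonglongrightarrow> 0"
    by (rule positive_null_sequence) blast
  have "\<forall>k. \<exists>a b. (a, b) \<in> contingent_cone (gph_subdiff g) (y, \<mu>) \<and> a + \<rho> k *\<^sub>R b = w"
    using contingent_cone_gph_subdiff_resolvent[OF lsc conv mu \<rho>(1)] by metis
  then obtain a b where tangent: "\<And>k. (a k, b k) \<in> contingent_cone (gph_subdiff g) (y, \<mu>)"
    and w: "\<And>k. a k + \<rho> k *\<^sub>R b k = w"
    by metis
  note bounds = frechet_normal_resolvent_bounds[OF mu epi normal tangent \<rho>(1) w]
  have "(\<lambda>k. (norm (a k - w))\<^sup>2) \<longlonglongrightarrow> 0"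
    by (rule tendsto_sandwich[OF _ _ tendsto_const tendsto_mult_left_zero[OF \<rho>(2), of "norm z * norm w"]])
      (use bounds(2) in auto)
  then have lim: "a \<longlonglongrightarrow> w"
    by (simp add: tendsto_norm_zero_iff LIM_zero_iff)
  then show ?thesis
  proof (rule lsc_le_limit[OF lsc_subderiv2])
    show "\<forall>\<^sub>F k in sequentially. subderiv2 g y \<mu> (a k) \<le> ereal (- (z \<bullet> a k))"
      using bounds(1) by simp
    show "(\<lambda>k. ereal (- (z \<bullet> a k))) \<longlonglongrightarrow> ereal (- (z \<bullet> w))"
      by (intro tendsto_intros lim)
  qed simp
qed

section \<open>Taylor expansions\<close>

definition continuously_differentiable :: "('a::real_normed_vector \<Rightarrow> 'b::real_normed_vector) \<Rightarrow> bool" where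
  "continuously_differentiable G \<longleftrightarrow> (\<forall>x. G differentiable (at x)) \<and>
    (\<forall>h. continuous_on UNIV (\<lambda>x. frechet_derivative G (at x) h))"

lemma continuously_differentiable_has_derivative:
  assumes "continuously_differentiable G"
  shows "(G has_derivative frechet_derivative G (at x)) (at x)"
  using assms frechet_derivative_works unfolding continuously_differentiable_def by blast

lemma continuously_differentiable_blinfun:
  fixes G :: "'a::euclidean_space \<Rightarrow> 'b::real_normed_vector"
  assumes "continuously_differentiable G"
  obtains G' where "\<And>x. blinfun_apply (G' x) = frechet_derivative G (at x)" "continuous_on UNIV G'"
proof -
  define G' where "G' x = Blinfun (frechet_derivative G (at x))" for x
  have G': "blinfun_apply (G' x) = frechet_derivative G (at x)" for x
    unfolding G'_def using continuously_differentiable_has_derivative[OF assms]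
    by (intro bounded_linear_Blinfun_apply has_derivative_bounded_linear)
  moreover have "continuous_on UNIV G'"
    using assms
    by (intro continuous_on_blinfun_componentwise) (simp add: G' continuously_differentiable_def)
  ultimately show thesis
    by (rule that)
qed

lemma continuously_differentiable_lipschitz_on:
  fixes G :: "'a::euclidean_space \<Rightarrow> 'b::real_normed_vector"
  assumes C1: "continuously_differentiable G" and "compact S" "convex S"
  obtains K where "K-lipschitz_on S G"
proof -
  obtain G' where G': "\<And>x. blinfun_apply (G' x) = frechet_derivative G (at x)"
    and cont: "continuous_on UNIV G'"
    using continuously_differentiable_blinfun[OF C1] by blast
  have "compact (G' ` S)"
    using cont \<open>compact S\<close> by (intro compact_continuous_image) (auto intro: continuous_on_subset)
  then obtain K where K: "0 < K" "\<And>x. x \<in> S \<Longrightarrow> norm (G' x) \<le> K"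
    using compact_imp_bounded[of "G' ` S"] by (auto simp: bounded_pos)
  have "K-lipschitz_on S G"
  proof (rule bounded_derivative_imp_lipschitz)
    show "(G has_derivative frechet_derivative G (at x)) (at x within S)" for x
      by (rule has_derivative_at_withinI[OF continuously_differentiable_has_derivative[OF C1]])
    show "onorm (frechet_derivative G (at x)) \<le> K" if "x \<in> S" for x
      using K(2)[OF that] by (simp add: norm_blinfun.rep_eq G')
  qed (use K(1) \<open>convex S\<close> in auto)
  then show thesis
    by (rule that)
qed

lemma tendsto_frechet_derivative:
  fixes G :: "'a::euclidean_space \<Rightarrow> 'b::real_normed_vector"
  assumes C1: "continuously_differentiable G" and x: "(xk \<longlongrightarrow> x) F" and v: "(vk \<longlongrightarrow> v) F"
  shows "((\<lambda>k. frechet_derivative G (at (xk k)) (vk k)) \<longlongrightarrow> frechet_derivative G (at x) v) F"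
proof -
  obtain G' where G': "\<And>x. blinfun_apply (G' x) = frechet_derivative G (at x)"
    and cont: "continuous_on UNIV G'"
    using continuously_differentiable_blinfun[OF C1] by blast
  have "((\<lambda>k. G' (xk k)) \<longlongrightarrow> G' x) F"
    using continuous_on_tendsto_compose[OF cont x] by simp
  then show ?thesis
    unfolding G'[symmetric] using v by (rule blinfun.tendsto)
qed

text \<open>In the Taylor estimates below \<open>F' = P \<circ> G\<close> with a bilinear product \<open>P\<close>: this covers both
  gradients (inner product) and Jacobians (matrix-vector product).\<close>
lemma taylor_first_order:
  fixes F :: "'a::real_normed_vector \<Rightarrow> 'b::real_normed_vector" and G :: "'a \<Rightarrow> 'c::real_normed_vector"
    and P :: "'c \<Rightarrow> 'a \<Rightarrow> 'b"
  assumes P: "bounded_bilinear P" and F: "\<And>z. (F has_derivative P (G z)) (at z)"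
    and S: "convex S" and lip: "L-lipschitz_on S G"
  obtains K where "0 \<le> K"
    "\<And>x x'. x \<in> S \<Longrightarrow> x' \<in> S \<Longrightarrow> norm (F x' - F x - P (G x) (x' - x)) \<le> K * (norm (x' - x))\<^sup>2"
proof -
  interpret bounded_bilinear P by fact
  obtain M where M: "0 < M" "\<And>a b. norm (P a b) \<le> norm a * norm b * M"
    using pos_bounded by blast
  have L: "0 \<le> L"
    using lip by (rule lipschitz_on_nonneg)
  have "norm (F x' - F x - P (G x) (x' - x)) \<le> (L * M) * (norm (x' - x))\<^sup>2"
    if x: "x \<in> S" and x': "x' \<in> S" for x x'
  proof -
    have "norm (F x' - F x - P (G x) (x' - x)) \<le> norm (x' - x) * (L * norm (x' - x) * M)"
    proof (rule differentiable_bound_linearization[where S = "closed_segment x x'"])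
      show "x + t *\<^sub>R (x' - x) \<in> closed_segment x x'" if "t \<in> {0..1}" for t
        using that unfolding in_segment by (intro exI[of _ t]) (auto simp: algebra_simps)
      show "(F has_derivative P (G z)) (at z within closed_segment x x')" for z
        by (rule has_derivative_at_withinI[OF F])
      fix z assume z: "z \<in> closed_segment x x'"
      show "onorm (P (G z) - P (G x)) \<le> L * norm (x' - x) * M"
      proof (rule onorm_bound)
        fix v :: 'a
        have "z \<in> S"
          using z closed_segment_subset[OF x x' S] by blast
        then have "norm (G z - G x) \<le> L * norm (z - x)"
          using lipschitz_onD[OF lip _ x] by (simp add: dist_norm)
        also have "\<dots> \<le> L * norm (x' - x)"
          using segment_bound1[OF z] L by (intro mult_left_mono) auto
        finally have "norm (G z - G x) * norm v * M \<le> L * norm (x' - x) * norm v * M"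
          using M(1) by (intro mult_right_mono) auto
        then show "norm ((P (G z) - P (G x)) v) \<le> L * norm (x' - x) * M * norm v"
          using order_trans[OF M(2)[of "G z - G x" v]] by (simp add: diff_left ac_simps)
      qed (use L M(1) in simp)
    qed simp
    then show ?thesis
      by (simp add: power2_eq_square ac_simps)
  qed
  then show thesis
    using L M(1) by (intro that[of "L * M"]) auto
qed

lemma taylor_second_order_segment:
  fixes F :: "'a::real_normed_vector \<Rightarrow> 'b::real_normed_vector" and G :: "'a \<Rightarrow> 'c::real_normed_vector"
    and P :: "'c \<Rightarrow> 'a \<Rightarrow> 'b"
  assumes P: "bounded_bilinear P" and F: "\<And>z. (F has_derivative P (G z)) (at z)" and D: "bounded_linear D"
    and bound: "\<And>s. 0 \<le> s \<Longrightarrow> s \<le> 1 \<Longrightarrow> norm (P (G (x + s *\<^sub>R h) - G x - D (s *\<^sub>R h)) h) \<le> c"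
  shows "norm (F (x + h) - F x - P (G x) h - (1/2) *\<^sub>R P (D h) h) \<le> c"
proof -
  interpret bounded_bilinear P by fact
  interpret D: bounded_linear D by fact
  define \<phi> where "\<phi> s = F (x + s *\<^sub>R h) - (s\<^sup>2 / 2) *\<^sub>R P (D h) h" for s
  define \<phi>' where "\<phi>' s = P (G (x + s *\<^sub>R h)) h - s *\<^sub>R P (D h) h" for s
  have "norm (\<phi> 1 - \<phi> 0 - (1 - 0) *\<^sub>R \<phi>' 0) \<le> norm (1 - 0 :: real) * c"
  proof (rule vector_differentiable_bound_linearization[where S = "{0..1}" and f' = \<phi>'])
    fix s :: real assume s: "s \<in> {0..1}"
    have "((\<lambda>s. x + s *\<^sub>R h) has_derivative (\<lambda>v. v *\<^sub>R h)) (at s within {0..1})"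
      by (auto intro!: derivative_eq_intros)
    from has_derivative_compose[OF this F]
    have "((\<lambda>s. F (x + s *\<^sub>R h)) has_vector_derivative P (G (x + s *\<^sub>R h)) h) (at s within {0..1})"
      unfolding has_vector_derivative_def by (simp add: scaleR_right)
    then show "(\<phi> has_vector_derivative \<phi>' s) (at s within {0..1})"
      unfolding \<phi>_def[abs_def] \<phi>'_def by (auto intro!: derivative_eq_intros)
    have "\<phi>' s - \<phi>' 0 = P (G (x + s *\<^sub>R h) - G x - D (s *\<^sub>R h)) h"
      by (simp add: \<phi>'_def add_left diff_left scaleR_left D.scaleR algebra_simps)
    then show "norm (\<phi>' s - \<phi>' 0) \<le> c"
      using bound s by simp
  qed (auto simp: closed_segment_eq_real_ivl)
  then show ?thesis
    by (simp add: \<phi>_def \<phi>'_def algebra_simps)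
qed

lemma taylor_second_order:
  fixes F :: "'a::real_normed_vector \<Rightarrow> 'b::real_normed_vector" and G :: "'a \<Rightarrow> 'c::real_normed_vector"
    and P :: "'c \<Rightarrow> 'a \<Rightarrow> 'b"
  assumes P: "bounded_bilinear P" and F: "\<And>z. (F has_derivative P (G z)) (at z)"
    and D: "(G has_derivative D) (at x)" and "0 < e"
  shows "\<forall>\<^sub>F h in nhds 0. norm (F (x + h) - F x - P (G x) h - (1/2) *\<^sub>R P (D h) h) \<le> e * (norm h)\<^sup>2"
proof -
  interpret bounded_bilinear P by fact
  obtain M where M: "0 < M" "\<And>a b. norm (P a b) \<le> norm a * norm b * M"
    using pos_bounded by blast
  obtain \<delta> where \<delta>: "0 < \<delta>" "\<And>z. norm (z - x) < \<delta> \<Longrightarrow> norm (G z - G x - D (z - x)) \<le> e / M * norm (z - x)"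
    using D \<open>0 < e\<close> M(1) unfolding has_derivative_at_alt by (metis divide_pos_pos)
  have "norm (F (x + h) - F x - P (G x) h - (1/2) *\<^sub>R P (D h) h) \<le> e * (norm h)\<^sup>2" if h: "norm h < \<delta>" for h
  proof (rule taylor_second_order_segment[OF P F has_derivative_bounded_linear[OF D]])
    fix s :: real assume "0 \<le> s" "s \<le> 1"
    then have sh: "norm (s *\<^sub>R h) \<le> norm h"
      by (simp add: mult_left_le_one_le)
    have "norm (P (G (x + s *\<^sub>R h) - G x - D (s *\<^sub>R h)) h) \<le> (e / M * norm (s *\<^sub>R h)) * norm h * M"
      using M(1) \<delta>(2)[of "x + s *\<^sub>R h"] sh h
      by (intro order_trans[OF M(2)] mult_right_mono) auto
    also have "\<dots> \<le> (e / M * norm h) * norm h * M"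
      using sh \<open>0 < e\<close> M(1) by (intro mult_right_mono mult_left_mono) auto
    finally show "norm (P (G (x + s *\<^sub>R h) - G x - D (s *\<^sub>R h)) h) \<le> e * (norm h)\<^sup>2"
      using M(1) by (simp add: power2_eq_square)
  qed
  then show ?thesis
    using \<delta>(1) by (auto simp: eventually_nhds_metric dist_norm)
qed

lemma quadratic_remainder_tendsto:
  fixes E :: "'a::real_normed_vector \<Rightarrow> 'b::real_normed_vector"
  assumes E: "\<And>e. 0 < e \<Longrightarrow> \<forall>\<^sub>F h in nhds 0. norm (E h) \<le> e * (norm h)\<^sup>2"
    and t: "\<And>k. 0 < t k" "(t \<longlongrightarrow> 0) K" and dk: "(dk \<longlongrightarrow> d) K"
  shows "((\<lambda>k. (2 / (t k)\<^sup>2) *\<^sub>R E (t k *\<^sub>R dk k)) \<longlongrightarrow> 0) K"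
proof (rule tendsto_norm_zero_cancel, rule tendstoI)
  fix e :: real assume "0 < e"
  obtain N where N: "(norm d)\<^sup>2 < N" "0 < N"
    using gt_ex[of "(norm d)\<^sup>2"] by (metis le_less_trans zero_le_power2)
  define e' where "e' = e / (2 * N)"
  have "0 < e'" and e: "2 * e' * N = e"
    using \<open>0 < e\<close> N(2) by (auto simp: e'_def)
  have "((\<lambda>k. t k *\<^sub>R dk k) \<longlongrightarrow> 0 *\<^sub>R d) K"
    by (intro tendsto_intros t dk)
  then have "((\<lambda>k. t k *\<^sub>R dk k) \<longlongrightarrow> 0) K"
    by simp
  with E[OF \<open>0 < e'\<close>] have "\<forall>\<^sub>F k in K. norm (E (t k *\<^sub>R dk k)) \<le> e' * (norm (t k *\<^sub>R dk k))\<^sup>2"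
    by (rule eventually_compose_filterlim)
  moreover have "((\<lambda>k. (norm (dk k))\<^sup>2) \<longlongrightarrow> (norm d)\<^sup>2) K"
    by (intro tendsto_intros dk)
  from order_tendstoD(2)[OF this N(1)] have "\<forall>\<^sub>F k in K. (norm (dk k))\<^sup>2 < N" .
  ultimately show "\<forall>\<^sub>F k in K. dist (norm ((2 / (t k)\<^sup>2) *\<^sub>R E (t k *\<^sub>R dk k))) 0 < e"
  proof eventually_elim
    case (elim k)
    have "norm ((2 / (t k)\<^sup>2) *\<^sub>R E (t k *\<^sub>R dk k)) \<le> 2 / (t k)\<^sup>2 * (e' * (norm (t k *\<^sub>R dk k))\<^sup>2)"
      unfolding norm_scaleR using elim(1) by (intro mult_mono) auto
    also have "\<dots> = 2 * e' * (norm (dk k))\<^sup>2"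
      using t(1)[of k] by (simp add: power_mult_distrib)
    also have "\<dots> < e"
      unfolding e[symmetric] using elim(2) \<open>0 < e'\<close> by simp
    finally show ?case
      by simp
  qed
qed

lemma tendsto_parab_arc:
  fixes x :: "'a::real_normed_vector"
  assumes "(t \<longlongrightarrow> 0) F" "(wk \<longlongrightarrow> w) F"
  shows "((\<lambda>k. parab_arc x d (wk k) (t k)) \<longlongrightarrow> x) F"
proof -
  have "((\<lambda>k. parab_arc x d (wk k) (t k)) \<longlongrightarrow> x + 0 *\<^sub>R d + (0\<^sup>2 / 2) *\<^sub>R w) F"
    unfolding parab_arc_def by (intro tendsto_intros assms) simp
  then show ?thesis
    by simp
qed

lemma parabolic_second_difference_tendsto:
  fixes F :: "'a::real_normed_vector \<Rightarrow> 'b::real_normed_vector" and G :: "'a \<Rightarrow> 'c::real_normed_vector"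
    and P :: "'c \<Rightarrow> 'a \<Rightarrow> 'b"
  assumes P: "bounded_bilinear P" and F: "\<And>z. (F has_derivative P (G z)) (at z)"
    and D: "(G has_derivative D) (at x)"
    and t: "\<And>k. 0 < t k" "t \<longlonglongrightarrow> 0" and w: "wk \<longlonglongrightarrow> w"
  shows "(\<lambda>k. (2 / (t k)\<^sup>2) *\<^sub>R (F (parab_arc x d (wk k) (t k)) - F x - t k *\<^sub>R P (G x) d))
    \<longlonglongrightarrow> P (G x) w + P (D d) d"
proof -
  interpret bounded_bilinear P by fact
  interpret D: bounded_linear D
    using D by (rule has_derivative_bounded_linear)
  define dk where "dk k = d + (t k / 2) *\<^sub>R wk k" for k
  define E where "E h = F (x + h) - F x - P (G x) h - (1/2) *\<^sub>R P (D h) h" for h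
  have "dk \<longlonglongrightarrow> d + (0 / 2) *\<^sub>R w"
    unfolding dk_def by (intro tendsto_intros t w) simp
  then have dk: "dk \<longlonglongrightarrow> d"
    by simp
  have "(\<lambda>k. (2 / (t k)\<^sup>2) *\<^sub>R E (t k *\<^sub>R dk k)) \<longlonglongrightarrow> 0"
    unfolding E_def by (rule quadratic_remainder_tendsto[OF taylor_second_order[OF P F D] t dk])
  moreover have "(\<lambda>k. P (G x) (wk k) + P (D (dk k)) (dk k)) \<longlonglongrightarrow> P (G x) w + P (D d) d"
    by (intro tendsto_intros tendsto D.tendsto dk w)
  ultimately have "(\<lambda>k. (2 / (t k)\<^sup>2) *\<^sub>R E (t k *\<^sub>R dk k) + (P (G x) (wk k) + P (D (dk k)) (dk k)))
      \<longlonglongrightarrow> 0 + (P (G x) w + P (D d) d)"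
    by (rule tendsto_add)
  moreover have "(2 / (t k)\<^sup>2) *\<^sub>R (F (parab_arc x d (wk k) (t k)) - F x - t k *\<^sub>R P (G x) d) =
      (2 / (t k)\<^sup>2) *\<^sub>R E (t k *\<^sub>R dk k) + (P (G x) (wk k) + P (D (dk k)) (dk k))" for k
  proof -
    have "P (G x) (t k *\<^sub>R dk k) = t k *\<^sub>R P (G x) d + ((t k)\<^sup>2 / 2) *\<^sub>R P (G x) (wk k)"
      by (simp add: dk_def scaleR_right add_right scaleR_add_right power2_eq_square)
    then have "F (parab_arc x d (wk k) (t k)) - F x - t k *\<^sub>R P (G x) d =
        E (t k *\<^sub>R dk k) + ((t k)\<^sup>2 / 2) *\<^sub>R (P (G x) (wk k) + P (D (dk k)) (dk k))"
      by (simp add: E_def parab_arc_eq dk_def[symmetric] D.scaleR scaleR_left scaleR_right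
          power2_eq_square algebra_simps)
    then show ?thesis
      using t(1)[of k] by (simp add: scaleR_add_right)
  qed
  ultimately show ?thesis
    by simp
qed

section \<open>Tilt stability and quadratic growth\<close>

definition quadratic_minorant ::
    "('a::real_inner \<Rightarrow> ereal) \<Rightarrow> 'a set \<Rightarrow> 'a \<Rightarrow> 'a \<Rightarrow> real \<Rightarrow> bool" where
  "quadratic_minorant f S x xs c \<longleftrightarrow> \<bar>f x\<bar> \<noteq> \<infinity> \<and>
    (\<forall>x'\<in>S. f x + ereal (xs \<bullet> (x' - x) + c * (norm (x' - x))\<^sup>2) \<le> f x')"

lemma quadratic_minorantD:
  assumes "quadratic_minorant f S x xs c" "f x = ereal fx" "x' \<in> S"
  shows "ereal (fx + xs \<bullet> (x' - x) + c * (norm (x' - x))\<^sup>2) \<le> f x'"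
  using assms by (auto simp: quadratic_minorant_def add.assoc)

lemma quadratic_minorantI:
  assumes "f x = ereal fx"
    and "\<And>x'. x' \<in> S \<Longrightarrow> ereal (fx + xs \<bullet> (x' - x) + c * (norm (x' - x))\<^sup>2) \<le> f x'"
  shows "quadratic_minorant f S x xs c"
  using assms by (auto simp: quadratic_minorant_def add.assoc)

lemma quadratic_minorant_subset:
  assumes "quadratic_minorant f S x xs c" "T \<subseteq> S"
  shows "quadratic_minorant f T x xs c"
  using assms by (auto simp: quadratic_minorant_def)

lemma mem_tilt_M_iff:
  assumes "\<And>z. f z \<noteq> - \<infinity>" "f xb \<noteq> \<infinity>" "0 \<le> \<delta>"
  shows "x \<in> tilt_M f xb \<delta> u \<longleftrightarrow> x \<in> cball xb \<delta> \<and> quadratic_minorant f (cball xb \<delta>) x u 0"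
proof -
  obtain fb where fb: "f xb = ereal fb"
    using assms(1)[of xb] assms(2) by (cases "f xb") auto
  have iff: "f x - f xb - ereal (u \<bullet> (x - xb)) \<le> f x' - f xb - ereal (u \<bullet> (x' - xb))
      \<longleftrightarrow> f x + ereal (u \<bullet> (x' - x) + 0 * (norm (x' - x))\<^sup>2) \<le> f x'" if "f x = ereal fx" for x' fx
    using that fb assms(1)[of x'] by (cases "f x'") (auto simp: inner_diff_right)
  show ?thesis
  proof (cases "f x")
    case (real fx)
    then show ?thesis
      unfolding tilt_M_def quadratic_minorant_def using iff[OF real] by simp
  next
    case PInf
    then have "\<not> f x - f xb - ereal (u \<bullet> (x - xb)) \<le> f xb - f xb - ereal (u \<bullet> (xb - xb))"
      using fb by simp
    moreover have "xb \<in> cball xb \<delta>"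
      using assms(3) by simp
    ultimately have "x \<notin> tilt_M f xb \<delta> u"
      unfolding tilt_M_def by blast
    then show ?thesis
      using PInf by (simp add: quadratic_minorant_def)
  qed (use assms(1) in simp)
qed

lemma has_derivative_continuous_subgradient:
  fixes e :: "'a::real_inner \<Rightarrow> real"
  assumes "open C" and cont: "continuous_on C M" and u: "u \<in> C"
    and sub: "\<And>u u'. u \<in> C \<Longrightarrow> u' \<in> C \<Longrightarrow> e u + M u \<bullet> (u' - u) \<le> e u'"
  shows "(e has_derivative (\<lambda>h. M u \<bullet> h)) (at u)"
  unfolding has_derivative_at_alt
proof (intro conjI allI impI)
  fix \<epsilon> :: real assume "0 < \<epsilon>"
  obtain r where r: "0 < r" "ball u r \<subseteq> C"
    using \<open>open C\<close> u open_contains_ball by blast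
  obtain s where s: "0 < s" "\<And>u'. u' \<in> C \<Longrightarrow> dist u' u < s \<Longrightarrow> dist (M u') (M u) < \<epsilon>"
    using cont u \<open>0 < \<epsilon>\<close> unfolding continuous_on_iff by blast
  have "norm (e u' - e u - M u \<bullet> (u' - u)) \<le> \<epsilon> * norm (u' - u)" if u': "norm (u' - u) < min r s" for u'
  proof -
    have "u' \<in> C" and close: "norm (M u' - M u) < \<epsilon>"
      using u' r(2) s(2)[of u'] by (auto simp: dist_norm norm_minus_commute)
    then have "0 \<le> e u' - e u - M u \<bullet> (u' - u)"
        "e u' - e u - M u \<bullet> (u' - u) \<le> (M u' - M u) \<bullet> (u' - u)"
      using sub[OF u, of u'] sub[OF _ u, of u'] by (auto simp: inner_diff_left inner_diff_right)
    then have "norm (e u' - e u - M u \<bullet> (u' - u)) \<le> norm (M u' - M u) * norm (u' - u)"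
      using norm_cauchy_schwarz[of "M u' - M u" "u' - u"] by simp
    also have "\<dots> \<le> \<epsilon> * norm (u' - u)"
      using close by (intro mult_right_mono) auto
    finally show ?thesis .
  qed
  then show "\<exists>d>0. \<forall>u'. norm (u' - u) < d \<longrightarrow>
      norm (e u' - e u - M u \<bullet> (u' - u)) \<le> \<epsilon> * norm (u' - u)"
    using r(1) s(1) by (intro exI[of _ "min r s"]) auto
qed (rule bounded_linear_inner_right)

lemma descent_lemma:
  fixes e :: "'a::real_inner \<Rightarrow> real"
  assumes "convex C" and deriv: "\<And>u. u \<in> C \<Longrightarrow> (e has_derivative (\<lambda>h. M u \<bullet> h)) (at u)"
    and lip: "\<kappa>-lipschitz_on C M" and u: "u \<in> C" and u': "u' \<in> C"
  shows "e u' \<le> e u + M u \<bullet> (u' - u) + \<kappa> / 2 * (norm (u' - u))\<^sup>2"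
proof -
  define h where "h = u' - u"
  define \<phi> where "\<phi> s = e (u + s *\<^sub>R h) - s * (M u \<bullet> h) - \<kappa> / 2 * (norm h)\<^sup>2 * s\<^sup>2" for s
  have "\<phi> 1 \<le> \<phi> 0"
  proof (rule DERIV_nonpos_imp_nonincreasing[of 0 1 \<phi>])
    fix s :: real assume s: "0 \<le> s" "s \<le> 1"
    define p where "p = u + s *\<^sub>R h"
    have p: "p \<in> C"
      using convexD_alt[OF \<open>convex C\<close> u u' s] by (simp add: p_def h_def algebra_simps)
    have "((\<lambda>s. u + s *\<^sub>R h) has_derivative (\<lambda>v. v *\<^sub>R h)) (at s)"
      by (auto intro!: derivative_eq_intros)
    from has_derivative_compose[OF this deriv[OF p[unfolded p_def]]]
    have "((\<lambda>s. e (u + s *\<^sub>R h)) has_real_derivative M p \<bullet> h) (at s)"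
      by (simp add: has_field_derivative_def p_def mult_commute_abs)
    then have "(\<phi> has_real_derivative M p \<bullet> h - M u \<bullet> h - \<kappa> * (norm h)\<^sup>2 * s) (at s)"
      unfolding \<phi>_def[abs_def] by (auto intro!: derivative_eq_intros)
    moreover have "M p \<bullet> h - M u \<bullet> h \<le> \<kappa> * (norm h)\<^sup>2 * s"
    proof -
      have "M p \<bullet> h - M u \<bullet> h \<le> norm (M p - M u) * norm h"
        unfolding inner_diff_left[symmetric] by (rule norm_cauchy_schwarz)
      also have "\<dots> \<le> (\<kappa> * norm (p - u)) * norm h"
        using lipschitz_onD[OF lip p u] by (intro mult_right_mono) (auto simp: dist_norm)
      finally show ?thesis
        using s by (simp add: p_def power2_eq_square ac_simps)
    qed
    ultimately show "\<exists>y. (\<phi> has_real_derivative y) (at s) \<and> y \<le> 0"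
      by (intro exI[of _ "M p \<bullet> h - M u \<bullet> h - \<kappa> * (norm h)\<^sup>2 * s"]) auto
  qed simp
  then show ?thesis
    by (simp add: \<phi>_def h_def)
qed

lemma regularized_minimizer_norm_le:
  fixes p m u :: "'a::real_inner"
  assumes "(norm u)\<^sup>2 / 2 + r * c - p \<bullet> u \<le> r * c0" "c0 + m \<bullet> u \<le> c" "0 \<le> r"
  shows "norm u \<le> 2 * norm (p - r *\<^sub>R m)"
proof -
  have "r * (c0 + m \<bullet> u) \<le> r * c"
    using assms(2,3) by (rule mult_left_mono)
  with assms(1) have "(norm u)\<^sup>2 / 2 \<le> (p - r *\<^sub>R m) \<bullet> u"
    by (simp add: inner_diff_left algebra_simps)
  also have "\<dots> \<le> norm (p - r *\<^sub>R m) * norm u"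
    by (rule norm_cauchy_schwarz)
  finally show ?thesis
    by (cases "u = 0") (auto simp: power2_eq_square)
qed

text \<open>A solution is a minimizer of \<open>\<parallel>u\<parallel>\<^sup>2 / 2 + r e(u) - \<langle>p, u\<rangle>\<close> over \<open>\<parallel>u\<parallel> \<le> \<epsilon> / 2\<close>, which is
  interior by the bound on \<open>p\<close>.\<close>
lemma identity_plus_gradient_solvable:
  fixes e :: "'a::euclidean_space \<Rightarrow> real"
  assumes deriv: "\<And>u. u \<in> ball 0 \<epsilon> \<Longrightarrow> (e has_derivative (\<lambda>h. M u \<bullet> h)) (at u)"
    and sub: "\<And>u. u \<in> ball 0 \<epsilon> \<Longrightarrow> e 0 + M 0 \<bullet> u \<le> e u"
    and "0 < \<epsilon>" "0 \<le> r" and p: "norm (p - r *\<^sub>R M 0) < \<epsilon> / 4"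
  obtains u where "u \<in> ball 0 \<epsilon>" "u + r *\<^sub>R M u = p"
proof -
  define \<phi> where "\<phi> u = 1 / 2 * (u \<bullet> u) + r * e u - p \<bullet> u" for u
  let ?K = "cball (0::'a) (\<epsilon> / 2)"
  have K: "?K \<subseteq> ball 0 \<epsilon>"
    using \<open>0 < \<epsilon>\<close> by auto
  have deriv_\<phi>: "(\<phi> has_derivative (\<lambda>h. (u + r *\<^sub>R M u - p) \<bullet> h)) (at u)" if "u \<in> ball 0 \<epsilon>" for u
  proof -
    have "(\<phi> has_derivative (\<lambda>h. 1 / 2 * (u \<bullet> h + h \<bullet> u) + r * (M u \<bullet> h) - p \<bullet> h)) (at u)"
      unfolding \<phi>_def[abs_def]
      by (intro has_derivative_diff has_derivative_add has_derivative_mult_right has_derivative_inner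
          has_derivative_inner_right[OF has_derivative_ident] has_derivative_ident deriv that)
    then show ?thesis
      by (simp add: inner_commute[of _ u] inner_add_left inner_diff_left)
  qed
  have "continuous_on ?K \<phi>"
    using deriv_\<phi> K by (blast intro: continuous_at_imp_continuous_on has_derivative_continuous)
  then obtain u where u: "u \<in> ?K" and min: "\<And>u'. u' \<in> ?K \<Longrightarrow> \<phi> u \<le> \<phi> u'"
    using continuous_attains_inf[of ?K \<phi>] \<open>0 < \<epsilon>\<close> by auto
  then have u_ball: "u \<in> ball 0 \<epsilon>"
    using K by blast
  have "(norm u)\<^sup>2 / 2 + r * e u - p \<bullet> u \<le> r * e 0"
    using min[of 0] \<open>0 < \<epsilon>\<close> by (simp add: \<phi>_def power2_norm_eq_inner)
  then have "norm u \<le> 2 * norm (p - r *\<^sub>R M 0)"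
    using sub[OF u_ball] \<open>0 \<le> r\<close> by (rule regularized_minimizer_norm_le)
  then have "norm u < \<epsilon> / 2"
    using p by linarith
  then have "(\<lambda>h. (u + r *\<^sub>R M u - p) \<bullet> h) = (\<lambda>h. 0)"
    using min by (intro differential_zero_maxmin[of u "ball 0 (\<epsilon> / 2)" \<phi>] deriv_\<phi> u_ball) auto
  then have "u + r *\<^sub>R M u = p"
    by (metis eq_iff_diff_eq_0 inner_eq_zero_iff)
  then show thesis
    using u_ball by (intro that)
qed

locale tilted_minimizers =
  fixes f :: "'a::euclidean_space \<Rightarrow> ereal" and C :: "'a set" and \<epsilon> \<kappa> :: real and M :: "'a \<Rightarrow> 'a"
  assumes eps_pos: "0 < \<epsilon>"
    and minimizer_mem: "u \<in> ball 0 \<epsilon> \<Longrightarrow> M u \<in> C"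
    and minimizer_minorant: "u \<in> ball 0 \<epsilon> \<Longrightarrow> quadratic_minorant f C (M u) u 0"
    and lipschitz: "\<kappa>-lipschitz_on (ball 0 \<epsilon>) M"
begin

text \<open>On \<open>ball 0 \<epsilon>\<close> this is the Fenchel conjugate of \<open>f\<close> restricted to \<open>C\<close>, and \<open>M\<close> is its gradient.\<close>
definition conjugate :: "'a \<Rightarrow> real" where
  "conjugate u = u \<bullet> M u - real_of_ereal (f (M u))"

lemma f_minimizer:
  assumes "u \<in> ball 0 \<epsilon>"
  shows "f (M u) = ereal (u \<bullet> M u - conjugate u)"
  using minimizer_minorant[OF assms] unfolding quadratic_minorant_def conjugate_def
  by (cases "f (M u)") auto

lemma fenchel_young:
  assumes "u \<in> ball 0 \<epsilon>" "x \<in> C"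
  shows "ereal (u \<bullet> x - conjugate u) \<le> f x"
  using quadratic_minorantD[OF minimizer_minorant f_minimizer] assms by (simp add: inner_diff_right)

lemma conjugate_subgradient:
  assumes "u \<in> ball 0 \<epsilon>" "u' \<in> ball 0 \<epsilon>"
  shows "conjugate u + M u \<bullet> (u' - u) \<le> conjugate u'"
  using fenchel_young[OF assms(2) minimizer_mem[OF assms(1)]] f_minimizer[OF assms(1)]
  by (simp add: inner_diff_right inner_commute)

lemma conjugate_has_derivative:
  assumes "u \<in> ball 0 \<epsilon>"
  shows "(conjugate has_derivative (\<lambda>h. M u \<bullet> h)) (at u)"
  using lipschitz_on_continuous_on[OF lipschitz] assms conjugate_subgradient
  by (intro has_derivative_continuous_subgradient[of "ball 0 \<epsilon>"]) auto

lemma minimizer_eqI: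
  assumes minorant: "quadratic_minorant f C x xs (- r)" and x: "x \<in> C" and "0 \<le> r"
    and small: "norm (xs + (r + 1) *\<^sub>R (x - M 0)) < \<epsilon> / 4"
  shows "xs \<in> ball 0 \<epsilon>" "M xs = x"
proof -
  have "norm ((xs + (r + 1) *\<^sub>R x) - (r + 1) *\<^sub>R M 0) < \<epsilon> / 4"
    using small by (simp add: algebra_simps)
  then obtain u where u: "u \<in> ball 0 \<epsilon>" and eq: "u + (r + 1) *\<^sub>R M u = xs + (r + 1) *\<^sub>R x"
    using identity_plus_gradient_solvable[of \<epsilon> conjugate M "r + 1"] conjugate_has_derivative
      conjugate_subgradient[of 0] eps_pos \<open>0 \<le> r\<close>
    by (metis add_nonneg_nonneg centre_in_ball diff_zero zero_le_one)
  have diff: "u - xs = (r + 1) *\<^sub>R (x - M u)"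
    using eq by (simp add: algebra_simps)
  obtain fx where fx: "f x = ereal fx"
    using minorant unfolding quadratic_minorant_def by (cases "f x") auto
  have "u \<bullet> x - conjugate u \<le> fx"
    using fenchel_young[OF u x] by (simp add: fx)
  moreover have "fx + xs \<bullet> (M u - x) + - r * (norm (M u - x))\<^sup>2 \<le> u \<bullet> M u - conjugate u"
    using quadratic_minorantD[OF minorant fx minimizer_mem[OF u]] f_minimizer[OF u] by simp
  ultimately have "(u - xs) \<bullet> (x - M u) \<le> r * (norm (x - M u))\<^sup>2"
    by (simp add: inner_diff_left inner_diff_right norm_minus_commute)
  moreover have "(u - xs) \<bullet> (x - M u) = (r + 1) * (norm (x - M u))\<^sup>2"
    by (simp add: diff power2_norm_eq_inner)
  ultimately have "(norm (x - M u))\<^sup>2 \<le> 0"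
    by (simp add: distrib_right)
  then have "M u = x"
    by simp
  with diff have "u = xs"
    by simp
  with u \<open>M u = x\<close> show "xs \<in> ball 0 \<epsilon>" "M xs = x"
    by auto
qed

lemma minimizer_quadratic_growth:
  assumes "0 < \<kappa>" and xs: "xs \<in> ball 0 \<epsilon>"
  shows "quadratic_minorant f {x' \<in> C. xs + (1 / \<kappa>) *\<^sub>R (x' - M xs) \<in> ball 0 \<epsilon>} (M xs) xs (1 / (2 * \<kappa>))"
proof (rule quadratic_minorantI[of f, OF f_minimizer[OF xs]])
  fix x' assume "x' \<in> {x' \<in> C. xs + (1 / \<kappa>) *\<^sub>R (x' - M xs) \<in> ball 0 \<epsilon>}"
  define x where "x = M xs"
  define h where "h = (1 / \<kappa>) *\<^sub>R (x' - x)"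
  have x': "x' \<in> C" and u: "xs + h \<in> ball 0 \<epsilon>"
    using \<open>x' \<in> _\<close> by (auto simp: h_def x_def)
  have "conjugate (xs + h) \<le> conjugate xs + x \<bullet> h + \<kappa> / 2 * (norm h)\<^sup>2"
    using descent_lemma[OF convex_ball conjugate_has_derivative lipschitz xs u] by (simp add: x_def)
  moreover have "\<kappa> / 2 * (norm h)\<^sup>2 = 1 / (2 * \<kappa>) * (norm (x' - x))\<^sup>2"
    using \<open>0 < \<kappa>\<close> by (simp add: h_def power_divide power2_eq_square)
  moreover have "h \<bullet> x' - h \<bullet> x = 2 * (1 / (2 * \<kappa>) * (norm (x' - x))\<^sup>2)"
    by (simp add: h_def power2_norm_eq_inner inner_diff_right diff_divide_distrib)
  ultimately have "xs \<bullet> x - conjugate xs + xs \<bullet> (x' - x) + 1 / (2 * \<kappa>) * (norm (x' - x))\<^sup>2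
      \<le> (xs + h) \<bullet> x' - conjugate (xs + h)"
    by (simp add: inner_add_left inner_diff_right inner_commute[of x h])
  then have "ereal (xs \<bullet> x - conjugate xs + xs \<bullet> (x' - x) + 1 / (2 * \<kappa>) * (norm (x' - x))\<^sup>2)
      \<le> ereal ((xs + h) \<bullet> x' - conjugate (xs + h))"
    by simp
  also have "\<dots> \<le> f x'"
    using u x' by (rule fenchel_young)
  finally show "ereal (xs \<bullet> M xs - conjugate xs + xs \<bullet> (x' - M xs)
      + 1 / (2 * \<kappa>) * (norm (x' - M xs))\<^sup>2) \<le> f x'"
    by (simp add: x_def)
qed

lemma minimizer_growth_ball:
  assumes "0 < \<kappa>" "0 \<le> r" and minorant: "quadratic_minorant f C x xs (- r)" and x: "x \<in> C"
    and x_near: "(r + 1) * norm (x - M 0) < \<epsilon> / 8" and xs_near: "norm xs < \<epsilon> / 8"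
    and ball: "ball x \<rho> \<subseteq> C" "\<rho> \<le> \<kappa> * (\<epsilon> / 2)"
  shows "quadratic_minorant f (ball x \<rho>) x xs (1 / (2 * \<kappa>))"
proof -
  have "norm (xs + (r + 1) *\<^sub>R (x - M 0)) < \<epsilon> / 4"
    using x_near xs_near norm_triangle_ineq[of xs "(r + 1) *\<^sub>R (x - M 0)"] \<open>0 \<le> r\<close> by simp
  then have xs_ball: "xs \<in> ball 0 \<epsilon>" and Mxs: "M xs = x"
    using minimizer_eqI[OF minorant x \<open>0 \<le> r\<close>] by auto
  have "ball x \<rho> \<subseteq> {x' \<in> C. xs + (1 / \<kappa>) *\<^sub>R (x' - M xs) \<in> ball 0 \<epsilon>}"
  proof safe
    fix x' assume x': "x' \<in> ball x \<rho>"
    then show "x' \<in> C"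
      using ball(1) by blast
    have "norm (x' - x) / \<kappa> < \<epsilon> / 2"
      using x' ball(2) \<open>0 < \<kappa>\<close> by (simp add: dist_norm norm_minus_commute field_simps)
    then have "norm ((1 / \<kappa>) *\<^sub>R (x' - M xs)) < \<epsilon> / 2"
      using \<open>0 < \<kappa>\<close> by (simp add: Mxs)
    then show "xs + (1 / \<kappa>) *\<^sub>R (x' - M xs) \<in> ball 0 \<epsilon>"
      using xs_near eps_pos norm_triangle_ineq[of xs "(1 / \<kappa>) *\<^sub>R (x' - M xs)"] by simp
  qed
  then show ?thesis
    using quadratic_minorant_subset[OF minimizer_quadratic_growth[OF \<open>0 < \<kappa>\<close> xs_ball]] Mxs by simp
qed

end

lemma tilt_stable_imp_tilted_minimizers:
  assumes tilt: "tilt_stable f xb \<kappa>" and "0 < \<kappa>" and nm: "\<And>z. f z \<noteq> - \<infinity>" and fin: "f xb \<noteq> \<infinity>"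
  obtains \<delta> \<epsilon> M where "0 < \<delta>" "M 0 = xb" "tilted_minimizers f (cball xb \<delta>) \<epsilon> \<kappa> M"
proof -
  obtain \<delta> \<epsilon> where "0 < \<delta>" "0 < \<epsilon>"
    and single: "\<And>u. u \<in> ball 0 \<epsilon> \<Longrightarrow> \<exists>x. tilt_M f xb \<delta> u = {x}"
    and dist: "\<And>u u' x x'. u \<in> ball 0 \<epsilon> \<Longrightarrow> u' \<in> ball 0 \<epsilon> \<Longrightarrow> tilt_M f xb \<delta> u = {x} \<Longrightarrow>
      tilt_M f xb \<delta> u' = {x'} \<Longrightarrow> dist x x' \<le> \<kappa> * dist u u'"
    and base: "tilt_M f xb \<delta> 0 = {xb}"
    using tilt unfolding tilt_stable_def by metis
  obtain M where M: "\<And>u. u \<in> ball 0 \<epsilon> \<Longrightarrow> tilt_M f xb \<delta> u = {M u}"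
    using single by metis
  have "M u \<in> cball xb \<delta> \<and> quadratic_minorant f (cball xb \<delta>) (M u) u 0" if "u \<in> ball 0 \<epsilon>" for u
    using M[OF that] mem_tilt_M_iff[of f xb \<delta> "M u" u, OF nm fin] \<open>0 < \<delta>\<close> by auto
  moreover have "\<kappa>-lipschitz_on (ball 0 \<epsilon>) M"
    using dist M \<open>0 < \<kappa>\<close> by (intro lipschitz_onI) auto
  ultimately have "tilted_minimizers f (cball xb \<delta>) \<epsilon> \<kappa> M"
    using \<open>0 < \<epsilon>\<close> by unfold_locales auto
  moreover have "M 0 = xb"
    using M[of 0] base \<open>0 < \<epsilon>\<close> by simp
  ultimately show thesis
    using \<open>0 < \<delta>\<close> by (intro that)
qed

lemma tilt_stable_quadratic_growth:
  assumes "tilt_stable f xb \<kappa>" "0 < \<kappa>" "\<And>z. f z \<noteq> - \<infinity>" "f xb \<noteq> \<infinity>"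
  shows "\<exists>\<delta>>0. \<forall>r\<ge>0. \<exists>\<eta>>0. \<forall>x xs. norm (x - xb) < \<eta> \<longrightarrow> norm xs < \<eta> \<longrightarrow>
    quadratic_minorant f (cball xb \<delta>) x xs (- r) \<longrightarrow>
    (\<exists>\<rho>>0. quadratic_minorant f (ball x \<rho>) x xs (1 / (2 * \<kappa>)))"
proof -
  obtain \<delta> \<epsilon> M where "0 < \<delta>" "M 0 = xb" and tilted: "tilted_minimizers f (cball xb \<delta>) \<epsilon> \<kappa> M"
    by (rule tilt_stable_imp_tilted_minimizers[OF assms])
  interpret tilted_minimizers f "cball xb \<delta>" \<epsilon> \<kappa> M
    by (rule tilted)
  have "\<exists>\<rho>>0. quadratic_minorant f (ball x \<rho>) x xs (1 / (2 * \<kappa>))"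
    if r: "0 \<le> r" and minorant: "quadratic_minorant f (cball xb \<delta>) x xs (- r)"
      and x: "norm (x - xb) < min (\<delta> / 2) (\<epsilon> / (8 * (r + 1)))"
      and xs: "norm xs < min (\<delta> / 2) (\<epsilon> / (8 * (r + 1)))"
    for r x xs
  proof (intro exI conjI)
    define \<rho> where "\<rho> = min (\<delta> / 2) (\<kappa> * (\<epsilon> / 2))"
    show "0 < \<rho>"
      using \<open>0 < \<delta>\<close> \<open>0 < \<kappa>\<close> eps_pos by (simp add: \<rho>_def)
    have scaled: "(r + 1) * norm (x - xb) < \<epsilon> / 8" "(r + 1) * norm xs < \<epsilon> / 8"
      using x xs r by (auto simp: field_simps)
    moreover have "norm xs \<le> (r + 1) * norm xs"
      using r by (simp add: distrib_right)
    ultimately have "norm xs < \<epsilon> / 8"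
      by linarith
    moreover have "x \<in> cball xb \<delta>"
      using x \<open>0 < \<delta>\<close> by (simp add: dist_norm norm_minus_commute)
    moreover have "ball x \<rho> \<subseteq> cball xb \<delta>"
    proof
      fix x' assume "x' \<in> ball x \<rho>"
      then show "x' \<in> cball xb \<delta>"
        using x dist_triangle[of xb x' x] by (simp add: \<rho>_def dist_norm norm_minus_commute)
    qed
    ultimately show "quadratic_minorant f (ball x \<rho>) x xs (1 / (2 * \<kappa>))"
      using minimizer_growth_ball[OF \<open>0 < \<kappa>\<close> r minorant, of \<rho>] scaled(1) \<open>M 0 = xb\<close> by (simp add: \<rho>_def)
  qed
  moreover have "0 < min (\<delta> / 2) (\<epsilon> / (8 * (r + 1)))" if "0 \<le> r" for r
    using that \<open>0 < \<delta>\<close> eps_pos by simp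
  ultimately show ?thesis
    using \<open>0 < \<delta>\<close> by blast
qed

section \<open>Parabolic subderivatives of convex functions\<close>

lemma econvexI:
  assumes "\<And>a \<alpha> b \<beta> u. g a \<le> ereal \<alpha> \<Longrightarrow> g b \<le> ereal \<beta> \<Longrightarrow> 0 \<le> u \<Longrightarrow> u \<le> 1 \<Longrightarrow>
    g ((1 - u) *\<^sub>R a + u *\<^sub>R b) \<le> ereal ((1 - u) * \<alpha> + u * \<beta>)"
  shows "econvex g"
  unfolding econvex_def convex_alt using assms by auto

lemma parab_quot_le_iff:
  assumes "g y = ereal gy" "subderiv g y d = ereal D" "0 < t"
  shows "parab_quot g y d t w \<le> ereal \<gamma> \<longleftrightarrow>
    g (parab_arc y d w t) \<le> ereal (gy + t * D + t\<^sup>2 / 2 * \<gamma>)"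
  unfolding parab_quot_def parab_arc_def using assms ereal_diff_quot_le_iff[of "t\<^sup>2 / 2"] by simp

lemma parab_subderiv_le_limit:
  assumes "\<And>k. 0 < t k" "t \<longlonglongrightarrow> 0" "sk \<longlonglongrightarrow> s"
    and "\<forall>\<^sub>F k in sequentially. parab_quot g y d (t k) (sk k) \<le> ereal (c k)" "c \<longlonglongrightarrow> l"
  shows "parab_subderiv g y d s \<le> ereal l"
  unfolding parab_subderiv_def
  by (rule Liminf_le_limit[OF filterlim_at_right_prod_nhds]) (use assms in auto)

lemma econvex_parab_quot:
  assumes conv: "econvex g" and gy: "g y = ereal gy" and D: "subderiv g y d = ereal D" and t: "0 < t"
  shows "econvex (parab_quot g y d t)"
proof (rule econvexI)
  fix a b \<alpha> \<beta> and u :: real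
  assume a: "parab_quot g y d t a \<le> ereal \<alpha>" and b: "parab_quot g y d t b \<le> ereal \<beta>"
    and u: "0 \<le> u" "u \<le> 1"
  note le_iff = parab_quot_le_iff[of g, OF gy D t]
  have "p + h *\<^sub>R ((1 - u) *\<^sub>R a + u *\<^sub>R b) = (1 - u) *\<^sub>R (p + h *\<^sub>R a) + u *\<^sub>R (p + h *\<^sub>R b)" for p h
    by (simp add: algebra_simps)
  then have "parab_arc y d ((1 - u) *\<^sub>R a + u *\<^sub>R b) t
      = (1 - u) *\<^sub>R parab_arc y d a t + u *\<^sub>R parab_arc y d b t"
    unfolding parab_arc_def .
  moreover have "gy + t * D + t\<^sup>2 / 2 * ((1 - u) * \<alpha> + u * \<beta>) =
      (1 - u) * (gy + t * D + t\<^sup>2 / 2 * \<alpha>) + u * (gy + t * D + t\<^sup>2 / 2 * \<beta>)"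
    by (simp add: field_simps)
  ultimately show "parab_quot g y d t ((1 - u) *\<^sub>R a + u *\<^sub>R b) \<le> ereal ((1 - u) * \<alpha> + u * \<beta>)"
    using econvexD[OF conv a[unfolded le_iff] b[unfolded le_iff] u] unfolding le_iff by simp
qed

lemma parab_epi_diff_finite:
  assumes "parab_epi_diff g y d"
  obtains w \<gamma> where "parab_subderiv g y d w < ereal \<gamma>"
  using assms ereal_dense2 unfolding parab_epi_diff_def by blast

lemma parab_epi_diff_sequence:
  assumes "parab_epi_diff g y d" "\<And>k. 0 < t k" "t \<longlonglongrightarrow> 0"
    and "parab_subderiv g y d s < ereal \<gamma>"
  obtains sk where "sk \<longlonglongrightarrow> s" "\<forall>\<^sub>F k in sequentially. parab_quot g y d (t k) (sk k) \<le> ereal \<gamma>"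
proof -
  obtain sk where sk: "sk \<longlonglongrightarrow> s" and lim: "(\<lambda>k. parab_quot g y d (t k) (sk k)) \<longlonglongrightarrow> parab_subderiv g y d s"
    using assms(1-3) unfolding parab_epi_diff_def by blast
  have "\<forall>\<^sub>F k in sequentially. parab_quot g y d (t k) (sk k) \<le> ereal \<gamma>"
    using order_tendstoD(2)[OF lim assms(4)] by (rule eventually_mono) simp
  with sk show thesis
    by (rule that)
qed

lemma econvex_parab_subderiv:
  assumes conv: "econvex g" and gy: "g y = ereal gy" and epi: "parab_epi_diff g y d"
  shows "econvex (parab_subderiv g y d)"
proof (rule econvexI)
  fix a b \<alpha> \<beta> and u :: real
  assume a: "parab_subderiv g y d a \<le> ereal \<alpha>" and b: "parab_subderiv g y d b \<le> ereal \<beta>"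
    and u: "0 \<le> u" "u \<le> 1"
  obtain D where D: "subderiv g y d = ereal D"
    using epi unfolding parab_epi_diff_def by (cases "subderiv g y d") auto
  obtain t :: "nat \<Rightarrow> real" where t: "\<And>k. 0 < t k" "t \<longlonglongrightarrow> 0"
    by (rule positive_null_sequence) blast
  show "parab_subderiv g y d ((1 - u) *\<^sub>R a + u *\<^sub>R b) \<le> ereal ((1 - u) * \<alpha> + u * \<beta>)"
  proof (rule ereal_le_epsilon2)
    fix e :: real assume "0 < e"
    then have a_less: "parab_subderiv g y d a < ereal (\<alpha> + e)"
      and b_less: "parab_subderiv g y d b < ereal (\<beta> + e)"
      using a b by (auto intro: le_less_trans)
    obtain ak where ak: "ak \<longlonglongrightarrow> a" "\<forall>\<^sub>F k in sequentially. parab_quot g y d (t k) (ak k) \<le> ereal (\<alpha> + e)"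
      using parab_epi_diff_sequence[OF epi t a_less] .
    obtain bk where bk: "bk \<longlonglongrightarrow> b" "\<forall>\<^sub>F k in sequentially. parab_quot g y d (t k) (bk k) \<le> ereal (\<beta> + e)"
      using parab_epi_diff_sequence[OF epi t b_less] .
    have "(\<lambda>k. (1 - u) *\<^sub>R ak k + u *\<^sub>R bk k) \<longlonglongrightarrow> (1 - u) *\<^sub>R a + u *\<^sub>R b"
      by (intro tendsto_intros ak(1) bk(1))
    moreover have "\<forall>\<^sub>F k in sequentially. parab_quot g y d (t k) ((1 - u) *\<^sub>R ak k + u *\<^sub>R bk k)
        \<le> ereal ((1 - u) * (\<alpha> + e) + u * (\<beta> + e))"
      using ak(2) bk(2)
      by eventually_elim (rule econvexD[OF econvex_parab_quot[of g, OF conv gy D t(1)] _ _ u])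
    ultimately have "parab_subderiv g y d ((1 - u) *\<^sub>R a + u *\<^sub>R b)
      \<le> ereal ((1 - u) * (\<alpha> + e) + u * (\<beta> + e))"
      by (rule parab_subderiv_le_limit[OF t _ _ tendsto_const])
    then show "parab_subderiv g y d ((1 - u) *\<^sub>R a + u *\<^sub>R b) \<le> ereal ((1 - u) * \<alpha> + u * \<beta>) + ereal e"
      by (simp add: algebra_simps)
  qed
qed

text \<open>With \<open>\<theta> = r t\<^sup>2 / 2\<close>, the arc in the direction \<open>s / (1 - \<theta>) + r (z - y)\<close> at time \<open>t\<close> is the convex
  combination with weight \<open>\<theta>\<close> of the point \<open>z\<close> and the arc in the direction \<open>s\<close> at time \<open>t / (1 - \<theta>)\<close>.\<close>
lemma parab_quot_recession:
  assumes conv: "econvex g" and gy: "g y = ereal gy" and D: "subderiv g y d = ereal D"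
    and z: "g z \<le> ereal gz" and "0 \<le> r" "0 < t" and \<theta>: "\<theta> = r * t\<^sup>2 / 2" "\<theta> < 1"
    and s: "parab_quot g y d (t / (1 - \<theta>)) s \<le> ereal \<gamma>"
  shows "parab_quot g y d t ((1 / (1 - \<theta>)) *\<^sub>R s + r *\<^sub>R (z - y)) \<le> ereal (\<gamma> / (1 - \<theta>) + r * (gz - gy))"
proof -
  define \<tau> where "\<tau> = t / (1 - \<theta>)"
  have "0 < \<tau>"
    using \<open>0 < t\<close> \<theta>(2) by (simp add: \<tau>_def)
  have weight: "(1 - \<theta>) * \<tau> = t" "(1 - \<theta>) * (\<tau>\<^sup>2 / 2) = t\<^sup>2 / 2 * (1 / (1 - \<theta>))"
    using \<theta>(2) by (simp_all add: \<tau>_def power2_eq_square)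
  have "(1 - \<theta>) *\<^sub>R parab_arc y d s \<tau> + \<theta> *\<^sub>R z
      = (y + ((1 - \<theta>) * \<tau>) *\<^sub>R d + ((1 - \<theta>) * (\<tau>\<^sup>2 / 2)) *\<^sub>R s) + \<theta> *\<^sub>R (z - y)"
    by (simp add: parab_arc_def algebra_simps)
  then have arc: "(1 - \<theta>) *\<^sub>R parab_arc y d s \<tau> + \<theta> *\<^sub>R z
      = parab_arc y d ((1 / (1 - \<theta>)) *\<^sub>R s + r *\<^sub>R (z - y)) t"
    unfolding weight by (simp add: parab_arc_def \<theta>(1) scaleR_add_right mult.commute[of r])
  have "(1 - \<theta>) * (gy + \<tau> * D + \<tau>\<^sup>2 / 2 * \<gamma>) + \<theta> * gz
      = gy + ((1 - \<theta>) * \<tau>) * D + ((1 - \<theta>) * (\<tau>\<^sup>2 / 2)) * \<gamma> + \<theta> * (gz - gy)"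
    by (simp add: algebra_simps)
  moreover have "\<theta> * (gz - gy) = t\<^sup>2 / 2 * (r * (gz - gy))"
    by (simp add: \<theta>(1))
  ultimately have val: "(1 - \<theta>) * (gy + \<tau> * D + \<tau>\<^sup>2 / 2 * \<gamma>) + \<theta> * gz
      = gy + t * D + t\<^sup>2 / 2 * (\<gamma> / (1 - \<theta>) + r * (gz - gy))"
    unfolding weight by (simp add: distrib_left)
  have "g (parab_arc y d s \<tau>) \<le> ereal (gy + \<tau> * D + \<tau>\<^sup>2 / 2 * \<gamma>)"
    using s parab_quot_le_iff[of g, OF gy D \<open>0 < \<tau>\<close>] by (simp add: \<tau>_def)
  moreover have "0 \<le> \<theta>"
    using \<open>0 \<le> r\<close> by (simp add: \<theta>(1))
  ultimately show ?thesis
    using econvexD[OF conv _ z _ less_imp_le[OF \<theta>(2)]]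
    unfolding parab_quot_le_iff[of g, OF gy D \<open>0 < t\<close>] arc[symmetric] val[symmetric] by blast
qed

lemma positive_null_sequence_quadratic_less:
  assumes "0 \<le> r"
  obtains t :: "nat \<Rightarrow> real" where "\<And>k. 0 < t k" "t \<longlonglongrightarrow> 0" "\<And>k. r * (t k)\<^sup>2 / 2 < 1"
proof -
  define t where "t k = inverse (real (Suc k)) / (r + 1)" for k
  have pos: "0 < t k" for k
    using assms by (simp add: t_def)
  have "t \<longlonglongrightarrow> 0 / (r + 1)"
    unfolding t_def using assms by (intro tendsto_intros LIMSEQ_inverse_real_of_nat) simp
  then have "t \<longlonglongrightarrow> 0"
    by simp
  moreover have "r * (t k)\<^sup>2 / 2 < 1" for k
  proof -
    have "t k \<le> 1 / (r + 1)"
      using assms unfolding t_def by (intro divide_right_mono) (simp_all add: inverse_le_1_iff)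
    then have "t k + r * t k \<le> 1"
      using assms by (simp add: field_simps)
    moreover have "0 \<le> r * t k"
      using assms pos[of k] by simp
    ultimately have "t k \<le> 1" "r * t k \<le> 1"
      using pos[of k] by linarith+
    then have "(r * t k) * t k \<le> 1"
      using mult_le_one less_imp_le[OF pos] by blast
    then show ?thesis
      by (simp add: power2_eq_square mult.assoc)
  qed
  ultimately show thesis
    using pos by (intro that)
qed

lemma parab_subderiv_recession:
  assumes conv: "econvex g" and gy: "g y = ereal gy" and epi: "parab_epi_diff g y d"
    and s: "parab_subderiv g y d s < ereal \<gamma>" and z: "g z \<le> ereal gz" and r: "0 \<le> r"
  shows "parab_subderiv g y d (s + r *\<^sub>R (z - y)) \<le> ereal (\<gamma> + r * (gz - gy))"
proof -
  obtain D where D: "subderiv g y d = ereal D"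
    using epi unfolding parab_epi_diff_def by (cases "subderiv g y d") auto
  obtain t :: "nat \<Rightarrow> real" where t: "\<And>k. 0 < t k" "t \<longlonglongrightarrow> 0" and less_1: "\<And>k. r * (t k)\<^sup>2 / 2 < 1"
    by (rule positive_null_sequence_quadratic_less[OF r]) blast
  define \<theta> where "\<theta> k = r * (t k)\<^sup>2 / 2" for k
  have \<theta>_less: "\<theta> k < 1" for k
    unfolding \<theta>_def by (rule less_1)
  have "\<theta> \<longlonglongrightarrow> r * 0\<^sup>2 / 2"
    unfolding \<theta>_def by (intro tendsto_intros t) simp
  then have \<theta>: "\<theta> \<longlonglongrightarrow> 0"
    by simp
  have "(\<lambda>k. t k / (1 - \<theta> k)) \<longlonglongrightarrow> 0 / (1 - 0)"
    by (intro tendsto_intros t \<theta>) simp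
  then have \<tau>: "(\<lambda>k. t k / (1 - \<theta> k)) \<longlonglongrightarrow> 0"
    by simp
  have \<tau>_pos: "0 < t k / (1 - \<theta> k)" for k
    using t(1) \<theta>_less by simp
  obtain sk where sk: "sk \<longlonglongrightarrow> s"
      "\<forall>\<^sub>F k in sequentially. parab_quot g y d (t k / (1 - \<theta> k)) (sk k) \<le> ereal \<gamma>"
    using parab_epi_diff_sequence[OF epi \<tau>_pos \<tau> s] .
  show ?thesis
  proof (rule parab_subderiv_le_limit[OF t])
    have "(\<lambda>k. (1 / (1 - \<theta> k)) *\<^sub>R sk k + r *\<^sub>R (z - y)) \<longlonglongrightarrow> (1 / (1 - 0)) *\<^sub>R s + r *\<^sub>R (z - y)"
      by (intro tendsto_intros sk \<theta>) simp
    then show "(\<lambda>k. (1 / (1 - \<theta> k)) *\<^sub>R sk k + r *\<^sub>R (z - y)) \<longlonglongrightarrow> s + r *\<^sub>R (z - y)"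
      by simp
    have "(\<lambda>k. \<gamma> / (1 - \<theta> k) + r * (gz - gy)) \<longlonglongrightarrow> \<gamma> / (1 - 0) + r * (gz - gy)"
      by (intro tendsto_intros \<theta>) simp
    then show "(\<lambda>k. \<gamma> / (1 - \<theta> k) + r * (gz - gy)) \<longlonglongrightarrow> \<gamma> + r * (gz - gy)"
      by simp
    show "\<forall>\<^sub>F k in sequentially. parab_quot g y d (t k) ((1 / (1 - \<theta> k)) *\<^sub>R sk k + r *\<^sub>R (z - y))
        \<le> ereal (\<gamma> / (1 - \<theta> k) + r * (gz - gy))"
      using sk(2)
      by eventually_elim (rule parab_quot_recession[OF conv gy D z r t(1) \<theta>_def \<theta>_less])
  qed
qed

lemma nonneg_if_multiples_bounded_below:
  fixes a :: real
  assumes "\<And>r. 0 < r \<Longrightarrow> K \<le> r * a"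
  shows "0 \<le> a"
proof (rule ccontr)
  assume "\<not> 0 \<le> a"
  then have "0 < (\<bar>K\<bar> + 1) / - a"
    by (intro divide_pos_pos) auto
  from assms[OF this] show False
    using \<open>\<not> 0 \<le> a\<close> by simp
qed

lemma subdiff_of_parab_subderiv_minorant:
  assumes conv: "econvex g" and gy: "g y = ereal gy" and epi: "parab_epi_diff g y d"
    and minorant: "\<And>s \<gamma>. parab_subderiv g y d s \<le> ereal \<gamma> \<Longrightarrow> k + \<eta> \<bullet> s \<le> \<gamma>"
  shows "\<eta> \<in> subdiff g y"
proof (rule subdiffI[of g, OF gy])
  fix z gz assume z: "g z \<le> ereal gz"
  obtain s \<gamma> where s: "parab_subderiv g y d s < ereal \<gamma>"
    using parab_epi_diff_finite[OF epi] .
  have "0 \<le> gz - gy - \<eta> \<bullet> (z - y)"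
  proof (rule nonneg_if_multiples_bounded_below)
    fix r :: real assume "0 < r"
    then have "k + \<eta> \<bullet> (s + r *\<^sub>R (z - y)) \<le> \<gamma> + r * (gz - gy)"
      using minorant[OF parab_subderiv_recession[OF conv gy epi s z]] by simp
    then show "k + \<eta> \<bullet> s - \<gamma> \<le> r * (gz - gy - \<eta> \<bullet> (z - y))"
      by (simp add: inner_add_right algebra_simps)
  qed
  then show "gy + \<eta> \<bullet> (z - y) \<le> gz"
    by simp
qed

lemma convex_on_imp_convex_strict_sublevel:
  assumes "convex_on S f"
  shows "convex {x \<in> S. f x < c}"
proof (rule convexI)
  fix x y and u v :: real
  assume xy: "x \<in> {x \<in> S. f x < c}" "y \<in> {x \<in> S. f x < c}" and uv: "0 \<le> u" "0 \<le> v" "u + v = 1"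
  then have "u *\<^sub>R x + v *\<^sub>R y \<in> S"
    using convexD[OF convex_on_imp_convex[OF assms]] by simp
  moreover have "f (u *\<^sub>R x + v *\<^sub>R y) \<le> u * f x + v * f y"
    using assms xy uv by (simp add: convex_on_def)
  moreover have "u * f x + v * f y < c"
    using xy uv by (intro convex_bound_lt) auto
  ultimately show "u *\<^sub>R x + v *\<^sub>R y \<in> {x \<in> S. f x < c}"
    by simp
qed

lemma convex_norm_strict_hypograph:
  fixes c :: real
  assumes "0 \<le> L"
  shows "convex {x :: 'a::real_normed_vector \<times> real. snd x + L * norm (fst x) < c}"
proof -
  have "convex_on UNIV (\<lambda>x :: 'a \<times> real. snd x + L * norm (fst x))"
  proof (intro convex_on_add convex_on_cmul assms)
    show "convex_on UNIV (snd :: 'a \<times> real \<Rightarrow> real)"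
      by (intro convex_onI) auto
    show "convex_on UNIV (\<lambda>x :: 'a \<times> real. norm (fst x))"
      by (intro convex_onI) (auto intro: order_trans[OF norm_triangle_ineq])
  qed
  then show ?thesis
    using convex_on_imp_convex_strict_sublevel by fastforce
qed

lemma norm_strict_hypograph_normal:
  fixes \<eta> :: "'a::real_inner" and \<theta> b c L :: real
  assumes nz: "(\<eta>, \<theta>) \<noteq> 0"
    and normal: "\<And>p e. 0 < e \<Longrightarrow> \<eta> \<bullet> p + \<theta> * (c - L * norm p - e) \<le> b"
  shows "0 < \<theta>" "\<theta> * c \<le> b"
proof -
  have "0 \<le> \<theta>"
  proof (rule nonneg_if_multiples_bounded_below)
    show "\<theta> * c - b \<le> e * \<theta>" if "0 < e" for e
      using normal[OF that, of 0] by (simp add: algebra_simps)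
  qed
  moreover have "\<theta> \<noteq> 0"
  proof
    assume "\<theta> = 0"
    then have "- b \<le> r * - (\<eta> \<bullet> \<eta>)" for r
      using normal[of 1 "r *\<^sub>R \<eta>"] by simp
    then have "0 \<le> - (\<eta> \<bullet> \<eta>)"
      by (rule nonneg_if_multiples_bounded_below)
    then show False
      using nz \<open>\<theta> = 0\<close> inner_ge_zero[of \<eta>] by (simp add: zero_prod_def)
  qed
  ultimately show "0 < \<theta>"
    by simp
  show "\<theta> * c \<le> b"
  proof (rule field_le_epsilon)
    fix e :: real assume "0 < e"
    then show "\<theta> * c \<le> b + e"
      using normal[of "e / \<theta>" 0] \<open>0 < \<theta>\<close> by (simp add: algebra_simps)
  qed
qed

lemma exact_penalty_imp_affine_minorant:
  fixes E :: "('a::euclidean_space \<times> real) set"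
  assumes E: "convex E" "E \<noteq> {}" and "0 \<le> L"
    and penalty: "\<And>p \<beta>. (p, \<beta>) \<in> E \<Longrightarrow> c \<le> \<beta> + L * norm p"
  obtains \<eta> where "\<And>p \<beta>. (p, \<beta>) \<in> E \<Longrightarrow> c + \<eta> \<bullet> p \<le> \<beta>"
proof -
  define S where "S = {x :: 'a \<times> real. snd x + L * norm (fst x) < c}"
  have "convex S"
    unfolding S_def using \<open>0 \<le> L\<close> by (rule convex_norm_strict_hypograph)
  moreover have "(0, c - 1) \<in> S"
    by (simp add: S_def)
  moreover have "S \<inter> E = {}"
    using penalty by (force simp: S_def)
  ultimately obtain a b where "a \<noteq> 0"
    and aS: "\<And>x. x \<in> S \<Longrightarrow> a \<bullet> x \<le> b" and aE: "\<And>x. x \<in> E \<Longrightarrow> b \<le> a \<bullet> x"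
    using separating_hyperplane_sets[of S E] E by (metis empty_iff)
  obtain \<eta> \<theta> where a: "a = (\<eta>, \<theta>)"
    by (cases a)
  have "\<eta> \<bullet> p + \<theta> * (c - L * norm p - e) \<le> b" if "0 < e" for p e
    using aS[of "(p, c - L * norm p - e)"] that by (simp add: S_def a)
  then have \<theta>: "0 < \<theta>" "\<theta> * c \<le> b"
    using norm_strict_hypograph_normal[of \<eta> \<theta> c L b] \<open>a \<noteq> 0\<close> a by auto
  show thesis
  proof (rule that)
    fix p \<beta> assume "(p, \<beta>) \<in> E"
    then have "\<theta> * c \<le> \<eta> \<bullet> p + \<theta> * \<beta>"
      using aE \<theta>(2) by (fastforce simp: a)
    then show "c + (- (1 / \<theta>) *\<^sub>R \<eta>) \<bullet> p \<le> \<beta>"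
      using \<theta>(1) by (simp add: field_simps)
  qed
qed

section \<open>Composite functions\<close>

lemma C2_fun_continuously_differentiable_grad: "C2_fun f \<Longrightarrow> continuously_differentiable (grad f)"
  by (simp add: C2_fun_def continuously_differentiable_def)

lemma C2_map_continuously_differentiable_jac: "C2_map F \<Longrightarrow> continuously_differentiable (jac F)"
  by (simp add: C2_map_def continuously_differentiable_def)

lemma bounded_bilinear_matrix_vector_mult:
  "bounded_bilinear ((*v) :: real^'n^'m \<Rightarrow> real^'n \<Rightarrow> real^'m)"
  unfolding bilinear_conv_bounded_bilinear[symmetric] bilinear_def
  by (auto intro!: linearI simp: algebra_simps scaleR_matrix_vector_assoc)

lemma C2_map_has_derivative:
  assumes "C2_map F"
  shows "(F has_derivative (*v) (jac F z)) (at z)"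
proof -
  have D: "(F has_derivative frechet_derivative F (at z)) (at z)"
    using assms frechet_derivative_works unfolding C2_map_def by blast
  then have "linear (frechet_derivative F (at z))"
    by (rule has_derivative_linear)
  then have "(*v) (jac F z) = frechet_derivative F (at z)"
    unfolding jac_def by (rule matrix_vector_mul)
  then show ?thesis
    using D by simp
qed

lemma C2_fun_has_derivative:
  assumes "C2_fun f"
  shows "(f has_derivative (\<bullet>) (grad f z)) (at z)"
proof -
  have D: "(f has_derivative frechet_derivative f (at z)) (at z)"
    using assms frechet_derivative_works unfolding C2_fun_def by blast
  then have lin: "linear (frechet_derivative f (at z))"
    by (rule has_derivative_linear)
  have "(\<bullet>) (grad f z) = frechet_derivative f (at z)"
  proof
    fix h
    have "frechet_derivative f (at z) h = frechet_derivative f (at z) (\<Sum>i\<in>UNIV. (h $ i) *\<^sub>R axis i 1)"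
      by (simp add: basis_expansion scalar_mult_eq_scaleR[symmetric])
    also have "\<dots> = (\<Sum>i\<in>UNIV. (h $ i) * frechet_derivative f (at z) (axis i 1))"
      by (simp add: linear_sum[OF lin] linear_scale[OF lin])
    finally show "grad f z \<bullet> h = frechet_derivative f (at z) h"
      by (simp add: grad_def inner_vec_def mult.commute)
  qed
  then show ?thesis
    using D by simp
qed

lemma hessq_minus:
  assumes "C2_fun f"
  shows "hessq f x (- v) = hessq f x v"
  unfolding hessq_def
    linear_neg[OF has_derivative_linear[OF
      continuously_differentiable_has_derivative[OF C2_fun_continuously_differentiable_grad[OF assms]]]]
  by simp

lemma d2F_minus:
  assumes "C2_map F"
  shows "d2F F x (- v) = d2F F x v"
  unfolding d2F_def
    linear_neg[OF has_derivative_linear[OF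
      continuously_differentiable_has_derivative[OF C2_map_continuously_differentiable_jac[OF assms]]]]
  by (simp add: bounded_bilinear.minus_left[OF bounded_bilinear_matrix_vector_mult]
      bounded_bilinear.minus_right[OF bounded_bilinear_matrix_vector_mult])

lemma transpose_mult_inner:
  fixes A :: "real^'n^'m"
  shows "(transpose A *v \<mu>) \<bullet> h = \<mu> \<bullet> (A *v h)"
  by (simp add: transpose_matrix_vector dot_lmul_matrix)

definition composite ::
    "('a \<Rightarrow> real) \<Rightarrow> ('a \<Rightarrow> 'b) \<Rightarrow> ('b \<Rightarrow> ereal) \<Rightarrow> 'a \<Rightarrow> ereal" where
  "composite f0 F g x = ereal (f0 x) + g (F x)"

definition grad_lagrangian ::
    "(real^'n \<Rightarrow> real) \<Rightarrow> (real^'n \<Rightarrow> real^'m) \<Rightarrow> real^'n \<Rightarrow> real^'m \<Rightarrow> real^'n" where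
  "grad_lagrangian f0 F x \<mu> = grad f0 x + transpose (jac F x) *v \<mu>"

definition hessq_lagrangian ::
    "(real^'n \<Rightarrow> real) \<Rightarrow> (real^'n \<Rightarrow> real^'m) \<Rightarrow> real^'n \<Rightarrow> real^'m \<Rightarrow> real^'n \<Rightarrow> real" where
  "hessq_lagrangian f0 F x \<mu> v = hessq f0 x v + \<mu> \<bullet> d2F F x v"

lemma grad_lagrangian_inner:
  "grad_lagrangian f0 F x \<mu> \<bullet> h = grad f0 x \<bullet> h + \<mu> \<bullet> (jac F x *v h)"
  unfolding grad_lagrangian_def inner_add_left transpose_mult_inner ..

lemma hessq_lagrangian_minus:
  assumes "C2_fun f0" "C2_map F"
  shows "hessq_lagrangian f0 F x \<mu> (- v) = hessq_lagrangian f0 F x \<mu> v"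
  using assms by (simp add: hessq_lagrangian_def hessq_minus d2F_minus)

lemma C2_map_tendsto_jac:
  assumes "C2_map F" "(xk \<longlongrightarrow> x) K"
  shows "((\<lambda>k. jac F (xk k)) \<longlongrightarrow> jac F x) K"
  using has_derivative_continuous[OF continuously_differentiable_has_derivative[OF
      C2_map_continuously_differentiable_jac[OF assms(1)]]] assms(2)
  by (rule isCont_tendsto_compose)

lemma C2_fun_tendsto_grad:
  assumes "C2_fun f" "(xk \<longlongrightarrow> x) K"
  shows "((\<lambda>k. grad f (xk k)) \<longlongrightarrow> grad f x) K"
  using has_derivative_continuous[OF continuously_differentiable_has_derivative[OF
      C2_fun_continuously_differentiable_grad[OF assms(1)]]] assms(2)
  by (rule isCont_tendsto_compose)

lemma tendsto_grad_lagrangian: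
  assumes "C2_fun f0" "C2_map F" "(xk \<longlongrightarrow> x) K" "(\<mu>k \<longlongrightarrow> \<mu>) K"
  shows "((\<lambda>k. grad_lagrangian f0 F (xk k) (\<mu>k k)) \<longlongrightarrow> grad_lagrangian f0 F x \<mu>) K"
proof -
  have "((\<lambda>k. transpose (jac F (xk k))) \<longlongrightarrow> transpose (jac F x)) K"
    unfolding transpose_def by (intro tendsto_intros C2_map_tendsto_jac assms)
  then show ?thesis
    unfolding grad_lagrangian_def
    by (intro tendsto_add C2_fun_tendsto_grad assms
        bounded_bilinear.tendsto[OF bounded_bilinear_matrix_vector_mult])
qed

lemma tendsto_hessq_lagrangian:
  assumes "C2_fun f0" "C2_map F" "(xk \<longlongrightarrow> x) K" "(\<mu>k \<longlongrightarrow> \<mu>) K" "(vk \<longlongrightarrow> v) K"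
  shows "((\<lambda>k. hessq_lagrangian f0 F (xk k) (\<mu>k k) (vk k)) \<longlongrightarrow> hessq_lagrangian f0 F x \<mu> v) K"
  unfolding hessq_lagrangian_def hessq_def d2F_def
  by (intro tendsto_add tendsto_inner bounded_bilinear.tendsto[OF bounded_bilinear_matrix_vector_mult]
      tendsto_frechet_derivative C2_fun_continuously_differentiable_grad
      C2_map_continuously_differentiable_jac assms)

lemma quadratic_minorant_composite:
  fixes F :: "real^'n \<Rightarrow> real^'m"
  assumes f0: "\<And>x'. x' \<in> S \<Longrightarrow> norm (f0 x' - f0 x - grad f0 x \<bullet> (x' - x)) \<le> K0 * (norm (x' - x))\<^sup>2"
    and F: "\<And>x'. x' \<in> S \<Longrightarrow> norm (F x' - F x - jac F x *v (x' - x)) \<le> K1 * (norm (x' - x))\<^sup>2"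
    and mu: "\<mu> \<in> subdiff g (F x)" and "norm \<mu> \<le> B"
  shows "quadratic_minorant (composite f0 F g) S x (grad_lagrangian f0 F x \<mu>) (- (K0 + B * K1))"
proof -
  obtain gy where gy: "g (F x) = ereal gy" "\<And>z. ereal (gy + \<mu> \<bullet> (z - F x)) \<le> g z"
    by (rule subdiffE[OF mu]) blast
  have "0 \<le> B"
    using \<open>norm \<mu> \<le> B\<close> norm_ge_zero order_trans by blast
  show ?thesis
  proof (rule quadratic_minorantI)
    show "composite f0 F g x = ereal (f0 x + gy)"
      by (simp add: composite_def gy(1))
    fix x' assume x': "x' \<in> S"
    define h where "h = x' - x"
    have "f0 x + grad f0 x \<bullet> h - K0 * (norm h)\<^sup>2 \<le> f0 x'"
      using f0[OF x'] by (simp add: h_def)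
    moreover have "\<mu> \<bullet> (jac F x *v h) - \<mu> \<bullet> (F x' - F x) \<le> B * (K1 * (norm h)\<^sup>2)"
    proof -
      have "\<mu> \<bullet> (jac F x *v h) - \<mu> \<bullet> (F x' - F x) \<le> norm \<mu> * norm (F x' - F x - jac F x *v h)"
        using Cauchy_Schwarz_ineq2[of \<mu> "F x' - F x - jac F x *v h"] by (simp add: inner_diff_right)
      also have "\<dots> \<le> B * (K1 * (norm h)\<^sup>2)"
        using F[OF x'] \<open>norm \<mu> \<le> B\<close> \<open>0 \<le> B\<close> unfolding h_def by (intro mult_mono) auto
      finally show ?thesis .
    qed
    ultimately have "ereal (f0 x + gy + grad_lagrangian f0 F x \<mu> \<bullet> h + - (K0 + B * K1) * (norm h)\<^sup>2)
        \<le> ereal (f0 x') + ereal (gy + \<mu> \<bullet> (F x' - F x))"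
      by (simp add: grad_lagrangian_inner algebra_simps)
    also have "\<dots> \<le> composite f0 F g x'"
      unfolding composite_def by (intro add_left_mono gy(2))
    finally show "ereal (f0 x + gy + grad_lagrangian f0 F x \<mu> \<bullet> (x' - x)
      + - (K0 + B * K1) * (norm (x' - x))\<^sup>2)
        \<le> composite f0 F g x'"
      unfolding h_def .
  qed
qed

lemma composite_quadratic_minorant_uniform:
  fixes F :: "real^'n \<Rightarrow> real^'m"
  assumes f0: "C2_fun f0" and F: "C2_map F" and S: "compact S" "convex S" and "0 \<le> B"
  obtains r where "0 \<le> r"
    "\<And>x \<mu>. x \<in> S \<Longrightarrow> \<mu> \<in> subdiff g (F x) \<Longrightarrow> norm \<mu> \<le> B \<Longrightarrow>
      quadratic_minorant (composite f0 F g) S x (grad_lagrangian f0 F x \<mu>) (- r)"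
proof -
  obtain L0 where "L0-lipschitz_on S (grad f0)"
    using continuously_differentiable_lipschitz_on[OF C2_fun_continuously_differentiable_grad[OF f0] S] .
  then obtain K0 where K0: "0 \<le> K0" "\<And>x x'. x \<in> S \<Longrightarrow> x' \<in> S \<Longrightarrow>
      norm (f0 x' - f0 x - grad f0 x \<bullet> (x' - x)) \<le> K0 * (norm (x' - x))\<^sup>2"
    using taylor_first_order[OF bounded_bilinear_inner C2_fun_has_derivative[OF f0] S(2)] by metis
  obtain L1 where "L1-lipschitz_on S (jac F)"
    using continuously_differentiable_lipschitz_on[OF C2_map_continuously_differentiable_jac[OF F] S] .
  then obtain K1 where K1: "0 \<le> K1" "\<And>x x'. x \<in> S \<Longrightarrow> x' \<in> S \<Longrightarrow>
      norm (F x' - F x - jac F x *v (x' - x)) \<le> K1 * (norm (x' - x))\<^sup>2"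
    using taylor_first_order[OF bounded_bilinear_matrix_vector_mult C2_map_has_derivative[OF F] S(2)]
    by metis
  show thesis
  proof (rule that)
    show "0 \<le> K0 + B * K1"
      using K0(1) K1(1) \<open>0 \<le> B\<close> by simp
  qed (intro quadratic_minorant_composite K0(2) K1(2))
qed

lemma composite_tilt_stable_growth:
  fixes F :: "real^'n \<Rightarrow> real^'m"
  assumes f0: "C2_fun f0" and F: "C2_map F" and g: "proper g" and xb: "F xb \<in> edom g"
    and tilt: "tilt_stable (composite f0 F g) xb \<kappa>" and "0 < \<kappa>" and "0 \<le> B"
  obtains \<eta> where "0 < \<eta>"
    "\<And>x \<mu>. norm (x - xb) < \<eta> \<Longrightarrow> \<mu> \<in> subdiff g (F x) \<Longrightarrow> norm \<mu> \<le> B \<Longrightarrow>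
      norm (grad_lagrangian f0 F x \<mu>) < \<eta> \<Longrightarrow>
      \<exists>\<rho>>0. quadratic_minorant (composite f0 F g) (ball x \<rho>) x (grad_lagrangian f0 F x \<mu>) (1 / (2 * \<kappa>))"
proof -
  have "composite f0 F g z \<noteq> - \<infinity>" for z
    using g by (simp add: composite_def proper_def)
  moreover have "composite f0 F g xb \<noteq> \<infinity>"
    using xb by (simp add: composite_def edom_def)
  ultimately obtain \<delta> where "0 < \<delta>" and growth: "\<And>r. 0 \<le> r \<Longrightarrow> \<exists>\<eta>>0. \<forall>x xs. norm (x - xb) < \<eta> \<longrightarrow>
      norm xs < \<eta> \<longrightarrow> quadratic_minorant (composite f0 F g) (cball xb \<delta>) x xs (- r) \<longrightarrow>
      (\<exists>\<rho>>0. quadratic_minorant (composite f0 F g) (ball x \<rho>) x xs (1 / (2 * \<kappa>)))"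
    using tilt_stable_quadratic_growth[OF tilt \<open>0 < \<kappa>\<close>] by blast
  obtain r where "0 \<le> r" and minorant: "\<And>x \<mu>. x \<in> cball xb \<delta> \<Longrightarrow> \<mu> \<in> subdiff g (F x) \<Longrightarrow>
      norm \<mu> \<le> B \<Longrightarrow> quadratic_minorant (composite f0 F g) (cball xb \<delta>) x (grad_lagrangian f0 F x \<mu>) (- r)"
    by (rule composite_quadratic_minorant_uniform[OF f0 F compact_cball convex_cball \<open>0 \<le> B\<close>]) blast
  obtain \<eta> where "0 < \<eta>" and \<eta>: "\<And>x xs. norm (x - xb) < \<eta> \<Longrightarrow> norm xs < \<eta> \<Longrightarrow>
      quadratic_minorant (composite f0 F g) (cball xb \<delta>) x xs (- r) \<Longrightarrow>
      \<exists>\<rho>>0. quadratic_minorant (composite f0 F g) (ball x \<rho>) x xs (1 / (2 * \<kappa>))"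
    using growth[OF \<open>0 \<le> r\<close>] by blast
  show thesis
  proof (rule that)
    show "0 < min \<eta> \<delta>"
      using \<open>0 < \<eta>\<close> \<open>0 < \<delta>\<close> by simp
  qed (use \<eta> minorant in \<open>auto simp: dist_norm norm_minus_commute\<close>)
qed

section \<open>Second-order growth along parabolic arcs\<close>

definition metric_subregular_on ::
    "('a::metric_space \<Rightarrow> 'b::metric_space) \<Rightarrow> 'b set \<Rightarrow> real \<Rightarrow> 'a set \<Rightarrow> bool" where
  "metric_subregular_on F D \<kappa> U \<longleftrightarrow> (\<forall>x\<in>U. infdist x (F -` D) \<le> \<kappa> * infdist (F x) D)"

lemma metric_subregular_on_approx:
  assumes reg: "metric_subregular_on F D \<kappa> U" and "0 \<le> \<kappa>" "x \<in> U" "y \<in> D" "F -` D \<noteq> {}" "0 < e"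
  obtains x' where "F x' \<in> D" "dist x x' < \<kappa> * dist (F x) y + e"
proof -
  have "infdist x (F -` D) \<le> \<kappa> * infdist (F x) D"
    using reg \<open>x \<in> U\<close> by (simp add: metric_subregular_on_def)
  also have "\<dots> \<le> \<kappa> * dist (F x) y"
    using \<open>0 \<le> \<kappa>\<close> \<open>y \<in> D\<close> by (intro mult_left_mono infdist_le)
  also have "\<dots> < \<kappa> * dist (F x) y + e"
    using \<open>0 < e\<close> by simp
  finally have "\<exists>x'\<in>F -` D. dist x x' < \<kappa> * dist (F x) y + e"
    using \<open>F -` D \<noteq> {}\<close> by (subst (asm) infdist_notempty) (auto simp: cInf_less_iff)
  then show thesis
    using that by auto
qed

lemma dist_parab_arc:
  fixes x :: "'a::real_normed_vector"
  shows "dist (parab_arc x d a t) (parab_arc x d b t) = t\<^sup>2 / 2 * norm (a - b)"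
proof -
  have "parab_arc x d a t - parab_arc x d b t = (t\<^sup>2 / 2) *\<^sub>R (a - b)"
    by (simp add: parab_arc_def scaleR_diff_right)
  then show ?thesis
    by (simp add: dist_norm)
qed

lemma parab_arc_surj:
  assumes "0 < t"
  obtains w where "x' = parab_arc x d w t"
  using assms by (intro that[of "(2 / t\<^sup>2) *\<^sub>R (x' - x - t *\<^sub>R d)"]) (simp add: parab_arc_def)

locale composite_growth =
  fixes f0 :: "real^'n \<Rightarrow> real" and F :: "real^'n \<Rightarrow> real^'m" and g :: "real^'m \<Rightarrow> ereal"
    and x :: "real^'n" and \<mu> :: "real^'m" and \<kappa> \<kappa>0 ell :: real
    and U :: "(real^'n) set" and V :: "(real^'m) set"
  assumes f0: "C2_fun f0" and F: "C2_map F" and g_proper: "proper g" and g_convex: "econvex g"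
    and mu: "\<mu> \<in> subdiff g (F x)"
    and kappa: "0 < \<kappa>"
    and growth: "\<exists>\<rho>>0. quadratic_minorant (composite f0 F g) (ball x \<rho>) x
      (grad_lagrangian f0 F x \<mu>) (1 / (2 * \<kappa>))"
    and V: "open V" "F x \<in> V" and lipschitz: "ell-lipschitz_on (V \<inter> edom g) (\<lambda>y. real_of_ereal (g y))"
    and U: "open U" "x \<in> U" and subregular: "metric_subregular_on F (edom g) \<kappa>0 U"
    and kappa0: "0 < \<kappa>0"

locale composite_growth_direction = composite_growth f0 F g x \<mu> \<kappa> \<kappa>0 ell U V
  for f0 :: "real^'n \<Rightarrow> real" and F :: "real^'n \<Rightarrow> real^'m" and g x \<mu> \<kappa> \<kappa>0 ell U V +
  fixes d :: "real^'n"
  assumes critical: "subderiv g (F x) (jac F x *v d) = ereal (\<mu> \<bullet> (jac F x *v d))"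
begin

abbreviation "A \<equiv> jac F x"
abbreviation "q \<equiv> d2F F x d"
abbreviation "\<psi> \<equiv> parab_subderiv g (F x) (A *v d)"

lemma g_finite:
  assumes "y \<in> edom g"
  shows "g y = ereal (real_of_ereal (g y))"
  using assms g_proper by (cases "g y") (auto simp: edom_def proper_def)

lemma F_x_edom: "F x \<in> edom g"
  using mu by (auto simp: subdiff_def edom_def)

definition F_quot :: "real^'n \<Rightarrow> real \<Rightarrow> real^'m" where
  "F_quot w t = (2 / t\<^sup>2) *\<^sub>R (F (parab_arc x d w t) - F x - t *\<^sub>R (A *v d))"

definition f0_quot :: "real^'n \<Rightarrow> real \<Rightarrow> real" where
  "f0_quot w t = (2 / t\<^sup>2) *\<^sub>R (f0 (parab_arc x d w t) - f0 x - t *\<^sub>R (grad f0 x \<bullet> d))"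

lemma tendsto_F_quot:
  assumes "\<And>k. 0 < t k" "t \<longlonglongrightarrow> 0" "wk \<longlonglongrightarrow> w"
  shows "(\<lambda>k. F_quot (wk k) (t k)) \<longlonglongrightarrow> A *v w + q"
  unfolding F_quot_def d2F_def
  by (rule parabolic_second_difference_tendsto[OF bounded_bilinear_matrix_vector_mult
      C2_map_has_derivative[OF F] continuously_differentiable_has_derivative[OF
      C2_map_continuously_differentiable_jac[OF F]] assms])

lemma tendsto_f0_quot:
  assumes "\<And>k. 0 < t k" "t \<longlonglongrightarrow> 0" "wk \<longlonglongrightarrow> w"
  shows "(\<lambda>k. f0_quot (wk k) (t k)) \<longlonglongrightarrow> grad f0 x \<bullet> w + hessq f0 x d"
  unfolding f0_quot_def hessq_def
  by (rule parabolic_second_difference_tendsto[OF bounded_bilinear_inner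
      C2_fun_has_derivative[OF f0] continuously_differentiable_has_derivative[OF
      C2_fun_continuously_differentiable_grad[OF f0]] assms])

lemma F_parab_arc:
  assumes "0 < t"
  shows "F (parab_arc x d w t) = parab_arc (F x) (A *v d) (F_quot w t) t"
  using assms by (simp add: F_quot_def parab_arc_def[of "F x"])

lemma arc_correction:
  assumes "0 < t" "parab_arc x d w t \<in> U" "parab_arc (F x) (A *v d) s t \<in> edom g"
  obtains w' where "F (parab_arc x d w' t) \<in> edom g" "norm (w' - w) \<le> \<kappa>0 * norm (F_quot w t - s) + t"
proof -
  have "F -` edom g \<noteq> {}"
    using F_x_edom by auto
  moreover have "0 < t\<^sup>2 / 2 * t"
    using assms(1) by simp
  ultimately obtain x' where "F x' \<in> edom g" and x': "dist (parab_arc x d w t) x'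
      < \<kappa>0 * dist (F (parab_arc x d w t)) (parab_arc (F x) (A *v d) s t) + t\<^sup>2 / 2 * t"
    using metric_subregular_on_approx[OF subregular less_imp_le[OF kappa0] assms(2,3)] by blast
  obtain w' where w': "x' = parab_arc x d w' t"
    using parab_arc_surj[OF assms(1)] .
  have "t\<^sup>2 / 2 * norm (w' - w) < t\<^sup>2 / 2 * (\<kappa>0 * norm (F_quot w t - s) + t)"
    using x' unfolding w' F_parab_arc[OF assms(1)] dist_parab_arc
    by (simp add: norm_minus_commute algebra_simps)
  then have "norm (w' - w) \<le> \<kappa>0 * norm (F_quot w t - s) + t"
    using assms(1) by (simp add: mult_less_cancel_left_pos)
  then show thesis
    using \<open>F x' \<in> edom g\<close> w' by (intro that) auto
qed

lemma arc_value_le: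
  assumes t: "0 < t" and FX: "F (parab_arc x d w t) \<in> V \<inter> edom g"
    and Y: "parab_arc (F x) (A *v d) s t \<in> V" and s: "parab_quot g (F x) (A *v d) t s \<le> ereal \<gamma>"
  shows "real_of_ereal (g (F (parab_arc x d w t))) \<le> real_of_ereal (g (F x)) + t * (\<mu> \<bullet> (A *v d))
    + t\<^sup>2 / 2 * (\<gamma> + ell * norm (F_quot w t - s))"
proof -
  define Y where "Y = parab_arc (F x) (A *v d) s t"
  have gY_le: "g Y \<le> ereal (real_of_ereal (g (F x)) + t * (\<mu> \<bullet> (A *v d)) + t\<^sup>2 / 2 * \<gamma>)"
    using s parab_quot_le_iff[of g, OF g_finite[OF F_x_edom] critical t] by (simp add: Y_def)
  then have Y_edom: "Y \<in> edom g"
    by (auto simp: edom_def)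
  have "real_of_ereal (g (F (parab_arc x d w t))) - real_of_ereal (g Y)
    \<le> ell * dist (F (parab_arc x d w t)) Y"
    using lipschitz_onD[OF lipschitz, of "F (parab_arc x d w t)" Y] FX Y Y_edom
    by (simp add: Y_def dist_real_def)
  also have "dist (F (parab_arc x d w t)) Y = t\<^sup>2 / 2 * norm (F_quot w t - s)"
    by (simp add: Y_def F_parab_arc[OF t] dist_parab_arc)
  finally have "real_of_ereal (g (F (parab_arc x d w t)))
      \<le> real_of_ereal (g Y) + t\<^sup>2 / 2 * (ell * norm (F_quot w t - s))"
    by (simp add: ac_simps)
  moreover have "real_of_ereal (g Y) \<le> real_of_ereal (g (F x)) + t * (\<mu> \<bullet> (A *v d)) + t\<^sup>2 / 2 * \<gamma>"
    using gY_le g_finite[OF Y_edom] by (metis ereal_less_eq(3))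
  ultimately show ?thesis
    unfolding distrib_left by linarith
qed

lemma arc_growth:
  assumes minorant: "quadratic_minorant (composite f0 F g) (ball x \<rho>) x
      (grad_lagrangian f0 F x \<mu>) (1 / (2 * \<kappa>))"
    and t: "0 < t" and ball: "parab_arc x d w t \<in> ball x \<rho>"
    and FX: "F (parab_arc x d w t) \<in> V \<inter> edom g" and Y: "parab_arc (F x) (A *v d) s t \<in> V"
    and s: "parab_quot g (F x) (A *v d) t s \<le> ereal \<gamma>"
  shows "grad f0 x \<bullet> w + \<mu> \<bullet> (A *v w) + (norm (d + (t / 2) *\<^sub>R w))\<^sup>2 / \<kappa>
    \<le> f0_quot w t + (\<gamma> + ell * norm (F_quot w t - s))"
proof -
  define h where "h = t\<^sup>2 / 2"
  define X where "X = parab_arc x d w t"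
  have "0 < h"
    using t by (simp add: h_def)
  have X_diff: "X - x = t *\<^sub>R d + h *\<^sub>R w" "X - x = t *\<^sub>R (d + (t / 2) *\<^sub>R w)"
    by (simp_all add: X_def h_def parab_arc_def power2_eq_square scaleR_add_right)
  have "grad_lagrangian f0 F x \<mu> \<bullet> (X - x) + 1 / (2 * \<kappa>) * (norm (X - x))\<^sup>2
      \<le> f0 X - f0 x + (real_of_ereal (g (F X)) - real_of_ereal (g (F x)))"
  proof -
    have "composite f0 F g x = ereal (f0 x + real_of_ereal (g (F x)))"
        "composite f0 F g X = ereal (f0 X + real_of_ereal (g (F X)))"
      unfolding composite_def plus_ereal.simps(1)[symmetric]
      using g_finite F_x_edom FX by (auto simp: X_def)
    with quadratic_minorantD[OF minorant _ ball] show ?thesis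
      by (simp add: X_def)
  qed
  moreover have "grad_lagrangian f0 F x \<mu> \<bullet> (X - x) =
      t * (grad f0 x \<bullet> d + \<mu> \<bullet> (A *v d)) + h * (grad f0 x \<bullet> w + \<mu> \<bullet> (A *v w))"
    unfolding grad_lagrangian_inner X_diff(1)
    by (simp add: matrix_vector_right_distrib matrix_vector_mult_scaleR inner_add_right algebra_simps)
  moreover have "1 / (2 * \<kappa>) * (norm (X - x))\<^sup>2 = h * ((norm (d + (t / 2) *\<^sub>R w))\<^sup>2 / \<kappa>)"
    unfolding X_diff(2) by (simp add: h_def power_mult_distrib)
  moreover have "h * f0_quot w t = f0 X - f0 x - t * (grad f0 x \<bullet> d)"
    using t by (simp add: f0_quot_def X_def h_def)
  moreover have "real_of_ereal (g (F X)) \<le> real_of_ereal (g (F x)) + t * (\<mu> \<bullet> (A *v d))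
      + h * (\<gamma> + ell * norm (F_quot w t - s))"
    unfolding X_def h_def using t FX Y s by (rule arc_value_le)
  ultimately have "h * (grad f0 x \<bullet> w + \<mu> \<bullet> (A *v w) + (norm (d + (t / 2) *\<^sub>R w))\<^sup>2 / \<kappa>)
      \<le> h * (f0_quot w t + (\<gamma> + ell * norm (F_quot w t - s)))"
    unfolding distrib_left by linarith
  then show ?thesis
    using \<open>0 < h\<close> by (simp only: mult_le_cancel_left_pos)
qed

lemma corrected_arcs:
  assumes s: "\<psi> s < ereal \<gamma>"
  obtains t sk wk where "\<And>k. 0 < t k" "t \<longlonglongrightarrow> 0" "sk \<longlonglongrightarrow> s"
    "\<And>k. parab_quot g (F x) (A *v d) (t k) (sk k) \<le> ereal \<gamma>"
    "\<And>k. F (parab_arc x d (wk k) (t k)) \<in> edom g"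
    "\<And>k. norm (wk k - w) \<le> \<kappa>0 * norm (F_quot w (t k) - sk k) + t k"
proof -
  have "((\<lambda>p. parab_arc x d w (fst p)) \<longlongrightarrow> x) (at_right 0 \<times>\<^sub>F nhds s)"
    by (rule tendsto_parab_arc[OF filterlim_compose[OF tendsto_ident_at filterlim_fst] tendsto_const])
  then have "\<forall>\<^sub>F p in at_right 0 \<times>\<^sub>F nhds s. parab_arc x d w (fst p) \<in> U"
    using U by (rule topological_tendstoD)
  then have "\<exists>\<^sub>F p in at_right 0 \<times>\<^sub>F nhds s.
      parab_arc x d w (fst p) \<in> U \<and> (case p of (t, s') \<Rightarrow> parab_quot g (F x) (A *v d) t s') < ereal \<gamma>"
    using s[unfolded parab_subderiv_def]
    by (intro frequently_eventually_conj frequently_less_of_Liminf_less)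
  then obtain t sk where t: "\<And>k. 0 < t k" "t \<longlonglongrightarrow> 0" and sk: "sk \<longlonglongrightarrow> s"
    and quot: "\<And>k. parab_quot g (F x) (A *v d) (t k) (sk k) < ereal \<gamma>"
    and in_U: "\<And>k. parab_arc x d w (t k) \<in> U"
    by (rule frequently_at_right_prod_sequence) auto
  have "parab_arc (F x) (A *v d) (sk k) (t k) \<in> edom g" for k
    using less_imp_le[OF quot[of k]] parab_quot_le_iff[of g, OF g_finite[OF F_x_edom] critical t(1)]
    by (auto simp: edom_def intro: le_less_trans)
  then have "\<forall>k. \<exists>w'. F (parab_arc x d w' (t k)) \<in> edom g \<and>
      norm (w' - w) \<le> \<kappa>0 * norm (F_quot w (t k) - sk k) + t k"
    using arc_correction[OF t(1) in_U] by metis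
  then obtain wk where "\<And>k. F (parab_arc x d (wk k) (t k)) \<in> edom g"
      "\<And>k. norm (wk k - w) \<le> \<kappa>0 * norm (F_quot w (t k) - sk k) + t k"
    by metis
  then show thesis
    using t sk less_imp_le[OF quot] by (intro that)
qed

lemma convergent_corrected_arcs:
  assumes s: "\<psi> s < ereal \<gamma>"
  obtains t sk wk w' where "\<And>k. 0 < t k" "t \<longlonglongrightarrow> 0" "sk \<longlonglongrightarrow> s" "wk \<longlonglongrightarrow> w'"
    "\<And>k. parab_quot g (F x) (A *v d) (t k) (sk k) \<le> ereal \<gamma>"
    "\<And>k. F (parab_arc x d (wk k) (t k)) \<in> edom g"
    "norm (w' - w) \<le> \<kappa>0 * norm (A *v w + q - s)"
proof -
  obtain t sk wk where t: "\<And>k. 0 < t k" "t \<longlonglongrightarrow> 0" and sk: "sk \<longlonglongrightarrow> s"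
    and quot: "\<And>k. parab_quot g (F x) (A *v d) (t k) (sk k) \<le> ereal \<gamma>"
    and feasible: "\<And>k. F (parab_arc x d (wk k) (t k)) \<in> edom g"
    and wk: "\<And>k. norm (wk k - w) \<le> \<kappa>0 * norm (F_quot w (t k) - sk k) + t k"
    by (rule corrected_arcs[OF s, of w]) blast
  have bound: "(\<lambda>k. \<kappa>0 * norm (F_quot w (t k) - sk k) + t k) \<longlonglongrightarrow> \<kappa>0 * norm (A *v w + q - s) + 0"
    by (intro tendsto_intros tendsto_F_quot t sk)
  then obtain B where B: "\<And>k. norm (\<kappa>0 * norm (F_quot w (t k) - sk k) + t k) \<le> B"
    using convergent_imp_bounded[OF bound] by (auto simp: bounded_iff)
  have "norm (wk k - w) \<le> B" for k
    using wk[of k] B[of k] by simp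
  then have "bounded (range (\<lambda>k. wk k - w))"
    by (auto intro: boundedI)
  then obtain l \<phi> where \<phi>: "strict_mono \<phi>" and l: "((\<lambda>k. wk k - w) \<circ> \<phi>) \<longlonglongrightarrow> l"
    using bounded_imp_convergent_subsequence by blast
  show thesis
  proof (rule that)
    show "(t \<circ> \<phi>) \<longlonglongrightarrow> 0" "(sk \<circ> \<phi>) \<longlonglongrightarrow> s"
      using LIMSEQ_subseq_LIMSEQ \<phi> t(2) sk by blast+
    show "(wk \<circ> \<phi>) \<longlonglongrightarrow> l + w"
      using tendsto_add[OF l tendsto_const[of w]] by (simp add: o_def)
    have "norm l \<le> \<kappa>0 * norm (A *v w + q - s) + 0"
      by (rule LIMSEQ_le[OF tendsto_norm[OF l] LIMSEQ_subseq_LIMSEQ[OF bound \<phi>]]) (use wk in auto)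
    then show "norm (l + w - w) \<le> \<kappa>0 * norm (A *v w + q - s)"
      by simp
  qed (use t(1) quot feasible in auto)
qed

lemma parabolic_growth:
  assumes s: "\<psi> s < ereal \<gamma>"
  obtains w' where "norm (w' - w) \<le> \<kappa>0 * norm (A *v w + q - s)"
    "\<mu> \<bullet> (A *v w') + (norm d)\<^sup>2 / \<kappa> \<le> hessq f0 x d + \<gamma> + ell * norm (A *v w' + q - s)"
proof -
  obtain t sk wk w' where t: "\<And>k. 0 < t k" "t \<longlonglongrightarrow> 0" and sk: "sk \<longlonglongrightarrow> s" and wk: "wk \<longlonglongrightarrow> w'"
    and quot: "\<And>k. parab_quot g (F x) (A *v d) (t k) (sk k) \<le> ereal \<gamma>"
    and feasible: "\<And>k. F (parab_arc x d (wk k) (t k)) \<in> edom g"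
    and w': "norm (w' - w) \<le> \<kappa>0 * norm (A *v w + q - s)"
    by (rule convergent_corrected_arcs[OF s, of w]) blast
  obtain \<rho> where "0 < \<rho>" and minorant: "quadratic_minorant (composite f0 F g) (ball x \<rho>) x
      (grad_lagrangian f0 F x \<mu>) (1 / (2 * \<kappa>))"
    using growth by blast
  have "(\<lambda>k. parab_arc x d (wk k) (t k)) \<longlonglongrightarrow> x"
    by (rule tendsto_parab_arc[OF t(2) wk])
  then have "\<forall>\<^sub>F k in sequentially. parab_arc x d (wk k) (t k) \<in> ball x \<rho>"
    using \<open>0 < \<rho>\<close> by (intro topological_tendstoD) auto
  moreover have "(\<lambda>k. F (parab_arc x d (wk k) (t k))) \<longlonglongrightarrow> F x"
    unfolding F_parab_arc[OF t(1)] by (rule tendsto_parab_arc[OF t(2) tendsto_F_quot[OF t wk]])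
  then have "\<forall>\<^sub>F k in sequentially. F (parab_arc x d (wk k) (t k)) \<in> V"
    using V by (rule topological_tendstoD)
  moreover have "(\<lambda>k. parab_arc (F x) (A *v d) (sk k) (t k)) \<longlonglongrightarrow> F x"
    by (rule tendsto_parab_arc[OF t(2) sk])
  then have "\<forall>\<^sub>F k in sequentially. parab_arc (F x) (A *v d) (sk k) (t k) \<in> V"
    using V by (rule topological_tendstoD)
  ultimately have "\<forall>\<^sub>F k in sequentially.
      grad f0 x \<bullet> wk k + \<mu> \<bullet> (A *v wk k) + (norm (d + (t k / 2) *\<^sub>R wk k))\<^sup>2 / \<kappa>
      \<le> f0_quot (wk k) (t k) + (\<gamma> + ell * norm (F_quot (wk k) (t k) - sk k))"
    by eventually_elim (rule arc_growth[OF minorant t(1) _ _ _ quot], use feasible in auto)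
  moreover have "(\<lambda>k. grad f0 x \<bullet> wk k + \<mu> \<bullet> (A *v wk k) + (norm (d + (t k / 2) *\<^sub>R wk k))\<^sup>2 / \<kappa>)
      \<longlonglongrightarrow> grad f0 x \<bullet> w' + \<mu> \<bullet> (A *v w') + (norm (d + (0 / 2) *\<^sub>R w'))\<^sup>2 / \<kappa>"
    using kappa by (intro tendsto_intros wk t
      bounded_bilinear.tendsto[OF bounded_bilinear_matrix_vector_mult]) auto
  moreover have "(\<lambda>k. f0_quot (wk k) (t k) + (\<gamma> + ell * norm (F_quot (wk k) (t k) - sk k)))
      \<longlonglongrightarrow> grad f0 x \<bullet> w' + hessq f0 x d + (\<gamma> + ell * norm (A *v w' + q - s))"
    by (intro tendsto_intros tendsto_f0_quot tendsto_F_quot t wk sk)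
  ultimately have "grad f0 x \<bullet> w' + \<mu> \<bullet> (A *v w') + (norm (d + (0 / 2) *\<^sub>R w'))\<^sup>2 / \<kappa>
      \<le> grad f0 x \<bullet> w' + hessq f0 x d + (\<gamma> + ell * norm (A *v w' + q - s))"
    by (intro tendsto_le[OF sequentially_bot])
  then show thesis
    using w' by (intro that) auto
qed

definition penalty :: real where
  "penalty = ell * (onorm ((*v) A) * \<kappa>0 + 1) + norm \<mu> * (onorm ((*v) A) * \<kappa>0)"

lemma ell_nonneg: "0 \<le> ell"
  using lipschitz by (rule lipschitz_on_nonneg)

lemma penalty_nonneg: "0 \<le> penalty"
  unfolding penalty_def using ell_nonneg kappa0
  by (intro add_nonneg_nonneg mult_nonneg_nonneg onorm_pos_le matrix_vector_mul_bounded_linear) auto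

lemma correction_cost:
  assumes w': "norm (w' - w) \<le> \<kappa>0 * norm (A *v w + q - s)"
  shows "ell * norm (A *v w' + q - s) + (\<mu> \<bullet> (A *v w) - \<mu> \<bullet> (A *v w')) \<le> penalty * norm (A *v w + q - s)"
proof -
  define n where "n = norm (A *v w + q - s)"
  define K where "K = onorm ((*v) A) * \<kappa>0"
  have "norm (A *v (w' - w)) \<le> onorm ((*v) A) * norm (w' - w)"
    by (rule onorm[OF matrix_vector_mul_bounded_linear])
  also have "\<dots> \<le> K * n"
    unfolding K_def n_def mult.assoc
    by (intro mult_left_mono w' onorm_pos_le matrix_vector_mul_bounded_linear)
  finally have step: "norm (A *v (w' - w)) \<le> K * n" .
  have "A *v w' + q - s = A *v (w' - w) + (A *v w + q - s)"
    by (simp add: algebra_simps)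
  then have "norm (A *v w' + q - s) \<le> norm (A *v (w' - w)) + n"
    unfolding n_def by (metis norm_triangle_ineq)
  then have "ell * norm (A *v w' + q - s) \<le> ell * (K * n + n)"
    using step ell_nonneg by (intro mult_left_mono) auto
  moreover have "\<mu> \<bullet> (A *v w) - \<mu> \<bullet> (A *v w') \<le> norm \<mu> * (K * n)"
  proof -
    have "\<mu> \<bullet> (A *v w) - \<mu> \<bullet> (A *v w') = - (\<mu> \<bullet> (A *v (w' - w)))"
      by (simp add: matrix_vector_mult_diff_distrib inner_diff_right)
    also have "\<dots> \<le> norm \<mu> * norm (A *v (w' - w))"
      using Cauchy_Schwarz_ineq2[of \<mu> "A *v (w' - w)"] by linarith
    also have "\<dots> \<le> norm \<mu> * (K * n)"
      using step by (intro mult_left_mono) auto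
    finally show ?thesis .
  qed
  ultimately have "ell * norm (A *v w' + q - s) + (\<mu> \<bullet> (A *v w) - \<mu> \<bullet> (A *v w'))
      \<le> ell * (K * n + n) + norm \<mu> * (K * n)"
    by (rule add_mono)
  also have "\<dots> = penalty * n"
    by (simp add: penalty_def K_def algebra_simps)
  finally show ?thesis
    unfolding n_def .
qed

lemma penalized_growth:
  assumes "\<psi> s \<le> ereal \<gamma>"
  shows "(norm d)\<^sup>2 / \<kappa> - hessq f0 x d \<le> \<gamma> - \<mu> \<bullet> (A *v w) + penalty * norm (s - q - A *v w)"
proof (rule field_le_epsilon)
  fix e :: real assume "0 < e"
  then have "\<psi> s < ereal (\<gamma> + e)"
    using assms by (auto intro: le_less_trans)
  then obtain w' where w': "norm (w' - w) \<le> \<kappa>0 * norm (A *v w + q - s)"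
    and "\<mu> \<bullet> (A *v w') + (norm d)\<^sup>2 / \<kappa> \<le> hessq f0 x d + (\<gamma> + e) + ell * norm (A *v w' + q - s)"
    by (rule parabolic_growth)
  then have "(norm d)\<^sup>2 / \<kappa> - hessq f0 x d \<le> \<gamma> + e - \<mu> \<bullet> (A *v w) + penalty * norm (A *v w + q - s)"
    using correction_cost[OF w'] by linarith
  moreover have "norm (A *v w + q - s) = norm (s - q - A *v w)"
    by (subst norm_minus_commute) (simp add: algebra_simps)
  ultimately show "(norm d)\<^sup>2 / \<kappa> - hessq f0 x d
      \<le> \<gamma> - \<mu> \<bullet> (A *v w) + penalty * norm (s - q - A *v w) + e"
    by simp
qed

definition perturbed_epigraph :: "((real^'m) \<times> real) set" where
  "perturbed_epigraph = {(s - q - A *v w, \<gamma> - \<mu> \<bullet> (A *v w)) | s w \<gamma>. \<psi> s \<le> ereal \<gamma>}"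

lemma convex_perturbed_epigraph:
  assumes "econvex \<psi>"
  shows "convex perturbed_epigraph"
  unfolding convex_alt
proof (intro ballI allI impI, elim conjE)
  fix e1 e2 and u :: real
  assume e: "e1 \<in> perturbed_epigraph" "e2 \<in> perturbed_epigraph" and u: "0 \<le> u" "u \<le> 1"
  obtain s1 w1 \<gamma>1 where e1: "e1 = (s1 - q - A *v w1, \<gamma>1 - \<mu> \<bullet> (A *v w1))" "\<psi> s1 \<le> ereal \<gamma>1"
    using e(1) unfolding perturbed_epigraph_def by blast
  obtain s2 w2 \<gamma>2 where e2: "e2 = (s2 - q - A *v w2, \<gamma>2 - \<mu> \<bullet> (A *v w2))" "\<psi> s2 \<le> ereal \<gamma>2"
    using e(2) unfolding perturbed_epigraph_def by blast
  have "(1 - u) *\<^sub>R e1 + u *\<^sub>R e2 =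
      (((1 - u) *\<^sub>R s1 + u *\<^sub>R s2) - q - A *v ((1 - u) *\<^sub>R w1 + u *\<^sub>R w2),
       ((1 - u) * \<gamma>1 + u * \<gamma>2) - \<mu> \<bullet> (A *v ((1 - u) *\<^sub>R w1 + u *\<^sub>R w2)))"
    unfolding e1 e2 by (simp add: algebra_simps inner_add_right inner_diff_right)
  then show "(1 - u) *\<^sub>R e1 + u *\<^sub>R e2 \<in> perturbed_epigraph"
    unfolding perturbed_epigraph_def using econvexD[OF assms e1(2) e2(2) u] by blast
qed

lemma multiplier_exists:
  assumes epi: "parab_epi_diff g (F x) (A *v d)"
  obtains \<eta> where "\<And>s w \<gamma>. \<psi> s \<le> ereal \<gamma> \<Longrightarrow>
    (norm d)\<^sup>2 / \<kappa> - hessq f0 x d + \<eta> \<bullet> (s - q - A *v w) \<le> \<gamma> - \<mu> \<bullet> (A *v w)"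
proof -
  have "convex perturbed_epigraph"
    by (intro convex_perturbed_epigraph econvex_parab_subderiv[of g, OF g_convex g_finite[OF F_x_edom] epi])
  moreover obtain s \<gamma> where "\<psi> s < ereal \<gamma>"
    using parab_epi_diff_finite[OF epi] .
  then have "perturbed_epigraph \<noteq> {}"
    using less_imp_le unfolding perturbed_epigraph_def by blast
  moreover have "(norm d)\<^sup>2 / \<kappa> - hessq f0 x d \<le> \<beta> + penalty * norm p"
    if "(p, \<beta>) \<in> perturbed_epigraph" for p \<beta>
    using that penalized_growth unfolding perturbed_epigraph_def by blast
  ultimately obtain \<eta> where
      "\<And>p \<beta>. (p, \<beta>) \<in> perturbed_epigraph \<Longrightarrow> (norm d)\<^sup>2 / \<kappa> - hessq f0 x d + \<eta> \<bullet> p \<le> \<beta>"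
    using exact_penalty_imp_affine_minorant[OF _ _ penalty_nonneg] by metis
  then show thesis
    unfolding perturbed_epigraph_def by (intro that[of \<eta>]) blast
qed

lemma multiplier_mem_Lambda:
  assumes epi: "parab_epi_diff g (F x) (A *v d)"
    and minorant: "\<And>s w \<gamma>. \<psi> s \<le> ereal \<gamma> \<Longrightarrow> c + \<eta> \<bullet> (s - q - A *v w) \<le> \<gamma> - \<mu> \<bullet> (A *v w)"
  shows "\<eta> \<in> Lambda g F x (transpose A *v \<mu>)"
proof -
  have "\<eta> \<in> subdiff g (F x)"
  proof (rule subdiff_of_parab_subderiv_minorant[of g, OF g_convex g_finite[OF F_x_edom] epi])
    show "(c - \<eta> \<bullet> q) + \<eta> \<bullet> s \<le> \<gamma>" if "\<psi> s \<le> ereal \<gamma>" for s \<gamma>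
      using minorant[OF that, of 0] by (simp add: inner_diff_right)
  qed
  moreover have "transpose A *v \<mu> = transpose A *v \<eta>"
  proof -
    obtain s \<gamma> where s: "\<psi> s < ereal \<gamma>"
      using parab_epi_diff_finite[OF epi] .
    have nonneg: "0 \<le> (\<eta> - \<mu>) \<bullet> (A *v w)" for w
    proof (rule nonneg_if_multiples_bounded_below)
      fix r :: real
      show "c + \<eta> \<bullet> (s - q) - \<gamma> \<le> r * ((\<eta> - \<mu>) \<bullet> (A *v w))"
        using minorant[OF less_imp_le[OF s], of "r *\<^sub>R w"]
        by (simp add: matrix_vector_mult_scaleR inner_diff_left inner_diff_right algebra_simps)
    qed
    have "(transpose A *v \<mu> - transpose A *v \<eta>) \<bullet> w = 0" for w
      using nonneg[of w] nonneg[of "- w"] unfolding inner_diff_left transpose_mult_inner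
      by (simp add: bounded_bilinear.minus_right[OF bounded_bilinear_matrix_vector_mult] inner_diff_left)
    then show ?thesis
      by (metis eq_iff_diff_eq_0 inner_eq_zero_iff)
  qed
  ultimately show ?thesis
    by (simp add: Lambda_def)
qed

lemma subderiv2_ge:
  assumes reg: "parab_regular g (F x) \<mu>" and epi: "parab_epi_diff g (F x) (A *v d)"
    and fin: "subderiv2 g (F x) \<mu> (A *v d) < \<infinity>"
    and unique: "\<exists>a. Lambda g F x (transpose A *v \<mu>) = {a}"
  shows "ereal ((norm d)\<^sup>2 / \<kappa> - hessq_lagrangian f0 F x \<mu> d) \<le> subderiv2 g (F x) \<mu> (A *v d)"
proof -
  obtain \<eta> where minorant: "\<And>s w \<gamma>. \<psi> s \<le> ereal \<gamma> \<Longrightarrow>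
      (norm d)\<^sup>2 / \<kappa> - hessq f0 x d + \<eta> \<bullet> (s - q - A *v w) \<le> \<gamma> - \<mu> \<bullet> (A *v w)"
    by (rule multiplier_exists[OF epi]) blast
  have "\<eta> \<in> Lambda g F x (transpose A *v \<mu>)"
    using epi minorant by (rule multiplier_mem_Lambda)
  moreover have "\<mu> \<in> Lambda g F x (transpose A *v \<mu>)"
    using mu by (simp add: Lambda_def)
  ultimately have "\<eta> = \<mu>"
    using unique by auto
  have "ereal ((norm d)\<^sup>2 / \<kappa> - hessq_lagrangian f0 F x \<mu> d) \<le> (INF s. \<psi> s - ereal (\<mu> \<bullet> s))"
  proof (rule INF_greatest, rule ereal_le_real)
    fix s \<gamma> assume "\<psi> s - ereal (\<mu> \<bullet> s) \<le> ereal \<gamma>"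
    then have "\<psi> s \<le> ereal (\<gamma> + \<mu> \<bullet> s)"
      by (cases "\<psi> s") auto
    from minorant[OF this, of 0]
    show "ereal ((norm d)\<^sup>2 / \<kappa> - hessq_lagrangian f0 F x \<mu> d) \<le> ereal \<gamma>"
      by (simp add: \<open>\<eta> = \<mu>\<close> hessq_lagrangian_def inner_diff_right)
  qed
  also have "\<dots> = subderiv2 g (F x) \<mu> (A *v d)"
    using reg fin unfolding parab_regular_def by blast
  finally show ?thesis .
qed

end

section \<open>The second-order condition\<close>

context composite_growth
begin

lemma second_order_inequality:
  assumes lsc: "lsc g" and reg: "parab_regular g (F x) \<mu>"
    and epi: "\<And>d. subderiv g (F x) d = ereal (\<mu> \<bullet> d) \<Longrightarrow> parab_epi_diff g (F x) d"
    and normal: "(z, - (jac F x *v v)) \<in> frechet_normal (gph_subdiff g) (F x, \<mu>)"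
    and unique: "\<exists>a. Lambda g F x (transpose (jac F x) *v \<mu>) = {a}"
  shows "(norm v)\<^sup>2 / \<kappa> \<le> hessq_lagrangian f0 F x \<mu> v + z \<bullet> (jac F x *v v)"
proof -
  have neg: "jac F x *v (- v) = - (jac F x *v v)"
    by (rule bounded_bilinear.minus_right[OF bounded_bilinear_matrix_vector_mult])
  have "twice_epi_diff g (F x) \<mu>"
    using mu reg epi by (rule parab_regular_imp_twice_epi_diff)
  then have upper: "subderiv2 g (F x) \<mu> (jac F x *v (- v)) \<le> ereal (z \<bullet> (jac F x *v v))"
    using subderiv2_le_inner_frechet_normal[OF lsc g_convex mu _ normal] by (simp add: neg)
  then have fin: "subderiv2 g (F x) \<mu> (jac F x *v (- v)) < \<infinity>"
    by (rule le_less_trans) simp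
  have critical: "subderiv g (F x) (jac F x *v (- v)) = ereal (\<mu> \<bullet> (jac F x *v (- v)))"
    using mu fin by (rule subderiv_eq_of_subderiv2_finite)
  then interpret composite_growth_direction f0 F g x \<mu> \<kappa> \<kappa>0 ell U V "- v"
    by unfold_locales
  have "ereal ((norm v)\<^sup>2 / \<kappa> - hessq_lagrangian f0 F x \<mu> v) \<le> subderiv2 g (F x) \<mu> (jac F x *v (- v))"
    using subderiv2_ge[OF reg epi[OF critical] fin unique] by (simp add: hessq_lagrangian_minus f0 F)
  from order_trans[OF this upper] show ?thesis
    by simp
qed

end

lemma eventually_composite_growth:
  fixes F :: "real^'n \<Rightarrow> real^'m"
  assumes f0: "C2_fun f0" and F: "C2_map F" and g: "proper g" "econvex g" and xb: "F xb \<in> edom g"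
    and tilt: "tilt_stable (composite f0 F g) xb \<kappa>" "0 < \<kappa>"
    and V: "open V" "F xb \<in> V" "ell-lipschitz_on (V \<inter> edom g) (\<lambda>y. real_of_ereal (g y))"
    and U: "open U" "xb \<in> U" "metric_subregular_on F (edom g) \<kappa>0 U" "0 < \<kappa>0"
    and stationary: "grad_lagrangian f0 F xb \<mu> = 0"
    and xk: "xk \<longlonglongrightarrow> xb" and \<mu>k: "\<mu>k \<longlonglongrightarrow> \<mu>" and sub: "\<And>k. \<mu>k k \<in> subdiff g (F (xk k))"
  shows "\<forall>\<^sub>F k in sequentially. composite_growth f0 F g (xk k) (\<mu>k k) \<kappa> \<kappa>0 ell U V"
proof -
  obtain B where B: "0 < B" "\<And>k. norm (\<mu>k k) \<le> B"
    using convergent_imp_bounded[OF \<mu>k] by (auto simp: bounded_pos)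
  obtain \<eta> where "0 < \<eta>" and \<eta>: "\<And>x \<nu>. norm (x - xb) < \<eta> \<Longrightarrow> \<nu> \<in> subdiff g (F x) \<Longrightarrow> norm \<nu> \<le> B \<Longrightarrow>
      norm (grad_lagrangian f0 F x \<nu>) < \<eta> \<Longrightarrow>
      \<exists>\<rho>>0. quadratic_minorant (composite f0 F g) (ball x \<rho>) x (grad_lagrangian f0 F x \<nu>) (1 / (2 * \<kappa>))"
    by (rule composite_tilt_stable_growth[OF f0 F g(1) xb tilt less_imp_le[OF B(1)]]) blast
  have "(\<lambda>k. F (xk k)) \<longlonglongrightarrow> F xb"
    using has_derivative_continuous[OF C2_map_has_derivative[OF F]] xk by (rule isCont_tendsto_compose)
  then have "\<forall>\<^sub>F k in sequentially. F (xk k) \<in> V"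
    using V(1,2) by (rule topological_tendstoD)
  moreover have "\<forall>\<^sub>F k in sequentially. xk k \<in> U"
    using xk U(1,2) by (rule topological_tendstoD)
  moreover have "\<forall>\<^sub>F k in sequentially. norm (xk k - xb) < \<eta>"
    using tendstoD[OF xk \<open>0 < \<eta>\<close>] by (simp add: dist_norm)
  moreover have "\<forall>\<^sub>F k in sequentially. norm (grad_lagrangian f0 F (xk k) (\<mu>k k)) < \<eta>"
    using tendstoD[OF tendsto_grad_lagrangian[OF f0 F xk \<mu>k] \<open>0 < \<eta>\<close>] by (simp add: stationary)
  ultimately show ?thesis
  proof eventually_elim
    case (elim k)
    then show ?case
      using f0 F g tilt(2) V(1,3) U(1,3,4) sub[of k] \<eta>[OF _ sub B(2)] by unfold_locales auto
  qed
qed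

theorem limiting_second_order_inequality:
  fixes F :: "real^'n \<Rightarrow> real^'m"
  assumes f0: "C2_fun f0" and F: "C2_map F" and g: "lsc g" "proper g" "econvex g" and xb: "F xb \<in> edom g"
    and tilt: "tilt_stable (composite f0 F g) xb \<kappa>" "0 < \<kappa>"
    and V: "open V" "F xb \<in> V" "ell-lipschitz_on (V \<inter> edom g) (\<lambda>y. real_of_ereal (g y))"
    and U: "open U" "xb \<in> U" "metric_subregular_on F (edom g) \<kappa>0 U" "0 < \<kappa>0"
    and regular: "\<forall>\<^sub>F x in nhds xb. \<forall>\<nu>\<in>subdiff g (F x). parab_regular g (F x) \<nu> \<and>
      (\<forall>d. subderiv g (F x) d = ereal (\<nu> \<bullet> d) \<longrightarrow> parab_epi_diff g (F x) d)"
    and stationary: "grad_lagrangian f0 F xb \<mu> = 0"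
    and xk: "xk \<longlonglongrightarrow> xb" and \<mu>k: "\<mu>k \<longlonglongrightarrow> \<mu>" and zk: "zk \<longlonglongrightarrow> z" and vk: "vk \<longlonglongrightarrow> v"
    and sub: "\<And>k. \<mu>k k \<in> subdiff g (F (xk k))"
    and normal: "\<And>k. (zk k, - (jac F (xk k) *v vk k)) \<in> frechet_normal (gph_subdiff g) (F (xk k), \<mu>k k)"
    and unique: "\<And>k. \<exists>a. Lambda g F (xk k) (transpose (jac F (xk k)) *v \<mu>k k) = {a}"
  shows "(norm v)\<^sup>2 / \<kappa> \<le> hessq_lagrangian f0 F xb \<mu> v + z \<bullet> (jac F xb *v v)"
proof (rule tendsto_le[OF sequentially_bot])
  have "\<forall>\<^sub>F k in sequentially. composite_growth f0 F g (xk k) (\<mu>k k) \<kappa> \<kappa>0 ell U V"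
    by (rule eventually_composite_growth[OF f0 F g(2,3) xb tilt V U stationary xk \<mu>k sub])
  moreover have "\<forall>\<^sub>F k in sequentially. \<forall>\<nu>\<in>subdiff g (F (xk k)). parab_regular g (F (xk k)) \<nu> \<and>
      (\<forall>d. subderiv g (F (xk k)) d = ereal (\<nu> \<bullet> d) \<longrightarrow> parab_epi_diff g (F (xk k)) d)"
    using regular xk by (rule eventually_compose_filterlim)
  ultimately show "\<forall>\<^sub>F k in sequentially. (norm (vk k))\<^sup>2 / \<kappa>
      \<le> hessq_lagrangian f0 F (xk k) (\<mu>k k) (vk k) + zk k \<bullet> (jac F (xk k) *v vk k)"
  proof eventually_elim
    case (elim k)
    then show ?case
      using sub by (intro composite_growth.second_order_inequality[OF elim(1) g(1) _ _ normal unique]) auto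
  qed
  show "(\<lambda>k. (norm (vk k))\<^sup>2 / \<kappa>) \<longlonglongrightarrow> (norm v)\<^sup>2 / \<kappa>"
    using tilt(2) by (intro tendsto_intros vk) auto
  show "(\<lambda>k. hessq_lagrangian f0 F (xk k) (\<mu>k k) (vk k) + zk k \<bullet> (jac F (xk k) *v vk k))
      \<longlonglongrightarrow> hessq_lagrangian f0 F xb \<mu> v + z \<bullet> (jac F xb *v v)"
    by (intro tendsto_add tendsto_inner tendsto_hessq_lagrangian f0 F xk \<mu>k vk zk
        bounded_bilinear.tendsto[OF bounded_bilinear_matrix_vector_mult] C2_map_tendsto_jac)
qed

lemma Lambda_dir_stationary:
  assumes "\<mu> \<in> Lambda_dir g F x (- grad f0 x) w"
  shows "\<mu> \<in> subdiff g (F x)" "grad_lagrangian f0 F x \<mu> = 0"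
proof -
  have "- grad f0 x = transpose (jac F x) *v \<mu>"
    using assms unfolding Lambda_dir_def Lambda_def by blast
  then show "grad_lagrangian f0 F x \<mu> = 0"
    unfolding grad_lagrangian_def by (rule neg_eq_iff_add_eq_0[THEN iffD1])
qed (use assms in \<open>simp add: Lambda_dir_def Lambda_def\<close>)

theorem theorem4p6:
  fixes f0 :: "real^'n \<Rightarrow> real" and F :: "real^'n \<Rightarrow> real^'m" and g :: "real^'m \<Rightarrow> ereal"
    and xb :: "real^'n" and \<kappa> \<kappa>0 ell :: real and Wbar :: "real^'m \<Rightarrow> real^'m^'m"
  assumes f0_C2: "C2_fun f0" and F_C2: "C2_map F"
    and g_lsc: "lsc g" and g_proper: "proper g" and g_convex: "econvex g"
    and xb_dom: "xb \<in> edom (\<lambda>x. g (F x))"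
    and kappa_pos: "\<kappa> > 0"
    and tilt: "tilt_stable (\<lambda>x. ereal (f0 x) + g (F x)) xb \<kappa>"
    and KKT: "\<exists>\<mu>\<in>subdiff g (F xb). grad f0 xb + transpose (jac F xb) *v \<mu> = 0"
    and A1: "\<exists>\<epsilon>>0. \<forall>x\<in>ball xb \<epsilon>. \<forall>\<mu>\<in>subdiff g (F x).
               parab_regular g (F x) \<mu> \<and>
               (\<forall>d. subderiv g (F x) d = ereal (\<mu> \<bullet> d) \<longrightarrow> parab_epi_diff g (F x) d)"
    and ell_nonneg: "ell \<ge> 0"
    and A2_lip: "\<exists>\<epsilon>>0. \<forall>y\<in>ball (F xb) \<epsilon> \<inter> edom g. \<forall>y'\<in>ball (F xb) \<epsilon> \<inter> edom g.
               \<bar>real_of_ereal (g y) - real_of_ereal (g y')\<bar> \<le> ell * dist y y'"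
    and kappa0_pos: "\<kappa>0 > 0"
    and A2_metric: "\<exists>U. open U \<and> xb \<in> U \<and> (\<forall>x'\<in>U.
               infdist x' (edom (\<lambda>x. g (F x))) \<le> \<kappa>0 * infdist (F x') (edom g))"
    and A3: "\<forall>\<mu>\<in>subdiff g (F xb).
               Wbar \<mu> \<in> Bsubdiff (prox g) (F xb + \<mu>) \<and>
               (\<Union>V\<in>Clarke_jac (prox g) (F xb + \<mu>). rge V) = rge (Wbar \<mu>) \<and>
               (\<forall>y\<in>(\<Union>V\<in>Clarke_jac (prox g) (F xb + \<mu>). rge V). \<exists>zb. y = Wbar \<mu> *v zb \<and>
                  (INF zV \<in> {(z, V). V \<in> Clarke_jac (prox g) (F xb + \<mu>) \<and> y = V *v z}.
                      ereal (y \<bullet> (fst zV - y))) = ereal (y \<bullet> (zb - y)) \<and>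
                  y \<bullet> (zb - y) = y \<bullet> ((pinv (Wbar \<mu>) - mat 1) *v y))"
    and A4: "\<forall>w\<in>crit_cone g F xb (- grad f0 xb). w \<noteq> 0 \<longrightarrow>
               (\<forall>\<mu>\<in>Lambda_dir g F xb (- grad f0 xb) w \<inter> cball 0 (tau \<kappa>0 ell F xb (- grad f0 xb)).
                 \<forall>v. jac F xb *v v \<in> {u. SOVF g (F xb) \<mu> u < \<infinity>} \<longrightarrow>
                   (\<exists>xk \<mu>k zk vk. xk \<longlonglongrightarrow> xb \<and> \<mu>k \<longlonglongrightarrow> \<mu> \<and>
                      (\<forall>k. \<mu>k k \<in> subdiff g (F (xk k))) \<and>
                      zk \<longlonglongrightarrow> (pinv (Wbar \<mu>) - mat 1) *v (jac F xb *v v) \<and>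
                      vk \<longlonglongrightarrow> v \<and>
                      (\<forall>k. (zk k, - (jac F (xk k) *v vk k))
                             \<in> frechet_normal (gph_subdiff g) (F (xk k), \<mu>k k)) \<and>
                      (\<forall>k. \<exists>a. Lambda g F (xk k) (transpose (jac F (xk k)) *v \<mu>k k) = {a})))"
  shows "\<forall>\<mu>\<in>(\<Union>w\<in>crit_cone g F xb (- grad f0 xb) - {0}. Lambda_dir g F xb (- grad f0 xb) w)
              \<inter> cball 0 (tau \<kappa>0 ell F xb (- grad f0 xb)).
           \<forall>v. v \<noteq> 0 \<and> jac F xb *v v \<in> (\<Union>V\<in>Clarke_jac (prox g) (F xb + \<mu>). rge V) \<longrightarrow>
             ereal (hessq f0 xb v + \<mu> \<bullet> d2F F xb v) + SOVF g (F xb) \<mu> (jac F xb *v v)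
               \<ge> ereal ((1 / \<kappa>) * (norm v)\<^sup>2)"
proof (rule ballI, elim IntE UN_E, intro allI impI, elim conjE)
  fix \<mu> v w
  assume w: "w \<in> crit_cone g F xb (- grad f0 xb) - {0}" "\<mu> \<in> Lambda_dir g F xb (- grad f0 xb) w"
    and \<mu>: "\<mu> \<in> cball 0 (tau \<kappa>0 ell F xb (- grad f0 xb))"
    and v: "jac F xb *v v \<in> (\<Union>V\<in>Clarke_jac (prox g) (F xb + \<mu>). rge V)"
  define z where "z = (pinv (Wbar \<mu>) - mat 1) *v (jac F xb *v v)"
  note stationary = Lambda_dir_stationary[OF w(2)]
  have sovf: "SOVF g (F xb) \<mu> (jac F xb *v v) = ereal (z \<bullet> (jac F xb *v v))"
    using A3[THEN bspec, OF stationary(1), THEN conjunct2, THEN conjunct2, THEN bspec, OF v] v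
    by (auto simp: SOVF_def z_def inner_commute)
  then obtain xk \<mu>k zk vk where seq: "xk \<longlonglongrightarrow> xb" "\<mu>k \<longlonglongrightarrow> \<mu>" "zk \<longlonglongrightarrow> z" "vk \<longlonglongrightarrow> v"
      "\<And>k. \<mu>k k \<in> subdiff g (F (xk k))"
      "\<And>k. (zk k, - (jac F (xk k) *v vk k)) \<in> frechet_normal (gph_subdiff g) (F (xk k), \<mu>k k)"
      "\<And>k. \<exists>a. Lambda g F (xk k) (transpose (jac F (xk k)) *v \<mu>k k) = {a}"
    using A4[rule_format, of w \<mu> v] w \<mu> unfolding z_def by auto
  obtain \<epsilon> where V: "0 < \<epsilon>" "ell-lipschitz_on (ball (F xb) \<epsilon> \<inter> edom g) (\<lambda>y. real_of_ereal (g y))"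
    using A2_lip ell_nonneg unfolding lipschitz_on_def dist_real_def by blast
  obtain U where U: "open U" "xb \<in> U" "metric_subregular_on F (edom g) \<kappa>0 U"
    using A2_metric unfolding metric_subregular_on_def by (auto simp: edom_def vimage_def)
  have "\<forall>\<^sub>F x in nhds xb. \<forall>\<nu>\<in>subdiff g (F x). parab_regular g (F x) \<nu> \<and>
      (\<forall>d. subderiv g (F x) d = ereal (\<nu> \<bullet> d) \<longrightarrow> parab_epi_diff g (F x) d)"
    using A1 by (auto simp: eventually_nhds_metric dist_commute)
  then have "(norm v)\<^sup>2 / \<kappa> \<le> hessq_lagrangian f0 F xb \<mu> v + z \<bullet> (jac F xb *v v)"
    using xb_dom tilt V(1)
    by (intro limiting_second_order_inequality[OF f0_C2 F_C2 g_lsc g_proper g_convex _ _ kappa_pos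
          open_ball _ V(2) U kappa0_pos _ stationary(2) seq])
      (auto simp: composite_def[abs_def] edom_def)
  then show "ereal (hessq f0 xb v + \<mu> \<bullet> d2F F xb v) + SOVF g (F xb) \<mu> (jac F xb *v v)
      \<ge> ereal ((1 / \<kappa>) * (norm v)\<^sup>2)"
    by (simp add: sovf hessq_lagrangian_def)
qed

end
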